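(* Let $n\ge1$ and let $\mathcal{L}$ be a collection of non-empty geometric subspaces of $X^n$, $X^n\in\{E^n,H^n,S^n\}$, with $X^n\in\mathcal L$, that is generated by points and also generated by hyperplanes. Then: (i) If $X^n=E^n$, the canonical map $\mathrm{Pt}^{\mathcal L}(E^n)\to\mathrm{Ls}^{\mathcal L}(E^n)$ is an isomorphism. (ii) If $X^n=H^n$, the canonical map $\mathrm{Pt}^{\mathcal L}(H^n)\to\mathrm{Ls}^{\mathcal L}(H^n)$ is an isomorphism. (iii) If $X^n=S^n$, the canonical map $\mathrm{Pt}^{\mathcal L}(S^n)\to\mathrm{Ls}^{\mathcal L}(S^n)$ is surjective, and its kernel is generated by (the classes of) joins of the form $\{x,-x\}*P$, where $\{x,-x\}\in\mathcal{L}^0$ and $P$ is an $(n-1)$-simplex with vertices in $\mathcal{L}^0$.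
   Context: Geometries: $E^n=\{x\in\mathbb{R}^{n+1}: x_0=1\}$; $H^n=\{x\in\mathbb{R}^{n+1}: -x_0^2+\sum_{i=1}^n x_i^2=-1,\ x_0>0\}$; $S^n$ the unit sphere in $\mathbb{R}^{n+1}$. A geometric subspace is the intersection of $X^n$ with a linear subspace of $\mathbb{R}^{n+1}$; a hyperplane is an $(n-1)$-dimensional one; the "points" (dimension $0$) in $S^n$ are pairs of antipodal points. $\mathcal{L}^k$ denotes the $k$-dimensional elements of $\mathcal{L}$. The span of a set is the smallest geometric subspace containing it. $\mathcal{L}$ is generated by points if it is the set of all non-empty spans of finite collections of elements of $\mathcal{L}^0$; it is generated by hyperplanes if it is the set of all non-empty intersections of finitely many elements of $\mathcal{L}^{n-1}$ ($X^n$ being the empty intersection). A convex $\mathcal{L}$-polytope is a bounded subset of $X^n$, not contained in a proper geometric subspace, that is an intersection of $X^n$ with finitely many closed half-spaces of $\mathbb{R}^{n+1}$ bounded by hyperplanes in $\mathcal{L}^{n-1}$. An $\mathcal{L}$-polytope is a finite union of convex ones. A subdivision of $P$ is a finite collection of $\mathcal{L}$-polytopes with disjoint interiors and union $P$. $\mathrm{Pt}^{\mathcal L}(X^n)$ is the free abelian group on symbols $[P]$, $P$ an $\mathcal{L}$-polytope, modulo $[P]=\sum_i[P_i]$ for every subdivision $\{P_i\}$ of $P$. $\mathrm{Ls}^{\mathcal L}(X^n)$ is the free abelian group on $(n+1)$-tuples of elements of $\mathcal{L}^0$, modulo all tuples lying in a proper geometric subspace of dimension at most $n-1$, and modulo $\sum_{i=0}^{n+1}(-1)^i(y_0,\dots,\widehat{y_i},\dots,y_{n+1})$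 for all $(n+2)$-tuples of elements of $\mathcal{L}^0$. Fix an orientation of $X^n$. The canonical map $\mathrm{Pt}^{\mathcal L}(X^n)\to\mathrm{Ls}^{\mathcal L}(X^n)$ is the unique homomorphism sending the class of every $n$-simplex with vertices in $\mathcal{L}^0$ (in $S^n$: with each vertex $v$ satisfying $\{v,-v\}\in\mathcal{L}^0$) to its tuple of vertices (in $S^n$: of antipodal pairs of vertices), ordered so as to agree with the orientation of $X^n$; such a map exists and is unique. In (iii), $P\subseteq S^n$ is the spherical simplex spanned by $n$ linearly independent unit vectors $v_i$ with $\{v_i,-v_i\}\in\mathcal{L}^0$, and $\{x,-x\}*P$ is the union of all points $((1-t)(\pm x)+tp)/\|(1-t)(\pm x)+tp\|$, $t\in[0,1]$, $p\in P$, where $x\notin\operatorname{span}P$ so that the join is an $n$-dimensional $\mathcal{L}$-polytope. *)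

theory Defs
  imports "HOL-Analysis.Analysis" "HOL-Algebra.Free_Abelian_Groups" "HOL-Algebra.Generated_Groups"
begin

section \<open>Geometries\<close>

text \<open>
  For \<open>n = CARD('n) \<ge> 1\<close> the ambient space \<open>\<real>\<^sup>n\<^sup>+\<^sup>1\<close> is \<^typ>\<open>real ^ 'n option\<close>;
  \<^term>\<open>None\<close> indexes the coordinate \<open>x\<^sub>0\<close> and \<^term>\<open>Some i\<close> the other \<open>n\<close> coordinates.
\<close>

datatype geometry = Euclidean | Hyperbolic | Spherical

fun model_space :: "geometry \<Rightarrow> (real ^ 'n::finite option) set" where
  "model_space Euclidean = {x. x $ None = 1}"
| "model_space Hyperbolic =
     {x. - (x $ None)\<^sup>2 + (\<Sum>i\<in>UNIV. (x $ Some i)\<^sup>2) = -1 \<and> x $ None > 0}"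
| "model_space Spherical = sphere 0 1"

definition geometric_subspace :: "geometry \<Rightarrow> (real ^ 'n::finite option) set \<Rightarrow> bool" where
  "geometric_subspace g A \<longleftrightarrow> (\<exists>V. subspace V \<and> A = model_space g \<inter> V)"

text \<open>
  If \<open>A = X\<^sup>n \<inter> V\<close> is non-empty, then \<open>A\<close> spans a linear subspace cutting out the same \<open>A\<close>,
  and the dimension of \<open>A\<close> is one less than the linear dimension of that span.
  In particular pairs of antipodal points of \<open>S\<^sup>n\<close> have dimension 0; the empty set gets \<open>-1\<close>.
\<close>

definition gdim :: "(real ^ 'n::finite option) set \<Rightarrow> int" where
  "gdim A = int (dim A) - 1"

definition level :: "(real ^ 'n::finite option) set set \<Rightarrow> int \<Rightarrow> (real ^ 'n option) set set" where
  "level L k = {A \<in> L. gdim A = k}"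

abbreviation points :: "(real ^ 'n::finite option) set set \<Rightarrow> (real ^ 'n option) set set" where
  "points L \<equiv> level L 0"

abbreviation hyperplanes :: "(real ^ 'n::finite option) set set \<Rightarrow> (real ^ 'n option) set set" where
  "hyperplanes L \<equiv> level L (int CARD('n) - 1)"

definition gspan :: "geometry \<Rightarrow> (real ^ 'n::finite option) set \<Rightarrow> (real ^ 'n option) set" where
  "gspan g S = \<Inter>{A. geometric_subspace g A \<and> S \<subseteq> A}"

definition generated_by_points :: "geometry \<Rightarrow> (real ^ 'n::finite option) set set \<Rightarrow> bool" where
  "generated_by_points g L \<longleftrightarrow>
     L = {gspan g (\<Union>F) | F. finite F \<and> F \<subseteq> points L} - {{}}"

definition generated_by_hyperplanes :: "geometry \<Rightarrow> (real ^ 'n::finite option) set set \<Rightarrow> bool" where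
  "generated_by_hyperplanes g L \<longleftrightarrow>
     L = {model_space g \<inter> \<Inter>F | F. finite F \<and> F \<subseteq> hyperplanes L} - {{}}"

section \<open>The polytope group\<close>

definition halfspaces :: "geometry \<Rightarrow> (real ^ 'n::finite option) set set \<Rightarrow> (real ^ 'n option) set set" where
  "halfspaces g L =
     {{x. a \<bullet> x \<le> 0} | a. a \<noteq> 0 \<and> model_space g \<inter> {x. a \<bullet> x = 0} \<in> hyperplanes L}"

text \<open>
  Boundedness may be tested in the ambient Euclidean norm: on \<open>H\<^sup>n\<close> a set is bounded for the
  hyperbolic metric iff the coordinate \<open>x\<^sub>0\<close> is bounded on it.
\<close>

definition convex_polytope :: "geometry \<Rightarrow> (real ^ 'n::finite option) set set \<Rightarrow> (real ^ 'n option) set \<Rightarrow> bool" where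
  "convex_polytope g L P \<longleftrightarrow>
     bounded P \<and>
     (\<forall>A. geometric_subspace g A \<and> P \<subseteq> A \<longrightarrow> A = model_space g) \<and>
     (\<exists>F. finite F \<and> F \<subseteq> halfspaces g L \<and> P = model_space g \<inter> \<Inter>F)"

text \<open>The empty union is allowed; its class is 0, by the subdivision into no pieces.\<close>

definition L_polytopes :: "geometry \<Rightarrow> (real ^ 'n::finite option) set set \<Rightarrow> (real ^ 'n option) set set" where
  "L_polytopes g L = {\<Union>F | F. finite F \<and> (\<forall>P\<in>F. convex_polytope g L P)}"

definition subdivision ::
  "geometry \<Rightarrow> (real ^ 'n::finite option) set set \<Rightarrow> (real ^ 'n option) set \<Rightarrow> (real ^ 'n option) set set \<Rightarrow> bool" where
  "subdivision g L P F \<longleftrightarrow>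
     finite F \<and> F \<subseteq> L_polytopes g L \<and> \<Union>F = P \<and>
     pairwise (\<lambda>Q R. disjnt (top_of_set (model_space g) interior_of Q)
                            (top_of_set (model_space g) interior_of R)) F"

definition Pt_relations ::
  "geometry \<Rightarrow> (real ^ 'n::finite option) set set \<Rightarrow> ((real ^ 'n option) set \<Rightarrow>\<^sub>0 int) set" where
  "Pt_relations g L =
     {frag_of P - (\<Sum>Q\<in>F. frag_of Q) | P F. P \<in> L_polytopes g L \<and> subdivision g L P F}"

definition Pt_null ::
  "geometry \<Rightarrow> (real ^ 'n::finite option) set set \<Rightarrow> ((real ^ 'n option) set \<Rightarrow>\<^sub>0 int) set" where
  "Pt_null g L = generate (free_Abelian_group (L_polytopes g L)) (Pt_relations g L)"

definition Pt ::
  "geometry \<Rightarrow> (real ^ 'n::finite option) set set \<Rightarrow> ((real ^ 'n option) set \<Rightarrow>\<^sub>0 int) set monoid" where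
  "Pt g L = free_Abelian_group (L_polytopes g L) Mod Pt_null g L"

definition Pt_class ::
  "geometry \<Rightarrow> (real ^ 'n::finite option) set set \<Rightarrow> (real ^ 'n option) set \<Rightarrow> ((real ^ 'n option) set \<Rightarrow>\<^sub>0 int) set" where
  "Pt_class g L P = Pt_null g L #>\<^bsub>free_Abelian_group (L_polytopes g L)\<^esub> frag_of P"

section \<open>The group of tuples\<close>

definition tuples :: "(real ^ 'n::finite option) set set \<Rightarrow> nat \<Rightarrow> (real ^ 'n option) set list set" where
  "tuples L m = {ys. length ys = m \<and> set ys \<subseteq> points L}"

definition omit :: "nat \<Rightarrow> 'a list \<Rightarrow> 'a list" where
  "omit i ys = take i ys @ drop (Suc i) ys"

definition degenerate :: "geometry \<Rightarrow> (real ^ 'n::finite option) set list \<Rightarrow> bool" where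
  "degenerate g ys \<longleftrightarrow>
     (\<exists>A. geometric_subspace g A \<and> gdim A \<le> int CARD('n) - 1 \<and> \<Union>(set ys) \<subseteq> A)"

definition Ls_relations ::
  "geometry \<Rightarrow> (real ^ 'n::finite option) set set \<Rightarrow> ((real ^ 'n option) set list \<Rightarrow>\<^sub>0 int) set" where
  "Ls_relations g L =
     {frag_of ys | ys. ys \<in> tuples L (CARD('n) + 1) \<and> degenerate g ys} \<union>
     {(\<Sum>i = 0..CARD('n) + 1. frag_cmul ((-1) ^ i) (frag_of (omit i ys))) | ys.
        ys \<in> tuples L (CARD('n) + 2)}"

definition Ls_null ::
  "geometry \<Rightarrow> (real ^ 'n::finite option) set set \<Rightarrow> ((real ^ 'n option) set list \<Rightarrow>\<^sub>0 int) set" where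
  "Ls_null g L = generate (free_Abelian_group (tuples L (CARD('n) + 1))) (Ls_relations g L)"

definition Ls ::
  "geometry \<Rightarrow> (real ^ 'n::finite option) set set \<Rightarrow> ((real ^ 'n option) set list \<Rightarrow>\<^sub>0 int) set monoid" where
  "Ls g L = free_Abelian_group (tuples L (CARD('n) + 1)) Mod Ls_null g L"

definition Ls_class ::
  "geometry \<Rightarrow> (real ^ 'n::finite option) set set \<Rightarrow> (real ^ 'n option) set list \<Rightarrow> ((real ^ 'n option) set list \<Rightarrow>\<^sub>0 int) set" where
  "Ls_class g L ys = Ls_null g L #>\<^bsub>free_Abelian_group (tuples L (CARD('n) + 1))\<^esub> frag_of ys"

section \<open>The canonical map\<close>

text \<open>
  An orientation of \<open>X\<^sup>n\<close> amounts to one of \<open>\<real>\<^sup>n\<^sup>+\<^sup>1\<close> (put the position vector in front of a tangent frame) and is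
  represented by an ordered basis. The vertices of an \<open>n\<close>-simplex in \<open>X\<^sup>n\<close> agree with it iff, as an
  ordered basis of \<open>\<real>\<^sup>n\<^sup>+\<^sup>1\<close>, they arise from it by a linear map of positive determinant.
\<close>

definition ordered_basis :: "(real ^ 'n::finite option) list \<Rightarrow> bool" where
  "ordered_basis b \<longleftrightarrow> distinct b \<and> independent (set b) \<and> span (set b) = UNIV"

definition agrees_with_orientation ::
  "(real ^ 'n::finite option) list \<Rightarrow> (real ^ 'n option) list \<Rightarrow> bool" where
  "agrees_with_orientation b vs \<longleftrightarrow> (\<exists>f. linear f \<and> det (matrix f) > 0 \<and> vs = map f b)"

fun point_of :: "geometry \<Rightarrow> real ^ 'n::finite option \<Rightarrow> (real ^ 'n option) set" where
  "point_of Spherical v = {v, - v}"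
| "point_of _ v = {v}"

text \<open>
  The simplex spanned by linearly independent vectors of \<open>X\<^sup>n\<close>: the intersection of \<open>X\<^sup>n\<close> with the
  set of their non-negative linear combinations. For \<open>E\<^sup>n\<close> this is the convex hull.
\<close>

definition gsimplex :: "geometry \<Rightarrow> (real ^ 'n::finite option) list \<Rightarrow> (real ^ 'n option) set" where
  "gsimplex g vs = model_space g \<inter> (convex_cone hull set vs)"

text \<open>
  The vertices \<open>vs\<close> below are automatically \<open>n + 1\<close> linearly independent vectors when \<open>b\<close> is an
  ordered basis. Homomorphisms are made unique as functions by fixing them to be
  \<^term>\<open>undefined\<close> outside the carrier.
\<close>

definition canonical_map ::
  "geometry \<Rightarrow> (real ^ 'n::finite option) set set \<Rightarrow> (real ^ 'n option) list \<Rightarrow>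
   ((real ^ 'n option) set \<Rightarrow>\<^sub>0 int) set \<Rightarrow> ((real ^ 'n option) set list \<Rightarrow>\<^sub>0 int) set" where
  "canonical_map g L b =
     (THE \<phi>. \<phi> \<in> hom (Pt g L) (Ls g L) \<and> \<phi> \<in> extensional (carrier (Pt g L)) \<and>
        (\<forall>vs. set vs \<subseteq> model_space g \<and> (\<forall>v\<in>set vs. point_of g v \<in> points L) \<and>
              agrees_with_orientation b vs \<longrightarrow>
              \<phi> (Pt_class g L (gsimplex g vs)) = Ls_class g L (map (point_of g) vs)))"

section \<open>Spherical joins\<close>

definition antipodal_join :: "real ^ 'n::finite option \<Rightarrow> (real ^ 'n option) set \<Rightarrow> (real ^ 'n option) set" where
  "antipodal_join x P =
     {sgn ((1 - t) *\<^sub>R y + t *\<^sub>R p) | t y p. t \<in> {0..1} \<and> y \<in> {x, - x} \<and> p \<in> P}"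

definition join_polytopes :: "(real ^ 'n::finite option) set set \<Rightarrow> (real ^ 'n option) set set" where
  "join_polytopes L =
     {antipodal_join x (gsimplex Spherical vs) | x vs.
        length vs = CARD('n) \<and> distinct vs \<and> independent (set vs) \<and>
        set vs \<subseteq> model_space Spherical \<and> (\<forall>v\<in>set vs. point_of Spherical v \<in> points L) \<and>
        x \<in> model_space Spherical \<and> point_of Spherical x \<in> points L \<and>
        x \<notin> gspan Spherical (gsimplex Spherical vs)}"

end

theory Submission
  imports Defs
begin

text \<open>
  Everything is expressed through indicator functions taken up to finitely many proper linear
  subspaces. A combination of polytopes vanishes in the polytope group iff its indicator function
  vanishes, because all polytopes involved are unions of cells of one hyperplane arrangement; and
  coning pointed cones off a vertex shows that simplices generate all these functions.
  It remains to see which combinations of vertex tuples have vanishing indicator function.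
  The boundary of an \<open>(n + 2)\<close>-tuple has vanishing indicator function as long as the tuple lies in an
  open half-space. Conversely, use these relations to cone a combination of tuples off a point \<open>p\<close>,
  and group the result by the hyperplanes \<open>H\<close> spanned by the remaining \<open>n\<close> points. The jump of
  the indicator function across \<open>H\<close> in direction \<open>p\<close> is the indicator function of the part lying
  in \<open>H\<close>, so by induction on the dimension a combination with vanishing indicator function is a
  consequence of the relations. In the spherical case replacing a vertex by its antipode changes the
  indicator function of a simplex by that of a join, which is where the kernel comes from.
\<close>

section \<open>Integer combinations\<close>

text \<open>All work is done with linear cones in the ambient space, which treats the three
  geometries alike: a simplex is the trace of a simplicial cone and a hyperplane the trace of a
  linear one. The two generation hypotheses enter at opposite ends. Generation by hyperplanes makes
  every vertex of a cell a point of \<open>L\<close>; generation by points puts every facet of a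
  simplex with vertices in \<open>L\<close> into a hyperplane of \<open>L\<close>. The obstacle is
  the sphere, where a tuple records only antipodal pairs, and the alternating sum of signed cones is
  guaranteed to vanish only for representatives in an open half-space. Hence the coning point must
  be \<open>p\<close> for some tuples and \<open>- p\<close> for others. This does no harm: passing
  from \<open>p\<close> to \<open>- p\<close> changes both the orientation of a cone and the side of
  its base on which it lies, so the jump across the base in direction \<open>p\<close> stays the
  same. Both choices also give the same tuple of points, so a single induction on the dimension
  serves all geometries.\<close>

interpretation zmod: module frag_cmul
  by unfold_locales (auto simp: frag_cmul_distrib frag_cmul_distrib2)

text \<open>Turns generated subgroups into integer spans, for which minimality and induction over
  linear combinations are available. Closure under integer multiples comes from integer powers in
  the group.\<close>

lemma generate_free_Abelian_group:
  assumes "R \<subseteq> carrier (free_Abelian_group S)"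
  shows "generate (free_Abelian_group S) R = zmod.span R"
proof
  show "generate (free_Abelian_group S) R \<subseteq> zmod.span R"
  proof
    fix x assume "x \<in> generate (free_Abelian_group S) R"
    then show "x \<in> zmod.span R"
    proof (induction rule: generate.induct)
      case one
      then show ?case by (simp add: zmod.span_zero)
    next
      case (incl h)
      then show ?case by (simp add: zmod.span_base)
    next
      case (inv h)
      then have "Poly_Mapping.keys h \<subseteq> S"
        using subsetD[OF assms] by (metis carrier_free_Abelian_group_iff)
      then show ?case using inv by (simp add: zmod.span_neg zmod.span_base)
    next
      case (eng h1 h2)
      then show ?case by (simp add: zmod.span_add)
    qed
  qed
next
  interpret F: group "free_Abelian_group S" by simp
  have G: "subgroup (generate (free_Abelian_group S) R) (free_Abelian_group S)"
    by (rule F.generate_is_subgroup[OF assms])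
  have pow: "frag_cmul n x \<in> generate (free_Abelian_group S) R"
    if "x \<in> generate (free_Abelian_group S) R" for n x
  proof -
    have "Poly_Mapping.keys x \<subseteq> S"
      using subgroup.mem_carrier[OF G that] by simp
    then show ?thesis
      using F.subgroup_int_pow_closed[OF G that, of n] by simp
  qed
  show "zmod.span R \<subseteq> generate (free_Abelian_group S) R"
  proof (rule zmod.span_minimal)
    show "R \<subseteq> generate (free_Abelian_group S) R"
      by (auto intro: generate.incl)
    show "zmod.subspace (generate (free_Abelian_group S) R)"
      unfolding zmod.subspace_def
      using pow generate.one[of "free_Abelian_group S" R] generate.eng[of _ "free_Abelian_group S" R]
      by auto
  qed
qed

lemma keys_in_span:
  assumes "c \<in> zmod.span R" "\<And>r. r \<in> R \<Longrightarrow> Poly_Mapping.keys r \<subseteq> S"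
  shows "Poly_Mapping.keys c \<subseteq> S"
proof -
  have "zmod.span R \<subseteq> {c. Poly_Mapping.keys c \<subseteq> S}"
  proof (rule zmod.span_minimal)
    show "zmod.subspace {c. Poly_Mapping.keys c \<subseteq> S}"
      unfolding zmod.subspace_def
      by (auto dest!: subsetD[OF keys_add])
  qed (use assms in auto)
  then show ?thesis using assms by auto
qed

text \<open>The linear extension of \<open>h\<close> to formal combinations. With \<open>h\<close>
  the membership indicator of a point \<open>z\<close> it gives the value at \<open>z\<close> of the
  indicator function of a combination.\<close>

definition frag_eval :: "('a \<Rightarrow> int) \<Rightarrow> ('a \<Rightarrow>\<^sub>0 int) \<Rightarrow> int" where
  "frag_eval h c = (\<Sum>x\<in>Poly_Mapping.keys c. Poly_Mapping.lookup c x * h x)"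

lemma frag_eval_superset:
  assumes "finite S" "Poly_Mapping.keys c \<subseteq> S"
  shows "frag_eval h c = (\<Sum>x\<in>S. Poly_Mapping.lookup c x * h x)"
  unfolding frag_eval_def
  by (rule sum.mono_neutral_left) (use assms in \<open>auto simp: in_keys_iff\<close>)

lemma frag_eval_0 [simp]: "frag_eval h 0 = 0"
  by (simp add: frag_eval_def)

lemma frag_eval_of [simp]: "frag_eval h (frag_of x) = h x"
  by (simp add: frag_eval_def)

lemma frag_eval_add: "frag_eval h (c + d) = frag_eval h c + frag_eval h d"
proof -
  let ?S = "Poly_Mapping.keys c \<union> Poly_Mapping.keys d"
  have "frag_eval h (c + d) = (\<Sum>x\<in>?S. Poly_Mapping.lookup (c + d) x * h x)"
    using keys_add[of c d] by (intro frag_eval_superset) auto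
  also have "\<dots> = (\<Sum>x\<in>?S. Poly_Mapping.lookup c x * h x) + (\<Sum>x\<in>?S. Poly_Mapping.lookup d x * h x)"
    by (simp add: lookup_add algebra_simps sum.distrib)
  also have "\<dots> = frag_eval h c + frag_eval h d"
    by (simp add: frag_eval_superset[of ?S])
  finally show ?thesis .
qed

lemma frag_eval_cmul: "frag_eval h (frag_cmul n c) = n * frag_eval h c"
  by (subst frag_eval_superset[OF _ keys_cmul])
     (auto simp: frag_eval_def sum_distrib_left algebra_simps)

lemma frag_eval_minus: "frag_eval h (- c) = - frag_eval h c"
  using frag_eval_cmul[of h "-1" c] by simp

lemma frag_eval_diff: "frag_eval h (c - d) = frag_eval h c - frag_eval h d"
  using frag_eval_add[of h c "- d"] by (simp add: frag_eval_minus)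

lemma frag_eval_sum: "frag_eval h (sum f A) = (\<Sum>a\<in>A. frag_eval h (f a))"
  by (induction A rule: infinite_finite_induct) (auto simp: frag_eval_add)

lemma frag_eval_cong:
  "(\<And>x. x \<in> Poly_Mapping.keys c \<Longrightarrow> h x = h' x) \<Longrightarrow> frag_eval h c = frag_eval h' c"
  by (simp add: frag_eval_def)

lemma frag_eval_fun_diff: "frag_eval (\<lambda>x. h x - h' x) c = frag_eval h c - frag_eval h' c"
  by (simp add: frag_eval_def algebra_simps sum_subtractf)

lemma frag_extend_eq_sum:
  "frag_extend f c = (\<Sum>x\<in>Poly_Mapping.keys c. frag_cmul (Poly_Mapping.lookup c x) (f x))"
  by (simp add: frag_extend_def)

lemma frag_eval_extend: "frag_eval h (frag_extend f c) = frag_eval (\<lambda>x. frag_eval h (f x)) c"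
  by (simp add: frag_extend_eq_sum frag_eval_sum frag_eval_cmul) (simp add: frag_eval_def)

lemma frag_extend_extend: "frag_extend f (frag_extend h c) = frag_extend (\<lambda>x. frag_extend f (h x)) c"
  by (simp add: frag_extend_eq_sum[of h] frag_extend_eq_sum[of "\<lambda>x. frag_extend f (h x)"]
      frag_extend_sum frag_extend_cmul)

lemma frag_extend_fun_diff: "frag_extend (\<lambda>x. f x - h x) c = frag_extend f c - frag_extend h c"
  by (simp add: frag_extend_def zmod.scale_right_diff_distrib sum_subtractf)

lemma frag_extend_fun_sum: "frag_extend (\<lambda>x. \<Sum>i\<in>I. f i x) c = (\<Sum>i\<in>I. frag_extend (f i) c)"
  by (simp add: frag_extend_def zmod.scale_sum_right) (rule sum.swap)

lemma frag_extend_in_span: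
  "(\<And>x. x \<in> Poly_Mapping.keys c \<Longrightarrow> f x \<in> zmod.span R) \<Longrightarrow> frag_extend f c \<in> zmod.span R"
  by (simp add: frag_extend_eq_sum zmod.span_sum zmod.span_scale)

lemma frag_extend_span_image:
  assumes "c \<in> zmod.span R" "\<And>r. r \<in> R \<Longrightarrow> frag_extend f r \<in> zmod.span R'"
  shows "frag_extend f c \<in> zmod.span R'"
  using assms(1)
proof (induction rule: zmod.span_induct_alt)
  case (step n x y)
  then show ?case
    by (simp add: frag_extend_add frag_extend_cmul assms(2) zmod.span_add zmod.span_scale)
qed (simp add: zmod.span_zero)

section \<open>Generic points of a subspace\<close>

definition generic :: "'a::real_vector set \<Rightarrow> 'a filter" where
  "generic U = inf (principal U) (INF B\<in>{B. subspace B \<and> \<not> U \<subseteq> B}. principal (- B))"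

lemma eventually_generic:
  "eventually P (generic U) \<longleftrightarrow>
    (\<exists>\<B>. finite \<B> \<and> (\<forall>B\<in>\<B>. subspace B \<and> \<not> U \<subseteq> B) \<and> (\<forall>z\<in>U. z \<notin> \<Union>\<B> \<longrightarrow> P z))"
proof -
  have *: "(\<forall>\<^sub>F z in (INF B\<in>\<B>. principal (- B)). z \<in> U \<longrightarrow> P z) \<longleftrightarrow> (\<forall>z\<in>U. z \<notin> \<Union>\<B> \<longrightarrow> P z)"
    if "finite \<B>" for \<B>
    using that by (auto simp: INF_principal_finite eventually_principal)
  have "eventually P (generic U) \<longleftrightarrow>
      (\<exists>\<B>\<subseteq>{B. subspace B \<and> \<not> U \<subseteq> B}. finite \<B> \<and>
        (\<forall>\<^sub>F z in (INF B\<in>\<B>. principal (- B)). z \<in> U \<longrightarrow> P z))"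
    unfolding generic_def inf.commute[of "principal U"] eventually_inf_principal
    by (rule eventually_INF)
  also have "\<dots> \<longleftrightarrow>
      (\<exists>\<B>\<subseteq>{B. subspace B \<and> \<not> U \<subseteq> B}. finite \<B> \<and> (\<forall>z\<in>U. z \<notin> \<Union>\<B> \<longrightarrow> P z))"
    using * by (intro ex_cong1 conj_cong refl) auto
  also have "\<dots> \<longleftrightarrow>
      (\<exists>\<B>. finite \<B> \<and> (\<forall>B\<in>\<B>. subspace B \<and> \<not> U \<subseteq> B) \<and> (\<forall>z\<in>U. z \<notin> \<Union>\<B> \<longrightarrow> P z))"
    unfolding subset_eq[of _ "{B. subspace B \<and> \<not> U \<subseteq> B}"] mem_Collect_eq
    by (rule ex_cong1) (rule conj_left_commute)
  finally show ?thesis .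
qed

lemma generic_subspace:
  "subspace B \<Longrightarrow> \<not> U \<subseteq> B \<Longrightarrow> \<forall>\<^sub>F z in generic U. z \<in> U \<and> z \<notin> B"
  unfolding eventually_generic by (intro exI[of _ "{B}"]) auto

lemma generic_all: "(\<And>z. z \<in> U \<Longrightarrow> P z) \<Longrightarrow> \<forall>\<^sub>F z in generic U. P z"
  unfolding eventually_generic by (intro exI[of _ "{}"]) auto

text \<open>Two parameters with values in \<open>B\<close> would put the direction \<open>u\<close>,
  and then \<open>z\<close>, into \<open>B\<close>. This allows a point to be moved off finitely
  many subspaces by an arbitrarily small shift.\<close>

lemma finite_line_inter_subspace:
  fixes B :: "'a::real_vector set"
  assumes "subspace B" "\<not> (z \<in> B \<and> u \<in> B)"
  shows "finite {t. z + t *\<^sub>R u \<in> B}"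
proof -
  have "s = t" if "z + s *\<^sub>R u \<in> B" "z + t *\<^sub>R u \<in> B" for s t
  proof (rule ccontr)
    assume "s \<noteq> t"
    have "(s - t) *\<^sub>R u \<in> B"
      using subspace_diff[OF assms(1) that] by (simp add: algebra_simps)
    then have "(1 / (s - t)) *\<^sub>R (s - t) *\<^sub>R u \<in> B"
      by (rule subspace_scale[OF assms(1)])
    then have u: "u \<in> B" using \<open>s \<noteq> t\<close> by simp
    have "z + s *\<^sub>R u - s *\<^sub>R u \<in> B"
      using that(1) u subspace_diff[OF assms(1)] subspace_scale[OF assms(1)] by blast
    then show False using u assms(2) by simp
  qed
  then have "{t. z + t *\<^sub>R u \<in> B} \<subseteq> {s}" if "z + s *\<^sub>R u \<in> B" for s
    using that by blast
  then show ?thesis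
    by (cases "\<exists>s. z + s *\<^sub>R u \<in> B") (auto intro: finite_subset)
qed

lemma eventually_at_right_notin_finite:
  "finite F \<Longrightarrow> \<forall>\<^sub>F t in at_right (0::real). t \<notin> F"
  using eventually_ball_finite[of F "\<lambda>t x. t \<noteq> x" "at_right 0"]
  by (auto simp: eventually_neq_at_within elim!: eventually_mono)

text \<open>The scalar field is infinite: a point off the earlier subspaces is moved along a
  direction off the new one, and only finitely many positions on this line are bad.\<close>

lemma subspace_not_covered:
  fixes U :: "'a::real_vector set"
  assumes "subspace U" "finite \<B>" "\<forall>B\<in>\<B>. subspace B \<and> \<not> U \<subseteq> B"
  shows "\<exists>z\<in>U. z \<notin> \<Union>\<B>"
  using assms(2,3)
proof (induction \<B> rule: finite_induct)
  case empty
  then show ?case using subspace_0[OF assms(1)] by auto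
next
  case (insert B \<B>)
  then obtain z where z: "z \<in> U" "z \<notin> \<Union>\<B>" by auto
  obtain u where u: "u \<in> U" "u \<notin> B" using insert by auto
  have "finite (\<Union>B'\<in>insert B \<B>. {t. z + t *\<^sub>R u \<in> B'})"
    using insert.hyps insert.prems z u by (intro finite_UN_I finite_line_inter_subspace) auto
  then obtain t where "t \<notin> (\<Union>B'\<in>insert B \<B>. {t. z + t *\<^sub>R u \<in> B'})"
    using ex_new_if_finite[OF infinite_UNIV_char_0] by blast
  then show ?case
    using z u subspace_add[OF assms(1)] subspace_scale[OF assms(1)]
    by (intro bexI[of _ "z + t *\<^sub>R u"]) auto
qed

section \<open>Lists with one entry omitted\<close>

lemma length_omit [simp]: "i < length xs \<Longrightarrow> length (omit i xs) = length xs - 1"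
  by (simp add: omit_def)

lemma set_omit_subset: "set (omit i xs) \<subseteq> set xs"
  by (auto simp: omit_def dest: in_set_takeD in_set_dropD)

lemma map_omit: "map f (omit i xs) = omit i (map f xs)"
  by (simp add: omit_def take_map drop_map)

lemma omit_Cons_0 [simp]: "omit 0 (x # xs) = xs"
  by (simp add: omit_def)

lemma omit_Cons_Suc [simp]: "omit (Suc i) (x # xs) = x # omit i xs"
  by (simp add: omit_def)

lemma nth_omit:
  "i < length xs \<Longrightarrow> j < length xs - 1 \<Longrightarrow> omit i xs ! j = xs ! (if j < i then j else Suc j)"
  by (auto simp: omit_def nth_append min_def)

lemma sum_omit:
  fixes xs :: "'a::real_vector list"
  assumes "i < length xs"
  shows "(\<Sum>j<length (omit i xs). a (if j < i then j else Suc j) *\<^sub>R omit i xs ! j)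
       = (\<Sum>j\<in>{..<length xs} - {i}. a j *\<^sub>R xs ! j)"
  by (rule sum.reindex_bij_witness[of _ "\<lambda>j. if j < i then j else j - 1"
        "\<lambda>j. if j < i then j else Suc j"])
     (use assms in \<open>auto simp: nth_omit split: if_splits\<close>)

lemma mem_convex_cone_hull_insert:
  "z \<in> convex_cone hull (insert x S) \<longleftrightarrow> (\<exists>t\<ge>0. z - t *\<^sub>R x \<in> convex_cone hull S)"
proof -
  have 1: "convex_cone hull {x} = {t *\<^sub>R x | t. t \<ge> 0}"
    by (subst convex_cone_hull_convex_hull_nonempty) auto
  have "(\<exists>y\<in>convex_cone hull S. z = t *\<^sub>R x + y) \<longleftrightarrow> z - t *\<^sub>R x \<in> convex_cone hull S" for t
    by (metis add_diff_cancel_left' add.commute diff_add_cancel)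
  then show ?thesis
    unfolding insert_is_Un[of x S] convex_cone_hull_Un 1 by fast
qed

lemma convex_cone_hull_list:
  fixes xs :: "'a::real_vector list"
  shows "z \<in> convex_cone hull (set xs) \<longleftrightarrow> (\<exists>c. (\<forall>i. 0 \<le> c i) \<and> z = (\<Sum>i<length xs. c i *\<^sub>R xs ! i))"
proof (induction xs arbitrary: z)
  case Nil
  then show ?case by (auto intro: exI[of _ "\<lambda>_. 0"])
next
  case (Cons x xs)
  show ?case
  proof
    assume "z \<in> convex_cone hull set (x # xs)"
    then obtain t c where "t \<ge> 0" "\<forall>i. 0 \<le> c i" "z - t *\<^sub>R x = (\<Sum>i<length xs. c i *\<^sub>R xs ! i)"
      by (auto simp: mem_convex_cone_hull_insert Cons)
    then show "\<exists>c. (\<forall>i. 0 \<le> c i) \<and> z = (\<Sum>i<length (x # xs). c i *\<^sub>R (x # xs) ! i)"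
      by (intro exI[of _ "case_nat t c"])
         (auto simp: sum.lessThan_Suc_shift algebra_simps split: nat.split simp del: sum.lessThan_Suc)
  next
    assume "\<exists>c. (\<forall>i. 0 \<le> c i) \<and> z = (\<Sum>i<length (x # xs). c i *\<^sub>R (x # xs) ! i)"
    then obtain c where "\<forall>i. 0 \<le> c i" "z = (\<Sum>i<length (x # xs). c i *\<^sub>R (x # xs) ! i)" by auto
    then show "z \<in> convex_cone hull set (x # xs)"
      by (auto simp: mem_convex_cone_hull_insert Cons sum.lessThan_Suc_shift simp del: sum.lessThan_Suc
          intro!: exI[of _ "c 0"] exI[of _ "\<lambda>i. c (Suc i)"])
  qed
qed

lemma span_list:
  fixes xs :: "'a::real_vector list"
  shows "z \<in> span (set xs) \<longleftrightarrow> (\<exists>c. z = (\<Sum>i<length xs. c i *\<^sub>R xs ! i))"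
proof (induction xs arbitrary: z)
  case (Cons x xs)
  show ?case
  proof
    assume "z \<in> span (set (x # xs))"
    then obtain t c where "z - t *\<^sub>R x = (\<Sum>i<length xs. c i *\<^sub>R xs ! i)"
      by (auto simp: span_breakdown_eq Cons)
    then show "\<exists>c. z = (\<Sum>i<length (x # xs). c i *\<^sub>R (x # xs) ! i)"
      by (intro exI[of _ "case_nat t c"])
         (auto simp: sum.lessThan_Suc_shift algebra_simps split: nat.split simp del: sum.lessThan_Suc)
  next
    assume "\<exists>c. z = (\<Sum>i<length (x # xs). c i *\<^sub>R (x # xs) ! i)"
    then obtain c where "z = (\<Sum>i<length (x # xs). c i *\<^sub>R (x # xs) ! i)" by auto
    then show "z \<in> span (set (x # xs))"
      by (auto simp: span_breakdown_eq Cons sum.lessThan_Suc_shift simp del: sum.lessThan_Suc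
          intro!: exI[of _ "c 0"] exI[of _ "\<lambda>i. c (Suc i)"])
  qed
qed auto

text \<open>The side condition \<open>Q\<close> on the coefficients lets one index shift serve both
  for spans (no condition) and for cones (nonnegative coefficients).\<close>

lemma omit_combination:
  fixes xs :: "'a::real_vector list"
  assumes "i < length xs"
  shows "(\<exists>c. Q c \<and> z = (\<Sum>j<length (omit i xs). c j *\<^sub>R omit i xs ! j)) \<longleftrightarrow>
         (\<exists>a. a i = 0 \<and> Q (\<lambda>j. a (if j < i then j else Suc j)) \<and> z = (\<Sum>j<length xs. a j *\<^sub>R xs ! j))"
    (is "?L \<longleftrightarrow> ?R")
proof
  assume ?L
  then obtain c where c: "Q c" "z = (\<Sum>j<length (omit i xs). c j *\<^sub>R omit i xs ! j)" by auto
  define a where "a j = (if j = i then 0 else c (if j < i then j else j - 1))" for j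
  have ac: "a (if j < i then j else Suc j) = c j" for j by (auto simp: a_def)
  have "z = (\<Sum>j\<in>{..<length xs} - {i}. a j *\<^sub>R xs ! j)"
    using c(2) sum_omit[OF assms, of a] by (simp add: ac)
  also have "\<dots> = (\<Sum>j<length xs. a j *\<^sub>R xs ! j)"
    by (rule sum.mono_neutral_left) (auto simp: a_def)
  finally show ?R using c(1) by (intro exI[of _ a]) (simp add: ac, simp add: a_def)
next
  assume ?R
  then obtain a where a: "a i = 0" "Q (\<lambda>j. a (if j < i then j else Suc j))"
    "z = (\<Sum>j<length xs. a j *\<^sub>R xs ! j)" by auto
  have "z = (\<Sum>j\<in>{..<length xs} - {i}. a j *\<^sub>R xs ! j)"
    unfolding a(3) by (rule sum.mono_neutral_right) (use a(1) in auto)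
  then show ?L
    using a(2) sum_omit[OF assms, of a] by (intro exI[of _ "\<lambda>j. a (if j < i then j else Suc j)"]) simp
qed

lemma span_omit:
  fixes xs :: "'a::real_vector list"
  assumes "i < length xs"
  shows "z \<in> span (set (omit i xs)) \<longleftrightarrow> (\<exists>a. a i = 0 \<and> z = (\<Sum>j<length xs. a j *\<^sub>R xs ! j))"
  using omit_combination[OF assms, of "\<lambda>_. True"] by (simp add: span_list)

lemma convex_cone_hull_omit:
  fixes xs :: "'a::real_vector list"
  assumes "i < length xs"
  shows "z \<in> convex_cone hull (set (omit i xs)) \<longleftrightarrow>
    (\<exists>a. a i = 0 \<and> (\<forall>j. 0 \<le> a j) \<and> z = (\<Sum>j<length xs. a j *\<^sub>R xs ! j))"
proof -
  have "(\<forall>j. 0 \<le> a (if j < i then j else Suc j)) \<longleftrightarrow> (\<forall>j. 0 \<le> a j)" if "a i = 0" for a :: "nat \<Rightarrow> real"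
  proof
    assume *: "\<forall>j. 0 \<le> a (if j < i then j else Suc j)"
    show "\<forall>j. 0 \<le> a j"
    proof
      fix j
      show "0 \<le> a j"
        using spec[OF *, of j] spec[OF *, of "j - 1"] that
        by (cases "j < i"; cases "j = i") (auto split: if_splits)
    qed
  qed auto
  then show ?thesis
    unfolding convex_cone_hull_list omit_combination[OF assms, of "\<lambda>c. \<forall>i. 0 \<le> c i"]
    by (intro ex_cong1) blast
qed

section \<open>Alternating volume forms\<close>

text \<open>Integer-valued, since it serves as a coefficient in free abelian groups.\<close>

definition isgn :: "real \<Rightarrow> int" where
  "isgn x = (if x > 0 then 1 else if x < 0 then - 1 else 0)"

lemma isgn_0 [simp]: "isgn 0 = 0"
  by (simp add: isgn_def)

lemma isgn_mult: "isgn (x * y) = isgn x * isgn y"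
  by (auto simp: isgn_def zero_less_mult_iff mult_less_0_iff)

lemma isgn_minus [simp]: "isgn (- x) = - isgn x"
  by (simp add: isgn_def)

lemma isgn_power_minus_one: "isgn ((- 1) ^ i * x) = (- 1) ^ i * isgn x"
  by (cases "even i") auto

lemma isgn_eq_0_iff [simp]: "isgn x = 0 \<longleftrightarrow> x = 0"
  by (auto simp: isgn_def)

text \<open>The properties of a determinant that the argument uses, for lists of vectors. When
  \<open>ps\<close> is a basis of a complement of \<open>U\<close>, the function
  \<open>\<lambda>ys. D (ps @ ys)\<close> is a volume form on \<open>U\<close>; in this way a single
  \<open>D\<close> orients all subspaces met in the induction on the dimension.\<close>

locale volume_form =
  fixes D :: "'a::euclidean_space list \<Rightarrow> real"
  assumes add: "Suc (length as + length bs) = DIM('a) \<Longrightarrow>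
      D (as @ (x + y) # bs) = D (as @ x # bs) + D (as @ y # bs)"
    and scale: "Suc (length as + length bs) = DIM('a) \<Longrightarrow>
      D (as @ (t *\<^sub>R x) # bs) = t * D (as @ x # bs)"
    and swap: "Suc (Suc (length as + length bs)) = DIM('a) \<Longrightarrow>
      D (as @ x # y # bs) = - D (as @ y # x # bs)"
    and nonzero_iff: "length vs = DIM('a) \<Longrightarrow> D vs \<noteq> 0 \<longleftrightarrow> span (set vs) = UNIV"
begin

lemma move:
  "Suc (length as + length bs + length cs) = DIM('a) \<Longrightarrow>
   D (as @ x # bs @ cs) = (- 1) ^ length bs * D (as @ bs @ x # cs)"
proof (induction bs arbitrary: as)
  case (Cons b bs)
  have "D (as @ x # (b # bs) @ cs) = - D (as @ b # x # bs @ cs)"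
    using swap[of as "bs @ cs" x b] Cons.prems by simp
  also have "D (as @ b # x # bs @ cs) = (- 1) ^ length bs * D (as @ b # bs @ x # cs)"
    using Cons.IH[of "as @ [b]"] Cons.prems by simp
  finally show ?case by simp
qed simp

lemma in_span_eq_0:
  assumes "Suc (length as + length bs) = DIM('a)" "x \<in> span (set as \<union> set bs)"
  shows "D (as @ x # bs) = 0"
proof (rule ccontr)
  assume "D (as @ x # bs) \<noteq> 0"
  then have "span (set (as @ x # bs)) = UNIV"
    using nonzero_iff assms(1) by simp
  moreover have "span (set (as @ x # bs)) = span (set as \<union> set bs)"
    using span_redundant[OF assms(2)] by (simp add: insert_commute)
  ultimately have "dim (set as \<union> set bs) = DIM('a)"
    using dim_span[of "set as \<union> set bs"] by simp
  moreover have "dim (set as \<union> set bs) \<le> card (set as \<union> set bs)"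
    by (rule dim_le_card') simp
  moreover have "card (set as \<union> set bs) \<le> length as + length bs"
    using card_length[of "as @ bs"] by simp
  ultimately show False using assms(1) by simp
qed

text \<open>
  Up to a common factor, the signed minors are the coefficients of the linear relation
  between \<open>k + 1\<close> vectors of a \<open>k\<close>-dimensional space.
\<close>

lemma relation_proportional_aux:
  assumes len: "length ps + length ys = Suc (DIM('a))"
    and ij: "i < j" "j < length ys"
    and rel: "(\<Sum>l<length ys. lam l *\<^sub>R ys ! l) = 0"
  shows "lam i * ((- 1) ^ j * D (ps @ omit j ys)) = lam j * ((- 1) ^ i * D (ps @ omit i ys))"
proof -
  define A B C where "A = take i ys" and "B = take (j - Suc i) (drop (Suc i) ys)"
    and "C = drop (Suc j) ys"
  define x y where "x = ys ! i" and "y = ys ! j"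
  have lens: "length A = i" "length B = j - Suc i" "length C = length ys - Suc j"
    using ij by (auto simp: A_def B_def C_def)
  have drop1: "drop (Suc i) ys = B @ y # C"
    using ij id_take_nth_drop[of "j - Suc i" "drop (Suc i) ys"]
    by (simp add: B_def C_def y_def)
  have ys: "ys = A @ x # B @ y # C"
    using ij id_take_nth_drop[of i ys] drop1 by (simp add: A_def x_def)
  have omit_i: "omit i ys = A @ B @ y # C"
    using drop1 by (simp add: omit_def A_def)
  have omit_j: "omit j ys = A @ x # B @ C"
  proof -
    have "j - i = Suc (length B)" "Suc j - i = Suc (Suc (length B))" using lens ij by auto
    then show ?thesis using lens ij by (subst ys) (simp add: omit_def)
  qed
  have len': "Suc (length (ps @ A @ B) + length C) = DIM('a)"
    using len lens ij by simp
  \<comment> \<open>The relation expresses this combination by the other vectors, so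
    \<open>D\<close> vanishes when it is put into one slot. Expanding that slot relates the two
    minors, up to the sign of moving \<open>x\<close> past \<open>B\<close>.\<close>
  have "lam i *\<^sub>R x + lam j *\<^sub>R y = - (\<Sum>l\<in>{..<length ys} - {i, j}. lam l *\<^sub>R ys ! l)"
  proof -
    have "(\<Sum>l<length ys. lam l *\<^sub>R ys ! l)
        = (\<Sum>l\<in>{..<length ys} - {i, j}. lam l *\<^sub>R ys ! l) + (\<Sum>l\<in>{i, j}. lam l *\<^sub>R ys ! l)"
      using ij by (intro sum.subset_diff) auto
    then show ?thesis using rel ij by (simp add: x_def y_def eq_neg_iff_add_eq_0 add_ac)
  qed
  also have "\<dots> \<in> span (set (ps @ A @ B) \<union> set C)"
  proof (intro span_neg span_sum span_scale span_base)
    fix l assume "l \<in> {..<length ys} - {i, j}"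
    then consider "l < i" | "i < l" "l < j" | "j < l" "l < length ys" by force
    then show "ys ! l \<in> set (ps @ A @ B) \<union> set C"
    proof cases
      case 1
      then have "A ! l \<in> set A" using lens ij by (intro nth_mem) linarith
      moreover have "A ! l = ys ! l" using lens ij 1 by (simp add: A_def)
      ultimately show ?thesis by simp
    next
      case 2
      then have "B ! (l - Suc i) \<in> set B" using lens ij by (intro nth_mem) linarith
      moreover have "B ! (l - Suc i) = ys ! l" using lens ij 2 by (simp add: B_def)
      ultimately show ?thesis by simp
    next
      case 3
      then have "C ! (l - Suc j) \<in> set C" using lens ij by (intro nth_mem) linarith
      moreover have "C ! (l - Suc j) = ys ! l" using lens ij 3 by (simp add: C_def)
      ultimately show ?thesis by simp
    qed
  qed
  finally have "D ((ps @ A @ B) @ (lam i *\<^sub>R x + lam j *\<^sub>R y) # C) = 0"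
    using len' by (rule in_span_eq_0[rotated])
  then have 0: "lam i * D (ps @ A @ B @ x # C) + lam j * D (ps @ A @ B @ y # C) = 0"
    using len' add[of "ps @ A @ B" C] scale[of "ps @ A @ B" C] by simp
  have mv: "D (ps @ A @ x # B @ C) = (- 1) ^ (j - Suc i) * D (ps @ A @ B @ x # C)"
    using move[of "ps @ A" B C x] len' lens by simp
  have sg: "(- 1 :: real) ^ j * (- 1) ^ (j - Suc i) = - ((- 1) ^ i)"
  proof -
    obtain d where "j = Suc (i + d)" using ij less_iff_Suc_add by auto
    then show ?thesis by (simp add: power_add mult.assoc flip: power_mult_distrib)
  qed
  have "lam i * ((- 1) ^ j * D (ps @ omit j ys))
      = lam i * (((- 1) ^ j * (- 1) ^ (j - Suc i)) * D (ps @ A @ B @ x # C))"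
    by (simp only: omit_j mv mult.assoc)
  also have "\<dots> = - ((- 1) ^ i) * (lam i * D (ps @ A @ B @ x # C))"
    unfolding sg by simp
  also have "lam i * D (ps @ A @ B @ x # C) = - (lam j * D (ps @ A @ B @ y # C))"
    using 0 by simp
  finally show ?thesis by (simp add: omit_i)
qed

lemma relation_proportional:
  assumes "length ps + length ys = Suc (DIM('a))" "i < length ys" "j < length ys"
    and "(\<Sum>l<length ys. lam l *\<^sub>R ys ! l) = 0"
  shows "lam i * ((- 1) ^ j * D (ps @ omit j ys)) = lam j * ((- 1) ^ i * D (ps @ omit i ys))"
  using relation_proportional_aux[OF assms(1), of i j lam] relation_proportional_aux[OF assms(1), of j i lam] assms
  by (cases i j rule: linorder_cases) auto

lemma span_of_nonzero:
  assumes "subspace U" "length ps + dim U = DIM('a)" "set xs \<subseteq> U" "length xs = dim U"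
    and "D (ps @ xs) \<noteq> 0"
  shows "span (set xs) = U"
proof -
  have "span (set (ps @ xs)) = UNIV" using nonzero_iff[of "ps @ xs"] assms by simp
  then have "DIM('a) = dim (set ps \<union> set xs)"
    using dim_span[of "set ps \<union> set xs"] by simp
  moreover obtain B where B: "B \<subseteq> set xs" "set xs \<subseteq> span B" "card B = dim (set xs)"
    using basis_exists[of "set xs"] by metis
  have "set ps \<union> set xs \<subseteq> span (set ps \<union> B)"
    using B(2) span_mono[of B "set ps \<union> B"] by (auto intro: span_base)
  then have "dim (set ps \<union> set xs) \<le> card (set ps \<union> B)"
    using finite_subset[OF B(1)] by (intro dim_le_card) auto
  moreover have "card (set ps \<union> B) \<le> length ps + dim (set xs)"
    using card_Un_le[of "set ps" B] card_length[of ps] B(3) by linarith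
  ultimately have "dim U \<le> dim (set xs)" using assms(2) by simp
  moreover have "span (set xs) \<subseteq> U" by (rule span_minimal[OF assms(3,1)])
  ultimately show ?thesis
    using subspace_dim_equal[of "span (set xs)" U] assms(1) by simp
qed

text \<open>Since one minor is nonzero, the relation \<open>lam\<close> is unique up to a factor, so
  the coefficient vectors of \<open>z\<close> form a line in direction \<open>lam\<close>. Walking
  along it in direction \<open>- lam\<close>, one leaves the nonnegative orthant through a
  coordinate with \<open>lam i > 0\<close>, and for \<open>z\<close> off the spans in
  \<open>gen\<close> through exactly one. Hence \<open>z\<close> lies in precisely one of these
  facet cones if it lies in the cone of all the vectors, and in none otherwise.\<close>

lemma count_cones:
  fixes lam :: "nat \<Rightarrow> real"
  assumes len: "length ps + length ys = Suc (DIM('a))"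
    and rel: "(\<Sum>l<length ys. lam l *\<^sub>R ys ! l) = 0"
    and i0: "i0 < length ys" "D (ps @ omit i0 ys) \<noteq> 0"
    and pos: "\<exists>i<length ys. lam i > 0"
    and gen: "\<And>i j. i < length ys \<Longrightarrow> j < length ys \<Longrightarrow> i \<noteq> j \<Longrightarrow>
       z \<notin> span ((!) ys ` ({..<length ys} - {i, j}))"
  shows "card {i. i < length ys \<and> lam i > 0 \<and> z \<in> convex_cone hull (set (omit i ys))}
       = of_bool (z \<in> convex_cone hull (set ys))"
proof -
  let ?I = "{i. i < length ys \<and> lam i > 0 \<and> z \<in> convex_cone hull (set (omit i ys))}"
  have uniq: "i = j" if "i \<in> ?I" "j \<in> ?I" for i j
  proof (rule ccontr)
    assume ne: "i \<noteq> j"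
    from that obtain a where a: "a i = 0" "\<forall>l. 0 \<le> a l" "z = (\<Sum>l<length ys. a l *\<^sub>R ys ! l)"
      by (auto simp: convex_cone_hull_omit)
    from that obtain b where b: "b j = 0" "\<forall>l. 0 \<le> b l" "z = (\<Sum>l<length ys. b l *\<^sub>R ys ! l)"
      by (auto simp: convex_cone_hull_omit)
    define mu where "mu l = b l - a l" for l
    have mu: "(\<Sum>l<length ys. mu l *\<^sub>R ys ! l) = 0"
      using a(3) b(3) by (simp add: mu_def algebra_simps sum_subtractf)
    let ?d = "(- 1) ^ i0 * D (ps @ omit i0 ys)"
    have d: "?d \<noteq> 0" using i0 by simp
    \<comment> \<open>Both \<open>mu\<close> and \<open>lam\<close> are proportional to the signed
      minors, hence to each other.\<close>
    have "mu i * lam j = mu j * lam i"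
    proof -
      have 1: "lam l * ?d = lam i0 * ((- 1) ^ l * D (ps @ omit l ys))"
        "mu l * ?d = mu i0 * ((- 1) ^ l * D (ps @ omit l ys))" if "l < length ys" for l
        using relation_proportional[OF len that i0(1) rel] relation_proportional[OF len that i0(1) mu] by auto
      have "(mu i * ?d) * (lam j * ?d) = (mu j * ?d) * (lam i * ?d)"
        using that by (simp only: 1 mem_Collect_eq) (simp add: mult_ac)
      then have "(?d * ?d) * (mu i * lam j) = (?d * ?d) * (mu j * lam i)"
        by (simp only: mult_ac)
      then show ?thesis using d by (metis mult_cancel_left no_zero_divisors)
    qed
    moreover have "mu i \<ge> 0" "mu j \<le> 0" using a b by (auto simp: mu_def)
    moreover have "lam i > 0" "lam j > 0" using that by auto
    ultimately have "mu j * lam i = 0"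
      using mult_nonneg_nonneg[of "mu i" "lam j"] mult_nonpos_nonneg[of "mu j" "lam i"] by linarith
    then have "mu j = 0" using \<open>lam i > 0\<close> by simp
    then have aj: "a j = 0" using b by (simp add: mu_def)
    have "z = (\<Sum>l\<in>{..<length ys} - {i, j}. a l *\<^sub>R ys ! l)"
      unfolding a(3) by (rule sum.mono_neutral_right) (use a(1) aj in auto)
    also have "\<dots> \<in> span ((!) ys ` ({..<length ys} - {i, j}))"
      by (intro span_sum span_scale span_base) auto
    finally show False using gen[of i j] that ne by auto
  qed
  show ?thesis
  proof (cases "z \<in> convex_cone hull (set ys)")
    case True
    then obtain a where a: "\<forall>l. 0 \<le> a l" "z = (\<Sum>l<length ys. a l *\<^sub>R ys ! l)"
      by (auto simp: convex_cone_hull_list)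
    define J where "J = {i. i < length ys \<and> lam i > 0}"
    have J: "finite J" "J \<noteq> {}" using pos by (auto simp: J_def)
    obtain i where i: "i \<in> J" "\<And>j. j \<in> J \<Longrightarrow> a i / lam i \<le> a j / lam j"
    proof -
      have "Min ((\<lambda>i. a i / lam i) ` J) \<in> (\<lambda>i. a i / lam i) ` J" using J by (intro Min_in) auto
      then obtain i where i: "i \<in> J" "Min ((\<lambda>i. a i / lam i) ` J) = a i / lam i" by auto
      moreover have "a i / lam i \<le> a j / lam j" if "j \<in> J" for j
        unfolding i(2)[symmetric] using that J(1) by (intro Min_le) auto
      ultimately show ?thesis using that by blast
    qed
    \<comment> \<open>The least ratio is the first parameter at which \<open>a - t * lam\<close>
      acquires a zero coefficient with \<open>lam\<close> positive; \<open>i\<close> is its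
      index.\<close>
    define t where "t = a i / lam i"
    have t: "t \<ge> 0" using a i(1) by (simp add: t_def J_def)
    define b where "b l = (if l < length ys then a l - t * lam l else 0)" for l
    have "0 \<le> b l" for l
    proof (cases "l < length ys \<and> lam l > 0")
      case True
      then have "t \<le> a l / lam l" using i(2)[of l] by (simp add: t_def J_def)
      then show ?thesis using True by (simp add: b_def pos_le_divide_eq)
    next
      case False
      then show ?thesis
        using a(1) t by (auto simp: b_def intro: order_trans[OF mult_nonneg_nonpos])
    qed
    moreover have "b i = 0" using i(1) by (simp add: b_def t_def J_def)
    moreover have "z = (\<Sum>l<length ys. b l *\<^sub>R ys ! l)"
    proof -
      have "(\<Sum>l<length ys. b l *\<^sub>R ys ! l) = z - t *\<^sub>R (\<Sum>l<length ys. lam l *\<^sub>R ys ! l)"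
        by (simp add: a(2) b_def scaleR_sum_right algebra_simps flip: sum_subtractf)
      then show ?thesis using rel by simp
    qed
    ultimately have "i \<in> ?I"
      using i(1) by (auto simp: J_def convex_cone_hull_omit)
    then have "?I = {i}" using uniq by blast
    then show ?thesis using True by simp
  next
    case False
    have "convex_cone hull (set (omit i ys)) \<subseteq> convex_cone hull (set ys)" for i
      by (rule hull_mono[OF set_omit_subset])
    then have "?I = {}" using False by blast
    then show ?thesis using False by (simp del: Collect_empty_eq)
  qed
qed

text \<open>The signed minors are \<open>c * lam i\<close> for a linear relation \<open>lam\<close>,
  so up to the sign of \<open>c\<close> the sum counts the facet cones through \<open>z\<close> with
  \<open>lam i > 0\<close> minus those with \<open>lam i < 0\<close>. By \<open>count_cones\<close>
  for \<open>lam\<close> and \<open>- lam\<close> the two counts agree. A relation between vectors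
  on which \<open>l\<close> is positive has coefficients of both signs. If all minors vanish, every
  term is zero.\<close>

lemma alternating_cone_sum:
  assumes U: "subspace U" "length ps + dim U = DIM('a)"
    and ys: "set ys \<subseteq> U" "length ys = Suc (dim U)"
    and l: "\<And>y. y \<in> set ys \<Longrightarrow> l \<bullet> y > 0"
  shows "\<forall>\<^sub>F z in generic U. (\<Sum>i<length ys. (- 1) ^ i *
           (isgn (D (ps @ omit i ys)) * of_bool (z \<in> convex_cone hull (set (omit i ys))))) = 0"
proof (cases "\<exists>i0<length ys. D (ps @ omit i0 ys) \<noteq> 0")
  case False
  then show ?thesis by (intro generic_all sum.neutral) auto
next
  case True
  then obtain i0 where i0: "i0 < length ys" "D (ps @ omit i0 ys) \<noteq> 0" by auto
  let ?mu = "\<lambda>i. (- 1) ^ i * D (ps @ omit i ys)"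
  have len: "length ps + length ys = Suc (DIM('a))" using U ys by simp
  have "span (set (omit i0 ys)) = U"
    using span_of_nonzero[OF U, of "omit i0 ys"] set_omit_subset[of i0 ys] i0 ys by simp
  then have "ys ! i0 \<in> span (set (omit i0 ys))" using i0 ys by auto
  then obtain a where a: "a i0 = 0" "ys ! i0 = (\<Sum>j<length ys. a j *\<^sub>R ys ! j)"
    by (auto simp: span_omit[OF i0(1)])
  define lam where "lam j = a j - of_bool (j = i0)" for j
  have "(\<Sum>j<length ys. of_bool (j = i0) *\<^sub>R ys ! j) = (\<Sum>j\<in>{i0}. ys ! j)"
    by (rule sum.mono_neutral_cong_right) (use i0 in auto)
  then have rel: "(\<Sum>j<length ys. lam j *\<^sub>R ys ! j) = 0"
    using a(2) by (simp add: lam_def algebra_simps sum_subtractf)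
  have lam0: "lam i0 = - 1" by (simp add: lam_def a)
  define c where "c = - ?mu i0"
  have c: "c \<noteq> 0" using i0 by (simp add: c_def)
  have mu: "?mu i = c * lam i" if "i < length ys" for i
    using relation_proportional[OF len that i0(1) rel] lam0 by (simp add: c_def mult.commute)
  have rel': "(\<Sum>j<length ys. (- lam j) *\<^sub>R ys ! j) = 0"
    using rel by (simp add: sum_negf)
  have lrel: "(\<Sum>j<length ys. lam j * (l \<bullet> ys ! j)) = 0"
    using arg_cong[OF rel, of "(\<bullet>) l"] by (simp add: inner_sum_right)
  have pos: "\<exists>i<length ys. lam i > 0"
  proof (rule ccontr)
    assume "\<not> ?thesis"
    then have np: "lam i \<le> 0" if "i < length ys" for i using that by force
    have "lam i0 * (l \<bullet> ys ! i0) = 0"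
    proof (rule ccontr)
      assume "lam i0 * (l \<bullet> ys ! i0) \<noteq> 0"
      moreover have "\<forall>i<length ys. lam i * (l \<bullet> ys ! i) \<le> 0"
        using np l by (auto intro!: mult_nonpos_nonneg simp: less_imp_le)
      ultimately have "(\<Sum>j<length ys. lam j * (l \<bullet> ys ! j)) < (\<Sum>j<length ys. 0)"
        using i0 by (intro sum_strict_mono_ex1) (auto intro!: bexI[of _ i0] simp: less_le)
      then show False using lrel by simp
    qed
    then show False using lam0 l[of "ys ! i0"] i0 by simp
  qed
  have neg: "\<exists>i<length ys. - lam i > 0" using lam0 i0 by (intro exI[of _ i0]) simp
  let ?B = "\<lambda>i j. span ((!) ys ` ({..<length ys} - {i, j}))"
  \<comment> \<open>Leaving out two of the \<open>dim U + 1\<close> vectors leaves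
    \<open>dim U - 1\<close>, so these spans do not contain \<open>U\<close>; avoiding them is the
    genericity that \<open>count_cones\<close> asks for.\<close>
  define \<B> where "\<B> = {?B i j | i j. i < length ys \<and> j < length ys \<and> i \<noteq> j}"
  have finB: "finite \<B>"
    unfolding \<B>_def
    by (rule finite_subset[of _ "(\<lambda>(i, j). ?B i j) ` ({..<length ys} \<times> {..<length ys})"]) auto
  have subB: "subspace B \<and> \<not> U \<subseteq> B" if "B \<in> \<B>" for B
  proof -
    obtain i j where ij: "B = ?B i j" "i < length ys" "j < length ys" "i \<noteq> j"
      using \<open>B \<in> \<B>\<close> by (auto simp: \<B>_def)
    have "dim B \<le> card ((!) ys ` ({..<length ys} - {i, j}))"
      unfolding ij(1) dim_span by (rule dim_le_card') simp
    also have "\<dots> \<le> card ({..<length ys} - {i, j})" by (rule card_image_le) simp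
    also have "\<dots> = length ys - 2" using ij by (subst card_Diff_subset) auto
    finally have "dim B < dim U" using ys ij by linarith
    moreover have "U \<subseteq> B \<Longrightarrow> dim U \<le> dim B" by (rule dim_subset)
    ultimately show ?thesis using ij(1) by (auto simp: subspace_span)
  qed
  show ?thesis
    unfolding eventually_generic
  proof (intro exI[of _ \<B>] conjI ballI impI)
    fix z assume z: "z \<in> U" "z \<notin> \<Union>\<B>"
    have gen: "z \<notin> ?B i j" if "i < length ys" "j < length ys" "i \<noteq> j" for i j
      using z(2) that by (auto simp: \<B>_def)
    let ?z = "\<lambda>i. of_bool (z \<in> convex_cone hull (set (omit i ys))) :: int"
    have card_sum: "(\<Sum>i<length ys. of_bool (Q i) * ?z i)
        = int (card {i. i < length ys \<and> Q i \<and> z \<in> convex_cone hull (set (omit i ys))})" for Q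
      by (subst card_eq_sum, subst of_nat_sum, rule sum.mono_neutral_cong_right)
         (auto simp: of_bool_def split: if_splits)
    have "(\<Sum>i<length ys. (- 1) ^ i * (isgn (D (ps @ omit i ys)) * ?z i))
        = (\<Sum>i<length ys. isgn c * (of_bool (lam i > 0) * ?z i - of_bool (- lam i > 0) * ?z i))"
    proof (rule sum.cong)
      fix i assume i: "i \<in> {..<length ys}"
      have "(- 1) ^ i * (isgn (D (ps @ omit i ys)) * ?z i) = isgn (?mu i) * ?z i"
        by (simp add: isgn_power_minus_one)
      also have "isgn (?mu i) = isgn c * isgn (lam i)" using mu i by (simp add: isgn_mult)
      also have "isgn (lam i) = of_bool (lam i > 0) - of_bool (- lam i > 0)"
        by (simp add: isgn_def)
      finally show "(- 1) ^ i * (isgn (D (ps @ omit i ys)) * ?z i)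
          = isgn c * (of_bool (lam i > 0) * ?z i - of_bool (- lam i > 0) * ?z i)"
        by (simp add: algebra_simps)
    qed simp
    also have "\<dots> = isgn c * ((\<Sum>i<length ys. of_bool (lam i > 0) * ?z i)
        - (\<Sum>i<length ys. of_bool (- lam i > 0) * ?z i))"
      by (simp only: sum_distrib_left sum_subtractf right_diff_distrib)
    also have "\<dots> = 0"
      unfolding card_sum
      using count_cones[OF len rel i0 pos gen] count_cones[OF len rel' i0 neg gen] by simp
    finally show "(\<Sum>i<length ys. (- 1) ^ i * (isgn (D (ps @ omit i ys)) * ?z i)) = 0" .
  qed (use finB subB in auto)
qed

end

section \<open>Tuples are determined by their cones\<close>

text \<open>For \<open>k = n + 1\<close>, \<open>Y = vertices\<close> and
  \<open>\<pi> = point_of g\<close> these are the defining relations of \<open>Ls g L\<close>; other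
  \<open>Y\<close> and \<open>k\<close> are needed for the induction through subspaces. Tuples are
  written as images of vectors under \<open>\<pi>\<close>, so that cones and orientations can be
  attached to representatives.\<close>

definition tuple_relations :: "('a::euclidean_space \<Rightarrow> 'b) \<Rightarrow> 'a set \<Rightarrow> nat \<Rightarrow> ('b list \<Rightarrow>\<^sub>0 int) set" where
  "tuple_relations \<pi> Y k =
     {frag_of (map \<pi> ys) | ys. length ys = k \<and> set ys \<subseteq> Y \<and> dim (set ys) < k} \<union>
     {(\<Sum>i<Suc k. frag_cmul ((- 1) ^ i) (frag_of (omit i (map \<pi> ys)))) | ys.
        length ys = Suc k \<and> set ys \<subseteq> Y}"

definition frag_cons :: "'b \<Rightarrow> ('b list \<Rightarrow>\<^sub>0 int) \<Rightarrow> ('b list \<Rightarrow>\<^sub>0 int)" where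
  "frag_cons p = frag_extend (\<lambda>ys. frag_of (p # ys))"

lemma degenerate_in_span:
  "length ys = k \<Longrightarrow> set ys \<subseteq> Y \<Longrightarrow> dim (set ys) < k \<Longrightarrow>
   frag_of (map \<pi> ys) \<in> zmod.span (tuple_relations \<pi> Y k)"
  by (rule zmod.span_base) (auto simp: tuple_relations_def)

text \<open>The alternating relation for \<open>p # ys\<close>, solved for the term that omits
  \<open>p\<close>: a tuple is replaced by tuples that all start with
  \<open>\<pi> p\<close>.\<close>

lemma cone_relation:
  assumes "length ys = k" "set ys \<subseteq> Y" "p \<in> Y"
  shows "frag_of (map \<pi> ys) - (\<Sum>i<k. frag_cmul ((- 1) ^ i) (frag_of (\<pi> p # omit i (map \<pi> ys))))
    \<in> zmod.span (tuple_relations \<pi> Y k)"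
proof -
  have "(\<Sum>i<Suc k. frag_cmul ((- 1) ^ i) (frag_of (omit i (map \<pi> (p # ys)))))
      \<in> zmod.span (tuple_relations \<pi> Y k)"
    unfolding tuple_relations_def using assms
    by (intro zmod.span_base UnI2 CollectI exI[of _ "p # ys"]) auto
  also have "(\<Sum>i<Suc k. frag_cmul ((- 1) ^ i) (frag_of (omit i (map \<pi> (p # ys)))))
    = frag_of (map \<pi> ys) - (\<Sum>i<k. frag_cmul ((- 1) ^ i) (frag_of (\<pi> p # omit i (map \<pi> ys))))"
    by (simp add: sum.lessThan_Suc_shift sum_negf zmod.scale_minus_left
        del: sum.lessThan_Suc minus_frag_cmul)
  finally show ?thesis .
qed

text \<open>Coning with \<open>p\<close> keeps degenerate tuples degenerate. The cone over the
  alternating relation of \<open>ys\<close> is, modulo the relation for \<open>p # ys\<close>, the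
  tuple \<open>ys\<close> itself, and this is degenerate in \<open>U\<close>: its
  \<open>k + 1\<close> vectors lie in the \<open>k\<close>-dimensional \<open>H\<close>.\<close>

lemma frag_cons_relations:
  assumes H: "dim H = k" "H \<subseteq> U" and p: "p \<in> W \<inter> U"
    and r: "r \<in> tuple_relations \<pi> (W \<inter> H) k"
  shows "frag_cons (\<pi> p) r \<in> zmod.span (tuple_relations \<pi> (W \<inter> U) (Suc k))"
  using r unfolding tuple_relations_def[of \<pi> "W \<inter> H"]
proof (elim UnE CollectE exE conjE)
  fix ys assume ys: "r = frag_of (map \<pi> ys)" "length ys = k" "set ys \<subseteq> W \<inter> H" "dim (set ys) < k"
  have "dim (set (p # ys)) < Suc k" using ys(4) by (simp add: dim_insert)
  then have "frag_of (map \<pi> (p # ys)) \<in> zmod.span (tuple_relations \<pi> (W \<inter> U) (Suc k))"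
    using ys p H(2) by (intro degenerate_in_span) auto
  then show ?thesis by (simp add: ys(1) frag_cons_def)
next
  fix ys assume ys: "r = (\<Sum>i<Suc k. frag_cmul ((- 1) ^ i) (frag_of (omit i (map \<pi> ys))))"
    "length ys = Suc k" "set ys \<subseteq> W \<inter> H"
  let ?c = "\<Sum>i<Suc k. frag_cmul ((- 1) ^ i) (frag_of (\<pi> p # omit i (map \<pi> ys)))"
  have "frag_of (map \<pi> ys) - ?c \<in> zmod.span (tuple_relations \<pi> (W \<inter> U) (Suc k))"
    using ys p H(2) by (intro cone_relation) auto
  moreover have "dim (set ys) \<le> dim H" using ys(3) by (intro dim_subset) auto
  then have "frag_of (map \<pi> ys) \<in> zmod.span (tuple_relations \<pi> (W \<inter> U) (Suc k))"
    using ys H by (intro degenerate_in_span) auto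
  ultimately have "frag_of (map \<pi> ys) - (frag_of (map \<pi> ys) - ?c)
      \<in> zmod.span (tuple_relations \<pi> (W \<inter> U) (Suc k))"
    by (intro zmod.span_diff[of "frag_of (map \<pi> ys)" _ "frag_of (map \<pi> ys) - ?c"])
  moreover have "frag_cons (\<pi> p) r = ?c"
    by (simp add: ys(1) frag_cons_def frag_extend_sum frag_extend_cmul del: sum.lessThan_Suc)
  ultimately show ?thesis by (simp only: diff_diff_eq2 add_diff_cancel_left')
qed

section \<open>Jumps of signed indicator functions across hyperplanes\<close>

lemma mem_simplicial_cone:
  fixes q :: "'a::real_vector"
  assumes "q \<notin> span S" "h \<in> span S"
  shows "a *\<^sub>R q + h \<in> convex_cone hull (insert q S) \<longleftrightarrow> 0 \<le> a \<and> h \<in> convex_cone hull S"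
proof -
  have "t = a" if "a *\<^sub>R q + h - t *\<^sub>R q \<in> convex_cone hull S" for t
  proof (rule ccontr)
    assume "t \<noteq> a"
    have "convex_cone hull S \<subseteq> span S"
      by (intro hull_minimal convex_cone_span span_superset)
    then have "a *\<^sub>R q + h - t *\<^sub>R q - h \<in> span S"
      using that assms(2) by (intro span_diff[of "a *\<^sub>R q + h - t *\<^sub>R q" S h]) auto
    then have "(a - t) *\<^sub>R q \<in> span S" by (simp add: algebra_simps)
    then have "(1 / (a - t)) *\<^sub>R (a - t) *\<^sub>R q \<in> span S" by (rule span_scale)
    then show False using \<open>t \<noteq> a\<close> assms(1) by simp
  qed
  moreover have "a *\<^sub>R q + h - a *\<^sub>R q = h" by simp
  ultimately show ?thesis
    unfolding mem_convex_cone_hull_insert by (metis (no_types))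
qed

context volume_form
begin

lemma nonzero_independent:
  assumes "length vs = DIM('a)" "D vs \<noteq> 0"
  shows "distinct vs" "independent (set vs)"
proof -
  have sp: "span (set vs) = UNIV" using nonzero_iff assms by blast
  then have "dim (set vs) = DIM('a)" using dim_span[of "set vs"] by simp
  then have "card (set vs) \<ge> DIM('a)" using dim_le_card'[of "set vs"] by simp
  then show "distinct vs" using card_length[of vs] assms(1) by (intro card_distinct) simp
  show "independent (set vs)"
    by (rule card_le_dim_spanning[of _ UNIV]) (use sp card_length[of vs] assms(1) in auto)
qed

lemma nonzero_append:
  assumes "length ps + k = DIM('a)" "span (set ps \<union> U) = UNIV" "subspace U" "dim U = k"
    and "length ys = k" "set ys \<subseteq> U"
  shows "D (ps @ ys) = 0 \<longleftrightarrow> dim (set ys) < k"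
proof
  assume D0: "D (ps @ ys) = 0"
  have "dim (set ys) \<le> k" using dim_subset[OF assms(6)] assms(4) by simp
  moreover have "dim (set ys) \<noteq> k"
  proof
    assume "dim (set ys) = k"
    moreover have "span (set ys) \<subseteq> U" by (rule span_minimal[OF assms(6,3)])
    ultimately have "span (set ys) = U"
      using subspace_dim_equal[of "span (set ys)" U] assms(3,4) by simp
    then have "U \<subseteq> span (set ps \<union> set ys)"
      using span_mono[of "set ys" "set ps \<union> set ys"] by simp
    then have "span (set ps \<union> U) \<subseteq> span (set ps \<union> set ys)"
      by (intro span_minimal) (auto intro: span_base)
    then show False using D0 nonzero_iff[of "ps @ ys"] assms by auto
  qed
  ultimately show "dim (set ys) < k" by simp
next
  assume "dim (set ys) < k"
  moreover have "dim (set ys) = dim U" if "D (ps @ ys) \<noteq> 0"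
    using span_of_nonzero[of U ps ys] assms that by (metis dim_span)
  ultimately show "D (ps @ ys) = 0" using assms(4) by auto
qed

text \<open>The indicator function of the cone over \<open>ys\<close>, signed by the orientation
  that \<open>ps\<close> induces on the subspace at hand. Lists with \<open>D (ps @ ys) = 0\<close>
  get the function 0.\<close>

definition cone_sign :: "'a list \<Rightarrow> 'a \<Rightarrow> 'a list \<Rightarrow> int" where
  "cone_sign ps z ys = isgn (D (ps @ ys)) * of_bool (z \<in> convex_cone hull (set ys))"

text \<open>
  The indicator function of a simplicial cone with a ray spanned by \<open>\<plusminus> p\<close> jumps
  in direction \<open>p\<close> only across the hyperplane spanned by the other rays.
\<close>

lemma cone_sign_jump:
  assumes U: "subspace U" "dim U = Suc k" "length ps + Suc k = DIM('a)" "span (set ps \<union> U) = UNIV"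
    and q: "q = p \<or> q = - p" and ys: "length ys = k" "set (q # ys) \<subseteq> U" and z: "z \<in> U"
    and D: "D (ps @ q # ys) \<noteq> 0" and H: "z \<in> H" "z \<in> span (set ys) \<Longrightarrow> span (set ys) = H"
  shows "\<forall>\<^sub>F t in at_right 0. cone_sign ps (z + t *\<^sub>R p) (q # ys) - cone_sign ps (z - t *\<^sub>R p) (q # ys)
      = (if span (set ys) = H then cone_sign (ps @ [p]) z ys else 0)"
proof -
  have len: "length (ps @ q # ys) = DIM('a)" using U ys by simp
  have qn: "q \<notin> span (set ys)"
    using nonzero_independent[OF len D]
    by (auto simp: dependent_def) (metis Diff_insert_absorb UnCI Un_commute list.set_intros(1) span_mono subsetD subset_insertI subset_Un_eq sup_ge2)
  have spU: "span (insert q (set ys)) = U"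
    using span_of_nonzero[OF U(1), of ps "q # ys"] U ys D by simp
  then have "z \<in> span (insert q (set ys))" using z by simp
  then obtain a where a: "z - a *\<^sub>R q \<in> span (set ys)"
    by (auto simp: span_breakdown_eq)
  define h where "h = z - a *\<^sub>R q"
  have h: "h \<in> span (set ys)" "z = a *\<^sub>R q + h" using a by (auto simp: h_def)
  have cone: "z + t *\<^sub>R q \<in> convex_cone hull (set (q # ys)) \<longleftrightarrow>
      0 \<le> a + t \<and> h \<in> convex_cone hull (set ys)" for t
    using mem_simplicial_cone[OF qn h(1), of "a + t"] by (simp add: h(2) algebra_simps)
  \<comment> \<open>Replacing \<open>p\<close> by \<open>- p\<close> contributes the factor
    \<open>s\<close> to the volume form and also reverses the side of the base on which the cone
    lies; in the difference of the two values these signs cancel.\<close>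
  define s :: real where "s = (if q = p then 1 else - 1)"
  have s: "s * s = 1" "q = s *\<^sub>R p" "p = s *\<^sub>R q" using q by (auto simp: s_def)
  have Dq: "D (ps @ q # ys) = s * D ((ps @ [p]) @ ys)"
    using scale[of ps ys s p] len s(2) by simp
  have cs: "cone_sign ps (z + t *\<^sub>R p) (q # ys)
      = isgn s * isgn (D ((ps @ [p]) @ ys)) * of_bool (0 \<le> a + s * t \<and> h \<in> convex_cone hull (set ys))" for t
    using cone[of "s * t"] s(3) by (simp add: cone_sign_def Dq isgn_mult mult.commute)
  have cs': "cone_sign ps (z - t *\<^sub>R p) (q # ys)
      = isgn s * isgn (D ((ps @ [p]) @ ys)) * of_bool (0 \<le> a - s * t \<and> h \<in> convex_cone hull (set ys))" for t
    using cs[of "- t"] by simp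
  show ?thesis
  proof (cases "span (set ys) = H")
    case True
    have "a = 0"
    proof (rule ccontr)
      assume "a \<noteq> 0"
      have "z - h \<in> span (set ys)" using H(1) h(1) True by (intro span_diff) auto
      then have "a *\<^sub>R q \<in> span (set ys)" by (simp add: h(2))
      then have "(1 / a) *\<^sub>R a *\<^sub>R q \<in> span (set ys)" by (rule span_scale)
      then show False using \<open>a \<noteq> 0\<close> qn by simp
    qed
    then have "z = h" using h by simp
    have "cone_sign ps (z + t *\<^sub>R p) (q # ys) - cone_sign ps (z - t *\<^sub>R p) (q # ys)
        = cone_sign (ps @ [p]) z ys" if "t > 0" for t
    proof -
      have "cone_sign ps (z + t *\<^sub>R p) (q # ys) - cone_sign ps (z - t *\<^sub>R p) (q # ys)
          = isgn s * s' * cone_sign (ps @ [p]) z ys"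
        if "s' = of_bool (0 \<le> a + s * t) - of_bool (0 \<le> a - s * t)" for s'
        unfolding cs cs' unfolding that cone_sign_def \<open>z = h\<close> by (simp add: algebra_simps of_bool_conj)
      then show ?thesis using that \<open>a = 0\<close> by (auto simp: s_def isgn_def)
    qed
    then show ?thesis using True
      unfolding eventually_at_right_field by (intro exI[of _ 1]) auto
  next
    case False
    \<comment> \<open>Here \<open>z\<close> is off the base hyperplane, and for
      \<open>t < \<bar>a\<bar>\<close> both shifted points lie on the same side of it as
      \<open>z\<close>.\<close>
    have "a \<noteq> 0" using H(2) False h by auto
    have "cone_sign ps (z + t *\<^sub>R p) (q # ys) - cone_sign ps (z - t *\<^sub>R p) (q # ys) = 0"
      if "t > 0" "t < \<bar>a\<bar>" for t
    proof -
      have "0 \<le> a + s * t \<longleftrightarrow> 0 \<le> a - s * t" using that by (auto simp: s_def)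
      then show ?thesis by (simp add: cs cs')
    qed
    then show ?thesis
      unfolding eventually_at_right_field using False \<open>a \<noteq> 0\<close> by (intro exI[of _ "\<bar>a\<bar>"]) auto
  qed
qed

text \<open>
  By \<open>lift\<close>, a cone point can be replaced by a vector with the same image under \<open>\<pi>\<close> that lies in a
  common open half-space with a given tuple, as required by \<open>alternating_cone_sum\<close>.
\<close>

theorem tuple_relations_if_cone_sign_eq_0:
  fixes W :: "'a set" and \<pi> :: "'a \<Rightarrow> 'b"
  assumes lift: "\<And>p ys. p \<in> W \<Longrightarrow> set ys \<subseteq> W \<Longrightarrow> distinct ys \<Longrightarrow> independent (set ys) \<Longrightarrow>
      \<exists>p'\<in>W. \<pi> p' = \<pi> p \<and> (p' = p \<or> p' = - p) \<and> (\<exists>l. \<forall>y\<in>set (p' # ys). l \<bullet> y > 0)"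
  shows "subspace U \<Longrightarrow> dim U = k \<Longrightarrow> length ps + k = DIM('a) \<Longrightarrow> span (set ps \<union> U) = UNIV \<Longrightarrow>
    (\<And>ys. ys \<in> Poly_Mapping.keys c \<Longrightarrow> length ys = k \<and> set ys \<subseteq> W \<inter> U) \<Longrightarrow>
    \<forall>\<^sub>F z in generic U. frag_eval (cone_sign ps z) c = 0 \<Longrightarrow>
    frag_extend (\<lambda>ys. frag_of (map \<pi> ys)) c \<in> zmod.span (tuple_relations \<pi> (W \<inter> U) k)"
proof (induction k arbitrary: U ps c)
  case 0
  have U: "U = {0}" using 0(2) subspace_0[OF 0(1)] by (auto simp: dim_eq_0)
  obtain \<B> where \<B>: "finite \<B>" "\<forall>B\<in>\<B>. subspace B \<and> \<not> U \<subseteq> B"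
    "\<forall>z\<in>U. z \<notin> \<Union>\<B> \<longrightarrow> frag_eval (cone_sign ps z) c = 0"
    using 0(6) unfolding eventually_generic by blast
  \<comment> \<open>Every subspace contains the origin, so a generic property of \<open>{0}\<close>
    holds at 0 itself. The value there is the coefficient of the empty tuple up to a sign.\<close>
  have "\<B> = {}" using \<B>(2) U by (auto simp: subspace_0)
  then have e: "frag_eval (cone_sign ps 0) c = 0" using \<B>(3) U by simp
  have "D ps \<noteq> 0" using nonzero_iff[of ps] 0 U by simp
  then have s: "isgn (D ps) \<noteq> 0" by simp
  have keys: "Poly_Mapping.keys c \<subseteq> {[]}" using 0(5) by auto
  have "frag_eval (cone_sign ps 0) c = Poly_Mapping.lookup c [] * isgn (D ps)"
    using frag_eval_superset[OF _ keys] by (simp add: cone_sign_def)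
  then have "[] \<notin> Poly_Mapping.keys c" using e s by (simp add: in_keys_iff)
  then have "c = 0" using keys by (metis keys_eq_empty subset_singletonD insert_not_empty insertI1)
  then show ?case by (simp add: zmod.span_zero)
next
  case (Suc k)
  let ?\<beta> = "frag_extend (\<lambda>ys. frag_of (map \<pi> ys))"
  let ?R = "tuple_relations \<pi> (W \<inter> U) (Suc k)"
  show ?case
  proof (cases "Poly_Mapping.keys c = {}")
    case True
    then have "c = 0" by simp
    then show ?thesis by (simp add: zmod.span_zero)
  next
    case False
    then obtain ys0 where "ys0 \<in> Poly_Mapping.keys c" by blast
    then have "hd ys0 \<in> W \<inter> U" using Suc.prems(5)[of ys0] by (cases ys0) auto
    then obtain p where p: "p \<in> W" "p \<in> U" by blast
    define nondeg where "nondeg ys \<longleftrightarrow> D (ps @ ys) \<noteq> 0" for ys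
    have "\<exists>q. q \<in> W \<and> q \<in> U \<and> \<pi> q = \<pi> p \<and> (q = p \<or> q = - p) \<and> (\<exists>l. \<forall>y\<in>set (q # ys). l \<bullet> y > 0)"
      if "ys \<in> Poly_Mapping.keys c" "nondeg ys" for ys
    proof -
      have "distinct (ps @ ys)" "independent (set (ps @ ys))"
        using nonzero_independent[of "ps @ ys"] Suc.prems(3) Suc.prems(5)[OF that(1)] that(2)
        by (auto simp: nondeg_def)
      then have "distinct ys" "independent (set ys)"
        using independent_mono[of "set (ps @ ys)" "set ys"] by auto
      moreover have "set ys \<subseteq> W" using Suc.prems(5)[OF that(1)] by simp
      ultimately obtain q where "q \<in> W" "\<pi> q = \<pi> p" "q = p \<or> q = - p" "\<exists>l. \<forall>y\<in>set (q # ys). l \<bullet> y > 0"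
        using lift[of p ys] p by auto
      then show ?thesis using p subspace_neg[OF Suc.prems(1), of p] by auto
    qed
    then obtain f where f: "\<And>ys. ys \<in> Poly_Mapping.keys c \<Longrightarrow> nondeg ys \<Longrightarrow>
        f ys \<in> W \<and> f ys \<in> U \<and> \<pi> (f ys) = \<pi> p \<and> (f ys = p \<or> f ys = - p) \<and>
        (\<exists>l. \<forall>y\<in>set (f ys # ys). l \<bullet> y > 0)"
      by metis
    \<comment> \<open>The sign of the coning point is chosen tuple by tuple, so that
      \<open>f ys # ys\<close> lies in an open half-space. Degenerate tuples are dropped: their
      images are relations and their signed indicator function is zero.\<close>
    define T where "T ys = (if nondeg ys
        then \<Sum>i<Suc k. frag_cmul ((- 1) ^ i) (frag_of (f ys # omit i ys)) else 0)" for ys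
    define c' where "c' = frag_extend T c"
    have keys_c': "\<exists>q ys. \<kappa> = q # ys \<and> length ys = k \<and> set ys \<subseteq> W \<inter> U \<and> q \<in> W \<inter> U \<and>
        (q = p \<or> q = - p) \<and> \<pi> q = \<pi> p"
      if \<kappa>: "\<kappa> \<in> Poly_Mapping.keys c'" for \<kappa>
    proof -
      obtain ys where ys: "ys \<in> Poly_Mapping.keys c" "\<kappa> \<in> Poly_Mapping.keys (T ys)"
        using \<kappa> keys_frag_extend[of T c] by (auto simp: c'_def)
      then have nd: "nondeg ys" by (auto simp: T_def split: if_splits)
      have "\<kappa> \<in> (\<Union>i<Suc k. Poly_Mapping.keys (frag_cmul ((- 1) ^ i) (frag_of (f ys # omit i ys))))"
        using ys(2) nd unfolding T_def by (intro subsetD[OF keys_sum]) simp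
      then obtain i where i: "i < Suc k" "\<kappa> = f ys # omit i ys" by (auto simp: keys_frag_of)
      show ?thesis
        using f[OF ys(1) nd] Suc.prems(5)[OF ys(1)] set_omit_subset[of i ys] i
        by (intro exI[of _ "f ys"] exI[of _ "omit i ys"]) auto
    qed
    have \<beta>_c': "?\<beta> c - ?\<beta> c' \<in> zmod.span ?R"
    proof -
      have "frag_of (map \<pi> ys) - ?\<beta> (T ys) \<in> zmod.span ?R" if ys: "ys \<in> Poly_Mapping.keys c" for ys
      proof (cases "nondeg ys")
        case True
        have "frag_of (map \<pi> ys) - (\<Sum>i<Suc k. frag_cmul ((- 1) ^ i) (frag_of (\<pi> (f ys) # omit i (map \<pi> ys))))
            \<in> zmod.span ?R"
          using f[OF ys True] Suc.prems(5)[OF ys] by (intro cone_relation) auto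
        then show ?thesis
          using True by (simp add: T_def frag_extend_sum frag_extend_cmul map_omit del: sum.lessThan_Suc)
      next
        case False
        then have "dim (set ys) < Suc k"
          using nonzero_append[OF Suc.prems(3,4,1,2), of ys] Suc.prems(5)[OF ys] by (auto simp: nondeg_def)
        then show ?thesis
          using False Suc.prems(5)[OF ys] by (simp add: T_def) (intro degenerate_in_span, auto)
      qed
      then have "frag_extend (\<lambda>ys. frag_of (map \<pi> ys) - ?\<beta> (T ys)) c \<in> zmod.span ?R"
        by (rule frag_extend_in_span)
      then show ?thesis by (simp add: frag_extend_fun_diff c'_def frag_extend_extend)
    qed
    have ev_c': "\<forall>\<^sub>F z in generic U. frag_eval (cone_sign ps z) c' = 0"
    proof -
      have "\<forall>\<^sub>F z in generic U. frag_eval (cone_sign ps z) (T ys) = cone_sign ps z ys"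
        if ys: "ys \<in> Poly_Mapping.keys c" for ys
      proof (cases "nondeg ys")
        case True
        obtain l where l: "\<forall>y\<in>set (f ys # ys). l \<bullet> y > 0" using f[OF ys True] by blast
        have "\<forall>\<^sub>F z in generic U. (\<Sum>i<length (f ys # ys). (- 1) ^ i *
            (isgn (D (ps @ omit i (f ys # ys))) * of_bool (z \<in> convex_cone hull (set (omit i (f ys # ys)))))) = 0"
          by (rule alternating_cone_sum[where l = l])
             (use Suc.prems f[OF ys True] Suc.prems(5)[OF ys] l in auto)
        then show ?thesis
        proof eventually_elim
          case (elim z)
          then have "(\<Sum>i<Suc (Suc k). (- 1) ^ i * cone_sign ps z (omit i (f ys # ys))) = 0"
            using Suc.prems(5)[OF ys] by (simp add: cone_sign_def del: sum.lessThan_Suc)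
          then have "cone_sign ps z ys - (\<Sum>i<Suc k. (- 1) ^ i * cone_sign ps z (f ys # omit i ys)) = 0"
            by (simp add: sum.lessThan_Suc_shift[of _ "Suc k"] sum_negf del: sum.lessThan_Suc)
          then show ?case
            using True by (simp add: T_def frag_eval_sum frag_eval_cmul del: sum.lessThan_Suc)
        qed
      next
        case False
        then show ?thesis by (simp add: T_def cone_sign_def nondeg_def)
      qed
      then have "\<forall>\<^sub>F z in generic U. \<forall>ys\<in>Poly_Mapping.keys c.
          frag_eval (cone_sign ps z) (T ys) = cone_sign ps z ys"
        by (intro eventually_ball_finite) auto
      with Suc.prems(6) show ?thesis
      proof eventually_elim
        case (elim z)
        then show ?case
          unfolding c'_def frag_eval_extend using frag_eval_cong[of c] by metis
      qed
    qed
    define HH where "HH = (\<lambda>\<kappa>. span (set (tl \<kappa>))) ` {\<kappa> \<in> Poly_Mapping.keys c'. nondeg \<kappa>}"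
    have finHH: "finite HH" by (simp add: HH_def)
    have HH: "subspace H \<and> H \<subseteq> U \<and> dim H = k \<and> p \<notin> H \<and> span (insert p H) = U" if "H \<in> HH" for H
    proof -
      obtain \<kappa> where \<kappa>: "\<kappa> \<in> Poly_Mapping.keys c'" "nondeg \<kappa>" "H = span (set (tl \<kappa>))"
        using \<open>H \<in> HH\<close> by (auto simp: HH_def)
      obtain q ys where q: "\<kappa> = q # ys" "length ys = k" "set ys \<subseteq> W \<inter> U" "q \<in> W \<inter> U" "q = p \<or> q = - p"
        using keys_c'[OF \<kappa>(1)] by blast
      have H: "H = span (set ys)" using \<kappa> q by simp
      have nz: "D (ps @ q # ys) \<noteq> 0" using \<kappa> q by (simp add: nondeg_def)
      have U: "span (insert q (set ys)) = U"
        using span_of_nonzero[OF Suc.prems(1), of ps "q # ys"] Suc.prems q nz by auto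
      have "dim (set ys) \<le> k" using dim_le_card'[of "set ys"] card_length[of ys] q by simp
      moreover have "dim (insert q (set ys)) = Suc k"
        using U Suc.prems(2) dim_span[of "insert q (set ys)"] by simp
      ultimately have d: "dim (set ys) = k" "q \<notin> span (set ys)"
        by (auto simp: dim_insert split: if_splits)
      have pq: "x \<in> span S \<longleftrightarrow> - x \<in> span S" for x :: 'a and S
        using span_neg[of x S] span_neg[of "- x" S] by auto
      have "span (insert p H) = span (insert q (set ys))"
      proof
        have "p \<in> span (insert q (set ys))"
          using q(5) pq[of q] span_base[of q "insert q (set ys)"] by auto
        then show "span (insert p H) \<subseteq> span (insert q (set ys))"
          unfolding H by (intro span_minimal) (auto intro: subsetD[OF span_mono, rotated])
        have "q \<in> span (insert p H)"
          using q(5) pq[of p] span_base[of p "insert p H"] by auto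
        then show "span (insert q (set ys)) \<subseteq> span (insert p H)"
          by (intro span_minimal) (auto intro!: span_base simp: H)
      qed
      moreover have "p \<notin> H" using d(2) q(5) pq[of p] by (auto simp: H)
      moreover have "H \<subseteq> U" unfolding H using q(3) Suc.prems(1) by (intro span_minimal) auto
      ultimately show ?thesis using d U by (auto simp: H subspace_span)
    qed
    \<comment> \<open>The bases of those nondegenerate cones of \<open>c'\<close> that stand on the
      hyperplane \<open>H\<close> of \<open>U\<close>.\<close>
    define d where "d H = frag_extend (\<lambda>\<kappa>. if nondeg \<kappa> \<and> span (set (tl \<kappa>)) = H
        then frag_of (tl \<kappa>) else 0) c'" for H
    have d_zero: "\<forall>\<^sub>F z in generic H. frag_eval (cone_sign (ps @ [p]) z) (d H) = 0" if H: "H \<in> HH" for H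
    proof -
      obtain \<B> where \<B>: "finite \<B>" "\<forall>B\<in>\<B>. subspace B \<and> \<not> U \<subseteq> B"
        "\<forall>z\<in>U. z \<notin> \<Union>\<B> \<longrightarrow> frag_eval (cone_sign ps z) c' = 0"
        using ev_c' unfolding eventually_generic by blast
      \<comment> \<open>Exceptional subspaces of \<open>c'\<close> that contain \<open>p\<close> are
        avoided by \<open>z\<close> itself, which is possible as \<open>H\<close> and
        \<open>p\<close> span \<open>U\<close>. Those without \<open>p\<close> are avoided further
        below by moving from \<open>z\<close> a little in the directions \<open>p\<close> and
        \<open>- p\<close>. Avoiding the other hyperplanes in \<open>HH\<close> excludes their jumps
        at \<open>z\<close>.\<close>
      have "\<forall>\<^sub>F z in generic H. z \<in> H \<and> z \<notin> B" if "B \<in> {B \<in> \<B>. p \<in> B} \<union> (HH - {H})" for B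
      proof (rule generic_subspace)
        show "subspace B" using that \<B> HH by auto
        show "\<not> H \<subseteq> B"
        proof
          assume HB: "H \<subseteq> B"
          show False
          proof (cases "B \<in> \<B> \<and> p \<in> B")
            case True
            then have "span (insert p H) \<subseteq> B" using HB \<B> by (intro span_minimal) auto
            then show False using True \<B> HH[OF H] by auto
          next
            case False
            then have B: "B \<in> HH" "B \<noteq> H" using that by auto
            then show False
              using subspace_dim_equal[of H B] HB HH[OF H] HH[OF B(1)] by auto
          qed
        qed
      qed
      then have "\<forall>\<^sub>F z in generic H. \<forall>B\<in>{B \<in> \<B>. p \<in> B} \<union> (HH - {H}). z \<in> H \<and> z \<notin> B"
        using \<B>(1) finHH by (intro eventually_ball_finite) auto
      moreover have "\<forall>\<^sub>F z in generic H. z \<in> H" by (rule generic_all)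
      ultimately show ?thesis
      proof eventually_elim
        case (elim z)
        then have zH: "z \<in> H" and zB: "\<And>B. B \<in> \<B> \<Longrightarrow> p \<in> B \<Longrightarrow> z \<notin> B"
          and zHH: "\<And>H'. H' \<in> HH \<Longrightarrow> H' \<noteq> H \<Longrightarrow> z \<notin> H'" by auto
        have zU: "z \<in> U" using zH HH[OF H] by auto
        have "\<forall>\<^sub>F t in at_right 0. t \<notin> {t. z + t *\<^sub>R p \<in> B} \<and> t \<notin> {t. z + t *\<^sub>R (- p) \<in> B}" if "B \<in> \<B>" for B
        proof (intro eventually_conj eventually_at_right_notin_finite finite_line_inter_subspace)
          show "\<not> (z \<in> B \<and> - p \<in> B)" using zB[OF that] subspace_neg[of B "- p"] \<B>(2) that by auto
        qed (use zB that \<B>(2) in auto)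
        then have 1: "\<forall>\<^sub>F t in at_right 0. \<forall>B\<in>\<B>. t \<notin> {t. z + t *\<^sub>R p \<in> B} \<and> t \<notin> {t. z + t *\<^sub>R (- p) \<in> B}"
          using \<B>(1) by (intro eventually_ball_finite) auto
        let ?J = "\<lambda>\<kappa>. if nondeg \<kappa> \<and> span (set (tl \<kappa>)) = H then cone_sign (ps @ [p]) z (tl \<kappa>) else 0"
        have "\<forall>\<^sub>F t in at_right 0. cone_sign ps (z + t *\<^sub>R p) \<kappa> - cone_sign ps (z - t *\<^sub>R p) \<kappa> = ?J \<kappa>"
          if \<kappa>: "\<kappa> \<in> Poly_Mapping.keys c'" for \<kappa>
        proof (cases "nondeg \<kappa>")
          case True
          obtain q ys where q: "\<kappa> = q # ys" "length ys = k" "set ys \<subseteq> W \<inter> U" "q \<in> W \<inter> U" "q = p \<or> q = - p"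
            using keys_c'[OF \<kappa>] by blast
          have "span (set ys) \<in> HH" using \<kappa> True q(1) by (auto simp: HH_def image_iff intro!: bexI[of _ \<kappa>])
          then have "z \<in> span (set ys) \<Longrightarrow> span (set ys) = H" using zHH by auto
          then have "\<forall>\<^sub>F t in at_right 0. cone_sign ps (z + t *\<^sub>R p) (q # ys) - cone_sign ps (z - t *\<^sub>R p) (q # ys)
              = (if span (set ys) = H then cone_sign (ps @ [p]) z ys else 0)"
            using Suc.prems q True zU zH by (intro cone_sign_jump[of U k]) (auto simp: nondeg_def)
          then show ?thesis using True q(1) by (simp cong: if_cong split: if_splits)
        next
          case False
          then show ?thesis by (simp add: cone_sign_def nondeg_def)
        qed
        then have "\<forall>\<^sub>F t in at_right 0. \<forall>\<kappa>\<in>Poly_Mapping.keys c'.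
            cone_sign ps (z + t *\<^sub>R p) \<kappa> - cone_sign ps (z - t *\<^sub>R p) \<kappa> = ?J \<kappa>"
          by (intro eventually_ball_finite) auto
        with 1 have "\<forall>\<^sub>F t in at_right (0::real). frag_eval (cone_sign (ps @ [p]) z) (d H) = 0"
        proof eventually_elim
          case (elim t)
          have "z + t *\<^sub>R p \<in> U" "z - t *\<^sub>R p \<in> U"
            using zU p(2) Suc.prems(1) by (auto intro: subspace_add subspace_diff subspace_scale)
          then have "frag_eval (cone_sign ps (z + t *\<^sub>R p)) c' = 0" "frag_eval (cone_sign ps (z - t *\<^sub>R p)) c' = 0"
            using \<B>(3) elim(1) by auto
          \<comment> \<open>The combined function vanishes on both sides of \<open>H\<close>, so the
            total jump at \<open>z\<close> is zero, and this jump is the value of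
            \<open>d H\<close>.\<close>
          then have "0 = frag_eval (\<lambda>\<kappa>. cone_sign ps (z + t *\<^sub>R p) \<kappa> - cone_sign ps (z - t *\<^sub>R p) \<kappa>) c'"
            by (simp add: frag_eval_fun_diff)
          also have "\<dots> = frag_eval ?J c'" using elim(2) by (intro frag_eval_cong) auto
          also have "\<dots> = frag_eval (cone_sign (ps @ [p]) z) (d H)"
            unfolding d_def frag_eval_extend by (intro frag_eval_cong) simp
          finally show ?case by simp
        qed
        then show ?case by simp
      qed
    qed
    have d_span: "frag_cons (\<pi> p) (?\<beta> (d H)) \<in> zmod.span ?R" if H: "H \<in> HH" for H
    proof -
      \<comment> \<open>The induction hypothesis is used in \<open>H\<close> with \<open>p\<close>
        appended to \<open>ps\<close>, because the jumps are values of
        \<open>cone_sign (ps @ [p])\<close>.\<close>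
      have "?\<beta> (d H) \<in> zmod.span (tuple_relations \<pi> (W \<inter> H) k)"
      proof (rule Suc.IH[OF _ _ _ _ _ d_zero[OF H]])
        show "span (set (ps @ [p]) \<union> H) = UNIV"
        proof -
          have "U \<subseteq> span (set (ps @ [p]) \<union> H)"
            using HH[OF H] span_mono[of "insert p H" "set (ps @ [p]) \<union> H"] by auto
          moreover have "set ps \<subseteq> span (set (ps @ [p]) \<union> H)" by (auto intro: span_base)
          ultimately have "span (set ps \<union> U) \<subseteq> span (set (ps @ [p]) \<union> H)"
            by (intro span_minimal) auto
          then show ?thesis using Suc.prems(4) by (metis top.extremum_uniqueI)
        qed
        show "length ys = k \<and> set ys \<subseteq> W \<inter> H" if ysd: "ys \<in> Poly_Mapping.keys (d H)" for ys
        proof -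
          obtain \<kappa> where \<kappa>: "\<kappa> \<in> Poly_Mapping.keys c'" "nondeg \<kappa>" "span (set (tl \<kappa>)) = H" "ys = tl \<kappa>"
            using ysd keys_frag_extend[of "\<lambda>\<kappa>. if nondeg \<kappa> \<and> span (set (tl \<kappa>)) = H
              then frag_of (tl \<kappa>) else 0" c']
            by (auto simp: d_def split: if_splits)
          then show ?thesis using keys_c'[OF \<kappa>(1)] span_superset[of "set ys"] by auto
        qed
      qed (use HH[OF H] Suc.prems(3) in auto)
      then show ?thesis
        unfolding frag_cons_def
        by (rule frag_extend_span_image)
           (use HH[OF H] p frag_cons_relations[of H k U p W] in \<open>auto simp: frag_cons_def\<close>)
    qed
    \<comment> \<open>Every coning point has image \<open>\<pi> p\<close>, so the choice between
      \<open>p\<close> and \<open>- p\<close> is invisible here: modulo degenerate tuples, the image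
      of \<open>c'\<close> is the sum of the cones over the \<open>d H\<close>.\<close>
    have "?\<beta> c' - (\<Sum>H\<in>HH. frag_cons (\<pi> p) (?\<beta> (d H))) \<in> zmod.span ?R"
    proof -
      let ?s = "\<lambda>\<kappa> H. if nondeg \<kappa> \<and> span (set (tl \<kappa>)) = H then frag_of (\<pi> p # map \<pi> (tl \<kappa>)) else 0"
      have "frag_of (map \<pi> \<kappa>) - (\<Sum>H\<in>HH. ?s \<kappa> H) \<in> zmod.span ?R" if \<kappa>: "\<kappa> \<in> Poly_Mapping.keys c'" for \<kappa>
      proof -
        obtain q ys where q: "\<kappa> = q # ys" "length ys = k" "set ys \<subseteq> W \<inter> U" "q \<in> W \<inter> U" "\<pi> q = \<pi> p"
          using keys_c'[OF \<kappa>] by blast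
        show ?thesis
        proof (cases "nondeg \<kappa>")
          case True
          then have "span (set ys) \<in> HH" using \<kappa> q(1) by (auto simp: HH_def image_iff intro!: bexI[of _ \<kappa>])
          then have "(\<Sum>H\<in>HH. ?s \<kappa> H) = frag_of (map \<pi> \<kappa>)"
            using True q finHH by (simp add: sum.delta)
          then show ?thesis by (simp add: zmod.span_zero)
        next
          case False
          then have "dim (set \<kappa>) < Suc k"
            using nonzero_append[OF Suc.prems(3,4,1,2), of \<kappa>] q by (auto simp: nondeg_def)
          then have "frag_of (map \<pi> \<kappa>) \<in> zmod.span ?R" using q by (intro degenerate_in_span) auto
          then show ?thesis using False by simp
        qed
      qed
      then have "frag_extend (\<lambda>\<kappa>. frag_of (map \<pi> \<kappa>) - (\<Sum>H\<in>HH. ?s \<kappa> H)) c' \<in> zmod.span ?R"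
        by (rule frag_extend_in_span)
      moreover have "frag_extend (\<lambda>\<kappa>. ?s \<kappa> H) c' = frag_cons (\<pi> p) (?\<beta> (d H))" for H
        unfolding d_def frag_cons_def frag_extend_extend
        by (rule arg_cong2[of _ _ _ _ frag_extend]) auto
      ultimately show ?thesis by (simp add: frag_extend_fun_diff frag_extend_fun_sum)
    qed
    moreover have "(\<Sum>H\<in>HH. frag_cons (\<pi> p) (?\<beta> (d H))) \<in> zmod.span ?R"
      using d_span by (rule zmod.span_sum)
    ultimately have "?\<beta> c' \<in> zmod.span ?R" using zmod.span_add by fastforce
    then show ?thesis using \<beta>_c' zmod.span_add by fastforce
  qed
qed

end

section \<open>Decomposing polyhedral cones into simplicial cones\<close>

text \<open>Under a retraction \<open>f\<close> of \<open>U\<close> onto \<open>H\<close>, the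
  preimage of a subspace not containing \<open>H\<close> does not contain \<open>U\<close>. So
  statements about generic points of a facet hyperplane transfer to generic points of the larger
  space.\<close>

lemma generic_retract:
  fixes f :: "'a::real_vector \<Rightarrow> 'a"
  assumes P: "\<forall>\<^sub>F z in generic H. P z"
    and f: "linear f" "f ` U \<subseteq> H" "H \<subseteq> U" "\<And>h. h \<in> H \<Longrightarrow> f h = h"
  shows "\<forall>\<^sub>F z in generic U. P (f z)"
proof -
  obtain \<B> where \<B>: "finite \<B>" "\<forall>B\<in>\<B>. subspace B \<and> \<not> H \<subseteq> B" "\<forall>z\<in>H. z \<notin> \<Union>\<B> \<longrightarrow> P z"
    using P unfolding eventually_generic by blast
  have "\<forall>\<^sub>F z in generic U. z \<in> U \<and> z \<notin> f -` B" if "B \<in> \<B>" for B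
  proof (rule generic_subspace)
    show "subspace (f -` B)" using \<B>(2) that by (intro linear_subspace_vimage[OF f(1)]) auto
    obtain h where "h \<in> H" "h \<notin> B" using \<B>(2) \<open>B \<in> \<B>\<close> by auto
    then show "\<not> U \<subseteq> f -` B" using f(3) f(4)[of h] by auto
  qed
  then have "\<forall>\<^sub>F z in generic U. \<forall>B\<in>\<B>. z \<in> U \<and> z \<notin> f -` B"
    using \<B>(1) by (intro eventually_ball_finite) auto
  moreover have "\<forall>\<^sub>F z in generic U. z \<in> U" by (rule generic_all)
  ultimately show ?thesis
    by eventually_elim (use \<B>(3) f(2) in auto)
qed

lemma mem_join_point:
  fixes q :: "'a::real_vector"
  assumes "subspace H" "q \<notin> H" "h \<in> H" "Q \<subseteq> H"
  shows "(\<exists>t\<ge>0. a *\<^sub>R q + h - t *\<^sub>R q \<in> Q) \<longleftrightarrow> 0 \<le> a \<and> h \<in> Q"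
proof -
  have "t = a" if "a *\<^sub>R q + h - t *\<^sub>R q \<in> Q" for t
  proof (rule ccontr)
    assume "t \<noteq> a"
    have "a *\<^sub>R q + h - t *\<^sub>R q - h \<in> H"
      using that assms by (intro subspace_diff[OF assms(1), of "a *\<^sub>R q + h - t *\<^sub>R q" h]) auto
    then have "(a - t) *\<^sub>R q \<in> H" by (simp add: algebra_simps)
    then have "(1 / (a - t)) *\<^sub>R (a - t) *\<^sub>R q \<in> H" by (rule subspace_scale[OF assms(1)])
    then show False using \<open>t \<noteq> a\<close> assms(2) by simp
  qed
  moreover have "a *\<^sub>R q + h - a *\<^sub>R q = h" by simp
  ultimately show ?thesis by metis
qed

section \<open>Faces and vertices of polyhedral cones\<close>

definition flat :: "'a::real_inner set \<Rightarrow> 'a set" where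
  "flat E = {x. \<forall>a\<in>E. a \<bullet> x = 0}"

text \<open>Equations \<open>E\<close> and inequalities \<open>A\<close> are kept apart: passing to
  a face adds a normal to \<open>E\<close> while \<open>A\<close> stays fixed, which suits induction
  on the dimension of \<open>flat E\<close>.\<close>

definition polyhedral_cone :: "'a::real_inner set \<Rightarrow> 'a set \<Rightarrow> 'a set" where
  "polyhedral_cone E A = {x \<in> flat E. \<forall>a\<in>A. a \<bullet> x \<le> 0}"

lemma subspace_flat: "subspace (flat E)"
  by (auto simp: flat_def subspace_def inner_add_right)

lemma flat_insert: "flat (insert a E) = flat E \<inter> {x. a \<bullet> x = 0}"
  by (auto simp: flat_def)

lemma polyhedral_cone_insert:
  "polyhedral_cone (insert a E) A = polyhedral_cone E A \<inter> flat (insert a E)"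
  by (auto simp: polyhedral_cone_def flat_def)

lemma dim_flat_insert:
  fixes a :: "'a::euclidean_space"
  assumes "x \<in> flat E" "a \<bullet> x \<noteq> 0"
  shows "dim (flat E) = Suc (dim (flat (insert a E)))"
    and "span (insert x (flat (insert a E))) = flat E"
proof -
  have xn: "x \<notin> flat (insert a E)" using assms(2) by (simp add: flat_def)
  show eq: "span (insert x (flat (insert a E))) = flat E"
  proof
    show "span (insert x (flat (insert a E))) \<subseteq> flat E"
      using assms(1) by (intro span_minimal subspace_flat) (auto simp: flat_insert)
    show "flat E \<subseteq> span (insert x (flat (insert a E)))"
    proof
      fix y assume y: "y \<in> flat E"
      define t where "t = (a \<bullet> y) / (a \<bullet> x)"
      have "y - t *\<^sub>R x \<in> flat (insert a E)"
        using y assms by (auto simp: flat_def t_def inner_diff_right)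
      then show "y \<in> span (insert x (flat (insert a E)))"
        by (auto simp: span_breakdown_eq intro: span_base)
    qed
  qed
  have "x \<notin> span (flat (insert a E))" using xn span_eq_iff subspace_flat by blast
  then have "dim (insert x (flat (insert a E))) = Suc (dim (flat (insert a E)))"
    by (simp add: dim_insert)
  then show "dim (flat E) = Suc (dim (flat (insert a E)))"
    using dim_span[of "insert x (flat (insert a E))"] eq by simp
qed

text \<open>Used with \<open>N\<close> the normals and \<open>W\<close> the vertices of a collection
  and \<open>C\<close> the model cone. The assumption then says that a line cut out by hyperplanes
  of the collection carries a vertex on each of its rays inside the model cone.\<close>

context
  fixes N W C :: "'a::euclidean_space set"
  assumes vertex: "\<And>E x. finite E \<Longrightarrow> E \<subseteq> N \<Longrightarrow> dim (flat E) = 1 \<Longrightarrow> x \<in> flat E \<Longrightarrow> x \<noteq> 0 \<Longrightarrow> x \<in> C \<Longrightarrow>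
      \<exists>t>0. t *\<^sub>R x \<in> W"
begin

text \<open>Pointedness gives a direction in \<open>flat E\<close>, not proportional to
  \<open>x\<close>, along which the cone is eventually left. Following it from \<open>x\<close> to
  the last point of the cone makes one more inequality tight and lowers the dimension of the flat.
  The endpoint is nonzero because the direction is not proportional to \<open>x\<close>.\<close>

lemma ex_vertex:
  assumes "finite E" "E \<subseteq> N" "finite A" "A \<subseteq> N"
    and "x \<in> polyhedral_cone E A" "x \<noteq> 0"
    and "\<And>x. x \<in> polyhedral_cone E A \<Longrightarrow> x \<noteq> 0 \<Longrightarrow> x \<in> C \<and> l \<bullet> x > 0"
  shows "\<exists>w\<in>W. w \<noteq> 0 \<and> w \<in> polyhedral_cone E A"
  using assms
proof (induction "dim (flat E)" arbitrary: E x rule: less_induct)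
  case less
  have xU: "x \<in> flat E" using less.prems(5) by (simp add: polyhedral_cone_def)
  have d0: "dim (flat E) \<noteq> 0" using xU less.prems(6) by (auto simp: dim_eq_0)
  show ?case
  proof (cases "dim (flat E) = 1")
    case True
    then obtain t where t: "t > 0" "t *\<^sub>R x \<in> W"
      using vertex[of E x] less.prems xU by blast
    then show ?thesis
      using less.prems(5,6) subspace_scale[OF subspace_flat xU]
      by (intro bexI[of _ "t *\<^sub>R x"]) (auto simp: polyhedral_cone_def mult_nonneg_nonpos)
  next
    case False
    have "\<not> flat E \<subseteq> span {x}"
    proof
      assume "flat E \<subseteq> span {x}"
      then have "dim (flat E) \<le> dim {x}" using dim_subset dim_span by metis
      also have "\<dots> \<le> 1" using dim_le_card'[of "{x}"] by simp
      finally show False using d0 False by simp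
    qed
    then obtain y0 where y0: "y0 \<in> flat E" "y0 \<notin> span {x}" by auto
    have "y0 \<noteq> 0" using y0(2) span_zero by auto
    have "\<not> (y0 \<in> polyhedral_cone E A \<and> - y0 \<in> polyhedral_cone E A)"
      using less.prems(7)[of y0] less.prems(7)[of "- y0"] \<open>y0 \<noteq> 0\<close> by auto
    then obtain y where "y = y0 \<or> y = - y0" and yK: "y \<notin> polyhedral_cone E A" by blast
    then have y: "y \<in> flat E" "y \<notin> span {x}"
      using y0 subspace_neg[OF subspace_flat y0(1)] span_neg[of "- y0" "{x}"] by auto
    define J where "J = {a \<in> A. a \<bullet> y > 0}"
    have "finite J" "J \<noteq> {}"
      using yK y(1) less.prems(3) by (auto simp: J_def polyhedral_cone_def not_le)
    then have "Min ((\<lambda>a. - (a \<bullet> x) / (a \<bullet> y)) ` J) \<in> (\<lambda>a. - (a \<bullet> x) / (a \<bullet> y)) ` J"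
      by (intro Min_in) auto
    then obtain a where a: "a \<in> J" "Min ((\<lambda>a. - (a \<bullet> x) / (a \<bullet> y)) ` J) = - (a \<bullet> x) / (a \<bullet> y)" by auto
    \<comment> \<open>The largest step that keeps all inequalities; the inequality of
      \<open>a\<close> becomes tight there.\<close>
    define s where "s = - (a \<bullet> x) / (a \<bullet> y)"
    have smin: "s \<le> - (b \<bullet> x) / (b \<bullet> y)" if "b \<in> J" for b
      unfolding s_def a(2)[symmetric] using that \<open>finite J\<close> by (intro Min_le) auto
    have xA: "b \<bullet> x \<le> 0" if "b \<in> A" for b
      using less.prems(5) that by (simp add: polyhedral_cone_def)
    have s0: "s \<ge> 0"
      using xA[of a] a(1) by (auto simp: s_def J_def divide_nonpos_pos)
    define x' where "x' = x + s *\<^sub>R y"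
    have x'U: "x' \<in> flat E"
      unfolding x'_def by (intro subspace_add subspace_scale subspace_flat xU y)
    have "b \<bullet> x' \<le> 0" if "b \<in> A" for b
    proof (cases "b \<in> J")
      case True
      then have "s * (b \<bullet> y) \<le> - (b \<bullet> x)"
        using smin[OF True] pos_le_divide_eq[of "b \<bullet> y" s "- (b \<bullet> x)"] by (simp add: J_def)
      then show ?thesis by (simp add: x'_def inner_add_right)
    next
      case False
      then show ?thesis
        using xA[OF that] s0 that by (auto simp: x'_def inner_add_right J_def intro!: add_nonpos_nonpos mult_nonneg_nonpos)
    qed
    moreover have "a \<bullet> x' = 0"
    proof -
      have "s * (a \<bullet> y) = - (a \<bullet> x)" using a(1) by (simp add: s_def J_def)
      then show ?thesis by (simp add: x'_def inner_add_right)
    qed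
    ultimately have x'K: "x' \<in> polyhedral_cone (insert a E) A"
      using x'U by (auto simp: polyhedral_cone_def flat_def)
    have "x' \<noteq> 0"
    proof
      assume "x' = 0"
      then have sy: "s *\<^sub>R y = - x" by (simp add: x'_def eq_neg_iff_add_eq_0 add.commute)
      then have "s \<noteq> 0" using less.prems(6) by auto
      then have "y = (- 1 / s) *\<^sub>R x" using arg_cong[OF sy, of "scaleR (1 / s)"] by simp
      then show False using y(2) span_scale[OF span_base[of x "{x}"], of "- 1 / s"] by simp
    qed
    have "dim (flat (insert a E)) < dim (flat E)"
      using dim_flat_insert(1)[OF y(1), of a] a(1) by (auto simp: J_def)
    moreover have sub: "polyhedral_cone (insert a E) A \<subseteq> polyhedral_cone E A"
      by (auto simp: polyhedral_cone_insert)
    ultimately have "\<exists>w\<in>W. w \<noteq> 0 \<and> w \<in> polyhedral_cone (insert a E) A"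
      using less.prems x'K \<open>x' \<noteq> 0\<close> a(1) by (intro less.hyps[of "insert a E" x']) (auto simp: J_def)
    then show ?thesis using sub by blast
  qed
qed

text \<open>
  A pointed cone is the union of the joins of one of its vertices \<open>p\<close> with the faces in the
  facet hyperplanes that miss \<open>p\<close>, and these joins overlap only in lower dimension.
\<close>

theorem polyhedral_cone_eq_simplicial_cones:
  assumes "finite A" "A \<subseteq> N"
  shows "finite E \<Longrightarrow> E \<subseteq> N \<Longrightarrow> dim (flat E) = k \<Longrightarrow>
    (\<And>x. x \<in> polyhedral_cone E A \<Longrightarrow> x \<noteq> 0 \<Longrightarrow> x \<in> C \<and> l \<bullet> x > 0) \<Longrightarrow>
    \<exists>c. (\<forall>ys\<in>Poly_Mapping.keys c. length ys = k \<and> set ys \<subseteq> W \<inter> flat E) \<and>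
        (\<forall>\<^sub>F z in generic (flat E).
           frag_eval (\<lambda>ys. of_bool (z \<in> convex_cone hull (set ys))) c = of_bool (z \<in> polyhedral_cone E A))"
proof (induction k arbitrary: E)
  case 0
  then have "flat E = {0}" using subspace_0[OF subspace_flat, of E] by (auto simp: dim_eq_0)
  then have "\<forall>\<^sub>F z in generic (flat E). frag_eval (\<lambda>ys. of_bool (z \<in> convex_cone hull (set ys))) (frag_of [])
      = of_bool (z \<in> polyhedral_cone E A)"
    by (intro generic_all) (auto simp: polyhedral_cone_def)
  then show ?case by (intro exI[of _ "frag_of []"]) auto
next
  case (Suc k)
  let ?K = "polyhedral_cone E A"
  have nz: "\<forall>\<^sub>F z in generic (flat E). z \<in> flat E \<and> z \<notin> {0}"
    using Suc.prems(3) by (intro generic_subspace) (auto simp flip: dim_eq_0)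
  show ?case
  proof (cases "\<exists>x\<in>?K. x \<noteq> 0")
    case False
    have "\<forall>\<^sub>F z in generic (flat E). frag_eval (\<lambda>ys. of_bool (z \<in> convex_cone hull (set ys))) 0
        = of_bool (z \<in> ?K)"
      using nz by eventually_elim (use False in auto)
    then show ?thesis by (intro exI[of _ 0]) auto
  next
    case True
    then obtain x where "x \<in> ?K" "x \<noteq> 0" by auto
    then obtain p where p: "p \<in> W" "p \<noteq> 0" "p \<in> ?K"
      using ex_vertex[OF Suc.prems(1,2) assms, of x l] Suc.prems(4) by blast
    have pU: "p \<in> flat E" using p(3) by (simp add: polyhedral_cone_def)
    have pA: "a \<bullet> p \<le> 0" if "a \<in> A" for a using p(3) that by (simp add: polyhedral_cone_def)
    define J where "J = {a \<in> A. a \<bullet> p < 0}"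
    have finJ: "finite J" using assms(1) by (simp add: J_def)
    \<comment> \<open>If all inequalities were tight at \<open>p\<close>, then \<open>- p\<close>
      would lie in the cone as well, against pointedness.\<close>
    have "J \<noteq> {}"
    proof
      assume "J = {}"
      then have "a \<bullet> p = 0" if "a \<in> A" for a using pA[OF that] that by (force simp: J_def)
      then have "- p \<in> ?K" using subspace_neg[OF subspace_flat pU] by (auto simp: polyhedral_cone_def)
      then show False using Suc.prems(4)[of p] Suc.prems(4)[of "- p"] p by auto
    qed
    \<comment> \<open>A set of hyperplanes rather than of normals, since different normals may
      define the same facet hyperplane, which must not be counted twice.\<close>
    define HH where "HH = (\<lambda>a. flat (insert a E)) ` J"
    have finHH: "finite HH" using finJ by (simp add: HH_def)
    have H: "subspace H" "H \<subseteq> flat E" "dim H = k" "p \<notin> H" "span (insert p H) = flat E" if "H \<in> HH" for H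
    proof -
      obtain a where a: "a \<in> J" "H = flat (insert a E)" using \<open>H \<in> HH\<close> by (auto simp: HH_def)
      then have "a \<bullet> p \<noteq> 0" by (simp add: J_def)
      then show "dim H = k" "span (insert p H) = flat E"
        using dim_flat_insert[OF pU, of a] Suc.prems(3) a(2) by simp_all
      show "subspace H" using a(2) subspace_flat by simp
      show "H \<subseteq> flat E" "p \<notin> H" using a(2) \<open>a \<bullet> p \<noteq> 0\<close> by (auto simp: flat_def)
    qed
    \<comment> \<open>Going from a point \<open>z\<close> of the cone in direction
      \<open>- p\<close>, the cone is left through a facet hyperplane that misses \<open>p\<close>.
      This hyperplane is unique unless \<open>z\<close> lies in the span of \<open>p\<close> and an
      intersection of two such hyperplanes, which is a proper subspace.\<close>
    have K_decomp: "\<forall>\<^sub>F z in generic (flat E).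
        of_bool (z \<in> ?K) = (\<Sum>H\<in>HH. of_bool (\<exists>t\<ge>0. z - t *\<^sub>R p \<in> ?K \<inter> H) :: int)"
    proof -
      have "\<forall>\<^sub>F z in generic (flat E). z \<in> flat E \<and> z \<notin> span (insert p (H1 \<inter> H2))"
        if "H1 \<in> HH" "H2 \<in> HH" "H1 \<noteq> H2" for H1 H2
      proof (rule generic_subspace)
        have "\<not> H1 \<subseteq> H2"
          using subspace_dim_equal[of H1 H2] H[OF that(1)] H[OF that(2)] that(3) by auto
        then have "H1 \<inter> H2 \<noteq> H1" by auto
        moreover have "subspace (H1 \<inter> H2)" using H that by (intro subspace_inter) auto
        ultimately have "dim (H1 \<inter> H2) < k"
          using subspace_dim_equal[of "H1 \<inter> H2" H1] H[OF that(1)] by (meson inf_le1 not_le_imp_less)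
        then have "dim (insert p (H1 \<inter> H2)) \<le> k" by (simp add: dim_insert)
        then show "\<not> flat E \<subseteq> span (insert p (H1 \<inter> H2))"
          using dim_subset[of "flat E" "span (insert p (H1 \<inter> H2))"] Suc.prems(3) by auto
      qed (simp add: subspace_span)
      then have "\<forall>\<^sub>F z in generic (flat E). \<forall>(H1, H2)\<in>{(H1, H2) \<in> HH \<times> HH. H1 \<noteq> H2}.
          z \<in> flat E \<and> z \<notin> span (insert p (H1 \<inter> H2))"
        using finHH by (intro eventually_ball_finite) (auto intro: finite_subset[of _ "HH \<times> HH"])
      moreover have "\<forall>\<^sub>F z in generic (flat E). z \<in> flat E" by (rule generic_all)
      ultimately show ?thesis
      proof eventually_elim
        case (elim z)
        let ?S = "{H \<in> HH. \<exists>t\<ge>0. z - t *\<^sub>R p \<in> ?K \<inter> H}"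
        have uniq: "H1 = H2" if "H1 \<in> ?S" "H2 \<in> ?S" for H1 H2
        proof (rule ccontr)
          assume ne: "H1 \<noteq> H2"
          obtain a1 t1 where 1: "H1 = flat (insert a1 E)" "a1 \<in> J" "t1 \<ge> 0" "z - t1 *\<^sub>R p \<in> ?K" "z - t1 *\<^sub>R p \<in> H1"
            using \<open>H1 \<in> ?S\<close> by (auto simp: HH_def)
          obtain a2 t2 where 2: "H2 = flat (insert a2 E)" "a2 \<in> J" "t2 \<ge> 0" "z - t2 *\<^sub>R p \<in> ?K" "z - t2 *\<^sub>R p \<in> H2"
            using \<open>H2 \<in> ?S\<close> by (auto simp: HH_def)
          have le: "t \<le> t'" if "a \<in> J" "z - t *\<^sub>R p \<in> ?K" "a \<bullet> (z - t' *\<^sub>R p) = 0" for a t t'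
          proof -
            have "a \<bullet> z - t * (a \<bullet> p) \<le> 0"
              using that(1,2) by (auto simp: J_def polyhedral_cone_def inner_diff_right)
            moreover have "a \<bullet> z = t' * (a \<bullet> p)" using that(3) by (simp add: inner_diff_right)
            ultimately have "(t' - t) * (a \<bullet> p) \<le> 0" by (simp add: algebra_simps)
            then show ?thesis using that(1) by (auto simp: J_def mult_le_0_iff)
          qed
          have "a1 \<bullet> (z - t1 *\<^sub>R p) = 0" "a2 \<bullet> (z - t2 *\<^sub>R p) = 0"
            using 1(1,5) 2(1,5) by (auto simp: flat_def)
          then have "t1 = t2" using le[OF 1(2) 2(4)] le[OF 2(2) 1(4)] by force
          then have "z - t1 *\<^sub>R p \<in> H1 \<inter> H2" using 1 2 by simp
          then have "z \<in> span (insert p (H1 \<inter> H2))"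
            by (auto simp: span_breakdown_eq intro: span_base)
          then show False using elim(1) that ne by auto
        qed
        have ex: "?S \<noteq> {} \<longleftrightarrow> z \<in> ?K"
        proof
          assume "?S \<noteq> {}"
          then obtain t where t: "t \<ge> 0" "z - t *\<^sub>R p \<in> ?K" by auto
          have "a \<bullet> z \<le> 0" if "a \<in> A" for a
          proof -
            have "a \<bullet> (z - t *\<^sub>R p) \<le> 0" using t(2) that by (simp add: polyhedral_cone_def)
            moreover have "t * (a \<bullet> p) \<le> 0" using t(1) pA[OF that] by (rule mult_nonneg_nonpos)
            ultimately show ?thesis by (simp add: inner_diff_right)
          qed
          then show "z \<in> ?K" using elim(2) by (simp add: polyhedral_cone_def)
        next
          assume z: "z \<in> ?K"
          have "Min ((\<lambda>a. (a \<bullet> z) / (a \<bullet> p)) ` J) \<in> (\<lambda>a. (a \<bullet> z) / (a \<bullet> p)) ` J"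
            using finJ \<open>J \<noteq> {}\<close> by (intro Min_in) auto
          then obtain a where a: "a \<in> J" "Min ((\<lambda>a. (a \<bullet> z) / (a \<bullet> p)) ` J) = (a \<bullet> z) / (a \<bullet> p)" by auto
          \<comment> \<open>The exit parameter: the smallest one at which an inequality not tight at
            \<open>p\<close> becomes tight.\<close>
          define t where "t = (a \<bullet> z) / (a \<bullet> p)"
          have tmin: "t \<le> (b \<bullet> z) / (b \<bullet> p)" if "b \<in> J" for b
            unfolding t_def a(2)[symmetric] using that finJ by (intro Min_le) auto
          have t0: "t \<ge> 0"
            using z a(1) by (auto simp: t_def J_def polyhedral_cone_def intro!: divide_nonpos_nonpos)
          have "b \<bullet> (z - t *\<^sub>R p) \<le> 0" if "b \<in> A" for b
          proof (cases "b \<in> J")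
            case True
            then have "b \<bullet> p < 0" by (simp add: J_def)
            then have "b \<bullet> z \<le> t * (b \<bullet> p)" using tmin[OF True] by (simp add: neg_le_divide_eq)
            then show ?thesis by (simp add: inner_diff_right)
          next
            case False
            then have "b \<bullet> p = 0" using pA[OF that] that by (force simp: J_def)
            then show ?thesis using z that by (simp add: inner_diff_right polyhedral_cone_def)
          qed
          moreover have "z - t *\<^sub>R p \<in> flat E"
            using elim(2) pU by (intro subspace_diff subspace_scale subspace_flat)
          moreover have "a \<bullet> (z - t *\<^sub>R p) = 0" using a(1) by (simp add: inner_diff_right t_def J_def)
          ultimately have "z - t *\<^sub>R p \<in> ?K \<inter> flat (insert a E)"
            by (auto simp: polyhedral_cone_def flat_def)
          then show "?S \<noteq> {}" using a(1) t0 by (auto simp: HH_def)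
        qed
        have "(\<Sum>H\<in>HH. of_bool (\<exists>t\<ge>0. z - t *\<^sub>R p \<in> ?K \<inter> H) :: int) = int (card ?S)"
          using finHH by (simp add: of_bool_def sum.If_cases Int_def)
        also have "card ?S = of_bool (z \<in> ?K)"
        proof (cases "z \<in> ?K")
          case True
          then obtain H where "H \<in> ?S" using ex by blast
          then have "?S = {H}" using uniq by blast
          then show ?thesis using True by simp
        next
          case False
          then have "?S = {}" using ex by blast
          then show ?thesis using False by (simp del: Collect_empty_eq)
        qed
        finally show ?case by simp
      qed
    qed
    have "\<exists>c. (\<forall>ys\<in>Poly_Mapping.keys c. length ys = k \<and> set ys \<subseteq> W \<inter> H) \<and>
        (\<forall>\<^sub>F z in generic H. frag_eval (\<lambda>ys. of_bool (z \<in> convex_cone hull (set ys))) c = of_bool (z \<in> ?K \<inter> H))"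
      if "H \<in> HH" for H
    proof -
      obtain a where a: "a \<in> J" "H = flat (insert a E)" using \<open>H \<in> HH\<close> by (auto simp: HH_def)
      show ?thesis
        unfolding a(2) polyhedral_cone_insert[symmetric]
      proof (rule Suc.IH)
        show "dim (flat (insert a E)) = k" using H(3)[OF that] a by simp
      qed (use Suc.prems assms a in \<open>auto simp: J_def polyhedral_cone_insert\<close>)
    qed
    then have "\<forall>H\<in>HH. \<exists>c. (\<forall>ys\<in>Poly_Mapping.keys c. length ys = k \<and> set ys \<subseteq> W \<inter> H) \<and>
        (\<forall>\<^sub>F z in generic H. frag_eval (\<lambda>ys. of_bool (z \<in> convex_cone hull (set ys))) c = of_bool (z \<in> ?K \<inter> H))"
      by (rule ballI)
    then obtain c where c0: "\<forall>H\<in>HH. (\<forall>ys\<in>Poly_Mapping.keys (c H). length ys = k \<and> set ys \<subseteq> W \<inter> H) \<and>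
        (\<forall>\<^sub>F z in generic H. frag_eval (\<lambda>ys. of_bool (z \<in> convex_cone hull (set ys))) (c H) = of_bool (z \<in> ?K \<inter> H))"
      by (rule bchoice[THEN exE])
    have c: "length ys = k \<and> set ys \<subseteq> W \<inter> H" if "H \<in> HH" "ys \<in> Poly_Mapping.keys (c H)" for H ys
      using c0 that by blast
    have c2: "\<forall>\<^sub>F z in generic H.
        frag_eval (\<lambda>ys. of_bool (z \<in> convex_cone hull (set ys))) (c H) = of_bool (z \<in> ?K \<inter> H)"
      if "H \<in> HH" for H
      using c0 that by blast
    define c' where "c' = (\<Sum>H\<in>HH. frag_cons p (c H))"
    have "\<forall>\<^sub>F z in generic (flat E). frag_eval (\<lambda>ys. of_bool (z \<in> convex_cone hull (set ys))) (frag_cons p (c H))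
        = of_bool (\<exists>t\<ge>0. z - t *\<^sub>R p \<in> ?K \<inter> H)" if HHH: "H \<in> HH" for H
    proof -
      obtain a where a: "a \<in> J" "H = flat (insert a E)" using HHH by (auto simp: HH_def)
      have ap: "a \<bullet> p \<noteq> 0" using a by (simp add: J_def)
      \<comment> \<open>Projection onto \<open>H\<close> along \<open>p\<close>. It reduces
        membership in a join with the ray of \<open>p\<close> to a sign condition on the coordinate
        along \<open>p\<close> and membership of the projection.\<close>
      define f where "f z = z - ((a \<bullet> z) / (a \<bullet> p)) *\<^sub>R p" for z
      have "linear f"
        unfolding f_def by (rule linearI) (auto simp: algebra_simps inner_add_right add_divide_distrib)
      moreover have "f ` flat E \<subseteq> H"
      proof
        fix y assume "y \<in> f ` flat E"
        then obtain z where "z \<in> flat E" "y = f z" by auto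
        then show "y \<in> H"
          using ap pU by (auto simp: a(2) f_def flat_def inner_diff_right)
      qed
      moreover have "f h = h" if "h \<in> H" for h using that by (simp add: f_def a(2) flat_def)
      ultimately have "\<forall>\<^sub>F z in generic (flat E).
          frag_eval (\<lambda>ys. of_bool (f z \<in> convex_cone hull (set ys))) (c H) = of_bool (f z \<in> ?K \<inter> H)"
        using H[OF HHH] by (intro generic_retract[OF c2[OF HHH]]) auto
      moreover have "\<forall>\<^sub>F z in generic (flat E). z \<in> flat E" by (rule generic_all)
      ultimately show ?thesis
      proof eventually_elim
        case (elim z)
        define t where "t = (a \<bullet> z) / (a \<bullet> p)"
        have z: "z = t *\<^sub>R p + f z" by (simp add: f_def t_def)
        have fz: "f z \<in> H" using \<open>f ` flat E \<subseteq> H\<close> elim(2) by auto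
        have join: "(\<exists>s\<ge>0. z - s *\<^sub>R p \<in> Q) \<longleftrightarrow> 0 \<le> t \<and> f z \<in> Q" if "Q \<subseteq> H" for Q
          using mem_join_point[OF H(1)[OF HHH] H(4)[OF HHH] fz that, of t] z by simp
        have "frag_eval (\<lambda>ys. of_bool (z \<in> convex_cone hull (set ys))) (frag_cons p (c H))
            = frag_eval (\<lambda>ys. of_bool (0 \<le> t) * of_bool (f z \<in> convex_cone hull (set ys))) (c H)"
          unfolding frag_cons_def frag_eval_extend
        proof (rule frag_eval_cong)
          fix ys assume "ys \<in> Poly_Mapping.keys (c H)"
          then have "convex_cone hull (set ys) \<subseteq> H"
            using c[OF HHH] H(1)[OF HHH] by (intro hull_minimal subspace_imp_convex_cone) auto
          then show "frag_eval (\<lambda>ys. of_bool (z \<in> convex_cone hull (set ys))) (frag_of (p # ys))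
              = (of_bool (0 \<le> t) * of_bool (f z \<in> convex_cone hull (set ys)) :: int)"
            by (simp add: mem_convex_cone_hull_insert join of_bool_conj)
        qed
        also have "\<dots> = of_bool (0 \<le> t) * frag_eval (\<lambda>ys. of_bool (f z \<in> convex_cone hull (set ys))) (c H)"
          by (simp add: frag_eval_def sum_distrib_left mult_ac)
        also have "\<dots> = of_bool (0 \<le> t \<and> f z \<in> ?K \<inter> H)" by (simp only: elim(1) of_bool_conj)
        also have "\<dots> = of_bool (\<exists>t\<ge>0. z - t *\<^sub>R p \<in> ?K \<inter> H)" by (subst join) auto
        finally show ?case .
      qed
    qed
    then have "\<forall>\<^sub>F z in generic (flat E). \<forall>H\<in>HH.
        frag_eval (\<lambda>ys. of_bool (z \<in> convex_cone hull (set ys))) (frag_cons p (c H))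
        = (of_bool (\<exists>t\<ge>0. z - t *\<^sub>R p \<in> ?K \<inter> H) :: int)"
      using finHH by (intro eventually_ball_finite) auto
    with K_decomp have "\<forall>\<^sub>F z in generic (flat E).
        frag_eval (\<lambda>ys. of_bool (z \<in> convex_cone hull (set ys))) c' = (of_bool (z \<in> ?K) :: int)"
    proof eventually_elim
      case (elim z)
      then show ?case by (simp add: c'_def frag_eval_sum)
    qed
    moreover have "length ys = Suc k \<and> set ys \<subseteq> W \<inter> flat E" if ys: "ys \<in> Poly_Mapping.keys c'" for ys
    proof -
      have "ys \<in> (\<Union>H\<in>HH. Poly_Mapping.keys (frag_cons p (c H)))"
        using ys unfolding c'_def by (intro subsetD[OF keys_sum])
      then obtain H where HHH: "H \<in> HH" and "ys \<in> Poly_Mapping.keys (frag_cons p (c H))" by auto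
      then have "ys \<in> (\<Union>zs\<in>Poly_Mapping.keys (c H). Poly_Mapping.keys (frag_of (p # zs)))"
        unfolding frag_cons_def by (intro subsetD[OF keys_frag_extend])
      then obtain zs where zs: "zs \<in> Poly_Mapping.keys (c H)" "ys = p # zs" by auto
      show ?thesis using c[OF HHH zs(1)] zs(2) p(1) pU H(2)[OF HHH] by auto
    qed
    ultimately show ?thesis by blast
  qed
qed

end

section \<open>The three geometries\<close>

text \<open>
  \<open>radial g x\<close> is the factor \<open>t > 0\<close> with \<open>x = t y\<close> for a point \<open>y\<close> of the model space, if there is one.
  The real square root is an odd function, so \<open>radial Hyperbolic\<close> is positive only on time-like vectors.
\<close>

fun radial :: "geometry \<Rightarrow> real ^ 'n::finite option \<Rightarrow> real" where
  "radial Euclidean x = x $ None"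
| "radial Hyperbolic x = sqrt ((x $ None)\<^sup>2 - (\<Sum>i\<in>UNIV. (x $ Some i)\<^sup>2))"
| "radial Spherical x = norm x"

text \<open>The open cone over the model space: an open half-space, the open future light cone, or
  all nonzero vectors. Being open and invariant under scaling, it allows points to be perturbed
  linearly and then normalized back.\<close>

definition model_cone :: "geometry \<Rightarrow> (real ^ 'n::finite option) set" where
  "model_cone g = {x. radial g x > 0 \<and> (g = Spherical \<or> x $ None > 0)}"

lemma model_space_eq: "model_space g = {x \<in> model_cone g. radial g x = 1}"
  by (cases g) (auto simp: model_cone_def algebra_simps)

lemma model_space_subset_cone: "model_space g \<subseteq> model_cone g"
  by (auto simp: model_space_eq)

lemma radial_scale: "t \<ge> 0 \<Longrightarrow> radial g (t *\<^sub>R x) = t * radial g x"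
  by (cases g) (auto simp: power_mult_distrib real_sqrt_mult simp flip: sum_distrib_left right_diff_distrib)

lemma model_cone_scale: "t > 0 \<Longrightarrow> x \<in> model_cone g \<Longrightarrow> t *\<^sub>R x \<in> model_cone g"
  by (auto simp: model_cone_def radial_scale)

lemma normalize_in_model_space: "x \<in> model_cone g \<Longrightarrow> (1 / radial g x) *\<^sub>R x \<in> model_space g"
  unfolding model_space_eq
  using model_cone_scale[of "1 / radial g x" x g] by (simp add: radial_scale model_cone_def)

lemma radial_pos: "x \<in> model_cone g \<Longrightarrow> radial g x > 0"
  by (simp add: model_cone_def)

lemma zero_notin_model_cone: "0 \<notin> model_cone g"
  using radial_scale[of 0 g 0] by (auto simp: model_cone_def)

lemma model_cone_Spherical: "model_cone Spherical = - {0}"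
  by (auto simp: model_cone_def)

lemma continuous_radial: "continuous_on UNIV (radial g :: real ^ 'n::finite option \<Rightarrow> real)"
proof (cases g)
  case Hyperbolic
  have "radial Hyperbolic = (\<lambda>x::real ^ 'n option. sqrt ((x $ None)\<^sup>2 - (\<Sum>i\<in>UNIV. (x $ Some i)\<^sup>2)))"
    by (rule ext) simp
  then show ?thesis unfolding Hyperbolic by (auto intro!: continuous_intros)
next
  case Euclidean
  have "radial Euclidean = (\<lambda>x::real ^ 'n option. x $ None)" by (rule ext) simp
  then show ?thesis unfolding Euclidean by (auto intro!: continuous_intros)
next
  case Spherical
  have "radial Spherical = (norm :: real ^ 'n option \<Rightarrow> real)" by (rule ext) simp
  then show ?thesis unfolding Spherical by (auto intro!: continuous_intros)
qed

lemma open_model_cone: "open (model_cone g :: (real ^ 'n::finite option) set)"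
proof -
  have 1: "open {x :: real ^ 'n option. radial g x > 0}"
    using continuous_radial by (intro open_Collect_less continuous_intros) auto
  have 2: "open {x :: real ^ 'n option. x $ None > 0}"
    by (intro open_Collect_less continuous_intros)
  have "model_cone g = {x :: real ^ 'n option. radial g x > 0} \<inter> (if g = Spherical then UNIV else {x. x $ None > 0})"
    by (auto simp: model_cone_def)
  then show ?thesis using 1 2 by auto
qed

text \<open>In this form, closure of the light cone under sums is the triangle inequality for
  \<open>L2_set\<close>.\<close>

lemma model_cone_Hyperbolic_iff:
  "x \<in> model_cone Hyperbolic \<longleftrightarrow> L2_set (\<lambda>i. x $ Some i) UNIV < x $ None"
proof -
  have "L2_set (\<lambda>i. x $ Some i) UNIV < x $ None \<longleftrightarrow>
      x $ None > 0 \<and> (L2_set (\<lambda>i. x $ Some i) UNIV)\<^sup>2 < (x $ None)\<^sup>2"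
    using L2_set_nonneg[of "\<lambda>i. x $ Some i" UNIV]
    by (auto intro: power_strict_mono power2_less_imp_less intro!: le_less_trans[of 0 "L2_set _ _"])
  also have "(L2_set (\<lambda>i. x $ Some i) UNIV)\<^sup>2 = (\<Sum>i\<in>UNIV. (x $ Some i)\<^sup>2)"
    by (simp add: L2_set_def sum_nonneg)
  finally show ?thesis by (auto simp: model_cone_def)
qed

lemma model_cone_add:
  assumes "x \<in> model_cone g" "y \<in> model_cone g" "x + y \<noteq> 0"
  shows "x + y \<in> model_cone g"
proof (cases g)
  case Hyperbolic
  then show ?thesis
    using assms L2_set_triangle_ineq[of "\<lambda>i. x $ Some i" "\<lambda>i. y $ Some i" UNIV]
    by (simp add: model_cone_Hyperbolic_iff)
qed (use assms in \<open>auto simp: model_cone_def\<close>)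

lemma model_cone_convex_cone_hull:
  assumes "S \<subseteq> model_cone g" "z \<in> convex_cone hull S" "z \<noteq> 0"
  shows "z \<in> model_cone g"
proof (cases "g = Spherical")
  case True
  then show ?thesis using assms by (simp add: model_cone_Spherical)
next
  case False
  have None: "x $ None > 0" if "x \<in> model_cone g" for x :: "real ^ 'a option"
    using that False by (simp add: model_cone_def)
  have "convex_cone (insert 0 (model_cone g :: (real ^ 'a option) set))"
    unfolding convex_cone_iff
  proof (intro conjI ballI allI impI)
    fix x y :: "real ^ 'a option"
    assume xy: "x \<in> insert 0 (model_cone g)" "y \<in> insert 0 (model_cone g)"
    show "x + y \<in> insert 0 (model_cone g)"
    proof (cases "x = 0 \<or> y = 0")
      case True
      then show ?thesis using xy by auto
    next
      case False
      then have "x \<in> model_cone g" "y \<in> model_cone g" using xy by auto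
      then show ?thesis using model_cone_add[of x g y] by blast
    qed
  next
    fix x :: "real ^ 'a option" and c :: real
    assume "x \<in> insert 0 (model_cone g)" "0 \<le> c"
    then show "c *\<^sub>R x \<in> insert 0 (model_cone g)"
      by (cases "c = 0") (auto simp: model_cone_scale)
  qed simp
  then have "convex_cone hull S \<subseteq> insert 0 (model_cone g)"
    using assms(1) by (intro hull_minimal) auto
  then show ?thesis using assms by auto
qed

lemma scale_mem_subspace_iff:
  assumes "t \<noteq> 0" "subspace B"
  shows "t *\<^sub>R x \<in> B \<longleftrightarrow> x \<in> B"
  using subspace_scale[OF assms(2), of x t] subspace_scale[OF assms(2), of "t *\<^sub>R x" "1 / t"] assms(1) by auto

text \<open>A point of the open set is moved slightly in a direction outside all exceptional
  subspaces and then scaled back to the model space. Scaling neither enters nor leaves a linear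
  subspace, and by continuity of \<open>radial\<close> the result stays in the open set.\<close>

lemma open_in_model_space_generic:
  fixes O' :: "(real ^ 'n::finite option) set"
  assumes O': "openin (top_of_set (model_space g)) O'" "O' \<noteq> {}"
    and P: "\<forall>\<^sub>F z in generic UNIV. P z"
  shows "\<exists>z\<in>O'. P z"
proof -
  obtain T where T: "open T" "O' = model_space g \<inter> T" using O'(1) by (auto simp: openin_open)
  obtain x where x: "x \<in> model_space g" "x \<in> T" using O'(2) T by auto
  obtain \<B> where \<B>: "finite \<B>" "\<forall>B\<in>\<B>. subspace B \<and> \<not> UNIV \<subseteq> B" "\<forall>z\<in>UNIV. z \<notin> \<Union>\<B> \<longrightarrow> P z"
    using P unfolding eventually_generic by blast
  obtain v where v: "v \<notin> \<Union>\<B>" using subspace_not_covered[OF subspace_UNIV \<B>(1,2)] by auto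
  have "\<forall>\<^sub>F t in at_right 0. t \<notin> {t. x + t *\<^sub>R v \<in> B}" if "B \<in> \<B>" for B
    using \<B>(2) v that by (intro eventually_at_right_notin_finite finite_line_inter_subspace) auto
  then have 1: "\<forall>\<^sub>F t in at_right 0. \<forall>B\<in>\<B>. t \<notin> {t. x + t *\<^sub>R v \<in> B}"
    using \<B>(1) by (intro eventually_ball_finite) auto
  have lim: "((\<lambda>t. x + t *\<^sub>R v) \<longlongrightarrow> x) (at_right 0)"
    by (auto intro!: tendsto_eq_intros)
  have xC: "x \<in> model_cone g" "radial g x = 1" using x(1) by (auto simp: model_space_eq)
  have 2: "\<forall>\<^sub>F t in at_right 0. x + t *\<^sub>R v \<in> model_cone g"
    using topological_tendstoD[OF lim open_model_cone xC(1)] .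
  have "((\<lambda>t. radial g (x + t *\<^sub>R v)) \<longlongrightarrow> radial g x) (at_right 0)"
    using lim continuous_radial[of g] by (intro isCont_tendsto_compose[OF _ lim]) (auto simp: continuous_on_eq_continuous_at)
  then have "((\<lambda>t. (1 / radial g (x + t *\<^sub>R v)) *\<^sub>R (x + t *\<^sub>R v)) \<longlongrightarrow> (1 / radial g x) *\<^sub>R x) (at_right 0)"
    using lim xC(2) by (intro tendsto_intros) auto
  then have lim2: "((\<lambda>t. (1 / radial g (x + t *\<^sub>R v)) *\<^sub>R (x + t *\<^sub>R v)) \<longlongrightarrow> x) (at_right 0)"
    using xC(2) by simp
  have 3: "\<forall>\<^sub>F t in at_right 0. (1 / radial g (x + t *\<^sub>R v)) *\<^sub>R (x + t *\<^sub>R v) \<in> T"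
    using topological_tendstoD[OF lim2 T(1) x(2)] .
  have "\<forall>\<^sub>F t in at_right (0::real). \<exists>z\<in>O'. P z"
    using 1 2 3
  proof eventually_elim
    case (elim t)
    let ?z = "(1 / radial g (x + t *\<^sub>R v)) *\<^sub>R (x + t *\<^sub>R v)"
    have "?z \<in> O'" using normalize_in_model_space[OF elim(2)] elim(3) T(2) by simp
    moreover have "?z \<notin> \<Union>\<B>"
      using elim(1) radial_pos[OF elim(2)] \<B>(2) by (auto simp: scale_mem_subspace_iff)
    ultimately show ?case using \<B>(3) by blast
  qed
  then show ?thesis by simp
qed

lemma model_space_nonempty: "model_space g \<noteq> ({} :: (real ^ 'n::finite option) set)"
proof -
  have "(\<Sum>i\<in>UNIV. (axis None 1 $ Some i)\<^sup>2) = (0 :: real)"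
    by (auto simp: axis_def)
  then have "axis None 1 \<in> (model_space g :: (real ^ 'n option) set)"
    by (cases g) auto
  then show ?thesis by auto
qed

lemma span_model_space: "span (model_space g) = (UNIV :: (real ^ 'n::finite option) set)"
proof (rule ccontr)
  assume "span (model_space g) \<noteq> (UNIV :: (real ^ 'n option) set)"
  then have "\<forall>\<^sub>F z in generic (UNIV :: (real ^ 'n option) set). z \<in> UNIV \<and> z \<notin> span (model_space g)"
    by (intro generic_subspace) (auto simp: subspace_span)
  then have "\<exists>z\<in>model_space g. z \<in> UNIV \<and> (z :: real ^ 'n option) \<notin> span (model_space g)"
    by (intro open_in_model_space_generic[where g = g]) (auto simp: model_space_nonempty)
  then show False using span_base by auto
qed

text \<open>
  The bound makes the part of the segment inside the open model cone relatively closed as well.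
\<close>

lemma segment_in_model_cone:
  fixes p y :: "real ^ 'n::finite option"
  assumes g: "g \<noteq> Spherical"
    and bd: "\<And>x. x \<in> closed_segment p y \<Longrightarrow> x \<in> model_cone g \<Longrightarrow> norm x \<le> M * radial g x"
    and p: "p \<in> model_cone g" and 0: "0 \<notin> closed_segment p y"
  shows "y \<in> model_cone g"
proof -
  let ?S = "closed_segment p y"
  let ?Z = "{x. norm x \<le> M * radial g x} \<inter> {x. 0 \<le> radial g x} \<inter> {x. 0 \<le> x $ None}"
  have "closed ?Z"
    using continuous_radial[of g] by (intro closed_Int closed_Collect_le continuous_intros) auto
  moreover have "?S \<inter> model_cone g = ?S \<inter> ?Z"
  proof (intro equalityI subsetI)
    fix x assume "x \<in> ?S \<inter> model_cone g"
    then show "x \<in> ?S \<inter> ?Z" using bd g by (auto simp: model_cone_def)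
  next
    fix x assume x: "x \<in> ?S \<inter> ?Z"
    then have "x \<noteq> 0" using 0 by auto
    \<comment> \<open>With \<open>radial g x = 0\<close> the bound
      \<open>norm x \<le> M * radial g x\<close> would force \<open>x = 0\<close>; this excludes
      boundary points of the model cone.\<close>
    then have "radial g x \<noteq> 0" using x by auto
    then have gp: "radial g x > 0" using x by auto
    have "x $ None > 0"
    proof (cases g)
      case Hyperbolic
      then have "(x $ None)\<^sup>2 > 0" using gp sum_nonneg[of UNIV "\<lambda>i. (x $ Some i)\<^sup>2"] by auto
      then show ?thesis using x by (auto simp: less_le)
    qed (use gp g in auto)
    then show "x \<in> ?S \<inter> model_cone g" using gp x by (auto simp: model_cone_def)
  qed
  ultimately have "closedin (top_of_set ?S) (?S \<inter> model_cone g)"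
    by (auto simp: closedin_closed)
  moreover have "openin (top_of_set ?S) (?S \<inter> model_cone g)"
    using open_model_cone by (auto simp: openin_open)
  moreover have "connected ?S" by simp
  moreover have "?S \<inter> model_cone g \<noteq> {}" using p by auto
  ultimately have "?S \<inter> model_cone g = ?S" unfolding connected_clopen by blast
  then show ?thesis by auto
qed

lemma positive_functional: "g \<noteq> Spherical \<Longrightarrow> x \<in> model_cone g \<Longrightarrow> axis None 1 \<bullet> x > 0"
  by (simp add: model_cone_def inner_axis')

lemma point_of_subset_span: "point_of g v \<subseteq> span {v}"
  by (cases g) (auto simp: span_base span_neg)

lemma mem_point_of: "v \<in> point_of g v"
  by (cases g) auto

lemma point_of_minus: "point_of Spherical (- v) = point_of Spherical v"
  by auto

lemma point_of_eq:
  fixes v :: "real ^ 'n::finite option"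
  assumes "v \<in> model_space g"
  shows "point_of g v = model_space g \<inter> span {v}"
proof (intro equalityI subsetI)
  fix x assume "x \<in> point_of g v"
  then show "x \<in> model_space g \<inter> span {v}"
    using assms point_of_subset_span[of g v] by (cases g) auto
next
  fix x assume x: "x \<in> model_space g \<inter> span {v}"
  then obtain t where t: "x = t *\<^sub>R v" by (auto simp: span_singleton)
  show "x \<in> point_of g v"
  proof (cases "t \<ge> 0")
    case True
    then have "t = 1" using x t assms radial_scale[of t g v] by (auto simp: model_space_eq)
    then show ?thesis using t by (simp add: mem_point_of)
  next
    case False
    show ?thesis
    proof (cases "g = Spherical")
      case True
      then have "\<bar>t\<bar> = 1" using x t assms by simp
      then have "t = - 1" using False by simp
      then show ?thesis using t True by simp
    next
      case g: False
      then have "x $ None > 0" "v $ None > 0" using x assms by (auto simp: model_space_eq model_cone_def)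
      then show ?thesis using t False by (simp add: zero_less_mult_iff)
    qed
  qed
qed

lemma point_of_eq_iff:
  assumes "v \<in> model_space g" "w \<in> model_space g" "point_of g v = point_of g w"
  shows "w = v \<or> g = Spherical \<and> w = - v"
  using assms by (cases g) (auto simp: doubleton_eq_iff)

section \<open>Collections generated by points and by hyperplanes\<close>

lemma DIM_eq: "DIM(real ^ 'n::finite option) = Suc CARD('n)"
  by (simp add: card_option)

locale generated_collection =
  fixes g :: geometry and L :: "(real ^ 'n::finite option) set set"
  assumes geometric: "\<forall>A\<in>L. geometric_subspace g A \<and> A \<noteq> {}"
    and whole: "model_space g \<in> L"
    and by_points: "generated_by_points g L"
    and by_hyperplanes: "generated_by_hyperplanes g L"
begin

definition normals :: "(real ^ 'n option) set" where
  "normals = {a. a \<noteq> 0 \<and> model_space g \<inter> {x. a \<bullet> x = 0} \<in> hyperplanes L}"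

text \<open>On the sphere both unit vectors of an antipodal pair in \<open>L\<close> are vertices,
  and \<open>point_of g\<close> identifies them.\<close>

definition vertices :: "(real ^ 'n option) set" where
  "vertices = {v \<in> model_space g. point_of g v \<in> points L}"

lemma normals_nonzero: "a \<in> normals \<Longrightarrow> a \<noteq> 0"
  by (simp add: normals_def)

lemma normals_minus: "a \<in> normals \<Longrightarrow> - a \<in> normals"
  by (simp add: normals_def)

lemma vertices_model_cone: "vertices \<subseteq> model_cone g"
  by (auto simp: vertices_def model_space_eq)

lemma vertices_nonzero: "v \<in> vertices \<Longrightarrow> v \<noteq> 0"
  using vertices_model_cone zero_notin_model_cone by auto

lemma halfspaces_eq: "halfspaces g L = (\<lambda>a. {x. a \<bullet> x \<le> 0}) ` normals"
  by (auto simp: halfspaces_def normals_def)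

lemma point_eq:
  assumes "A \<in> points L" "v \<in> A"
  shows "A = point_of g v"
proof -
  have A: "A \<in> L" "dim A = 1" using assms(1) by (auto simp: level_def gdim_def)
  then obtain V where V: "subspace V" "A = model_space g \<inter> V"
    using geometric by (auto simp: geometric_subspace_def)
  have v: "v \<in> model_space g" "v \<in> V" using assms(2) V by auto
  have vn: "v \<noteq> 0" using v(1) model_space_subset_cone zero_notin_model_cone by auto
  have "span {v} \<subseteq> span A" using assms(2) by (intro span_mono) auto
  moreover have "dim (span A) \<le> dim (span {v})" using A(2) vn by simp
  ultimately have "span A = span {v}"
    using subspace_dim_equal[of "span {v}" "span A"] by (auto simp: subspace_span)
  then have "A \<subseteq> span {v}" using span_superset by blast
  moreover have "span {v} \<subseteq> V" using v(2) V(1) by (intro span_minimal) auto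
  ultimately show ?thesis unfolding point_of_eq[OF v(1)] V(2) by blast
qed

lemma point_lift:
  assumes "A \<in> points L"
  shows "\<exists>v\<in>vertices. point_of g v = A"
proof -
  have "A \<in> L" using assms by (simp add: level_def)
  then obtain v where v: "v \<in> A" "A \<subseteq> model_space g"
    using geometric by (force simp: geometric_subspace_def)
  then show ?thesis using point_eq[OF assms v(1)] assms by (intro bexI[of _ v]) (auto simp: vertices_def)
qed

lemma hyperplane_normal:
  assumes "A \<in> hyperplanes L"
  shows "\<exists>a\<in>normals. A = model_space g \<inter> {x. a \<bullet> x = 0}"
proof -
  have A: "A \<in> L" "dim A = CARD('n)" using assms by (auto simp: level_def gdim_def)
  then obtain V where V: "subspace V" "A = model_space g \<inter> V"
    using geometric by (auto simp: geometric_subspace_def)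
  obtain a where a: "a \<noteq> 0" "span A \<subseteq> {x. a \<bullet> x = 0}"
    using lowdim_subset_hyperplane[of A] A(2) DIM_eq[where 'n='n] by auto
  have "span A = {x. a \<bullet> x = 0}"
    by (rule subspace_dim_equal)
       (use a A(2) DIM_eq[where 'n='n] in \<open>auto simp: subspace_span subspace_hyperplane dim_hyperplane\<close>)
  moreover have "span A \<subseteq> V" using V by (intro span_minimal) auto
  ultimately have "A = model_space g \<inter> {x. a \<bullet> x = 0}"
    using V(2) span_superset[of A] by blast
  then show ?thesis using a(1) assms by (intro bexI[of _ a]) (auto simp: normals_def)
qed

lemma model_space_flat:
  assumes "finite E" "E \<subseteq> normals" "model_space g \<inter> flat E \<noteq> {}"
  shows "model_space g \<inter> flat E \<in> L"
proof -
  let ?F = "(\<lambda>a. model_space g \<inter> {x. a \<bullet> x = 0}) ` E"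
  have "finite ?F" "?F \<subseteq> hyperplanes L" using assms by (auto simp: normals_def)
  moreover have "model_space g \<inter> flat E = model_space g \<inter> \<Inter>?F" by (auto simp: flat_def)
  ultimately have "model_space g \<inter> flat E \<in> {model_space g \<inter> \<Inter>F | F. finite F \<and> F \<subseteq> hyperplanes L} - {{}}"
    using assms(3) by blast
  also have "\<dots> = L" using by_hyperplanes by (simp add: generated_by_hyperplanes_def)
  finally show ?thesis .
qed

text \<open>Generation by hyperplanes is used here: a line cut out by normals that meets the model
  cone cuts out an element of \<open>L\<close> of dimension 0. This provides the vertices of
  polyhedral cones.\<close>

lemma vertex_of_flat:
  assumes "finite E" "E \<subseteq> normals" "dim (flat E) = 1" "x \<in> flat E" "x \<in> model_cone g"
  shows "\<exists>t>0. t *\<^sub>R x \<in> vertices"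
proof -
  let ?t = "1 / radial g x" and ?A = "model_space g \<inter> flat E"
  have t: "?t > 0" using radial_pos[OF assms(5)] by simp
  have v: "?t *\<^sub>R x \<in> ?A"
    using normalize_in_model_space[OF assms(5)] subspace_scale[OF subspace_flat assms(4)] by auto
  then have L: "?A \<in> L" using model_space_flat assms by blast
  have "dim ?A \<le> dim (flat E)" by (intro dim_subset) auto
  moreover have "?t *\<^sub>R x \<noteq> 0"
    using v model_space_subset_cone[of g] zero_notin_model_cone[of g] by (metis IntD1 subsetD)
  then have "dim ?A \<noteq> 0" using v by (auto simp: dim_eq_0)
  ultimately have "dim ?A = 1" using assms(3) by linarith
  then have "?A \<in> points L" using L by (simp add: level_def gdim_def)
  then show ?thesis using point_eq[OF _ v] v t by (intro exI[of _ ?t]) (auto simp: vertices_def)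
qed

lemma gspan_points:
  assumes "S \<subseteq> model_space g"
  shows "gspan g (\<Union>(point_of g ` S)) = model_space g \<inter> span S"
proof
  have "point_of g v \<subseteq> model_space g \<inter> span S" if "v \<in> S" for v
    using that assms span_mono[of "{v}" S] by (subst point_of_eq) auto
  then have "\<Union>(point_of g ` S) \<subseteq> model_space g \<inter> span S" by auto
  moreover have "geometric_subspace g (model_space g \<inter> span S)"
    by (auto simp: geometric_subspace_def intro: subspace_span)
  ultimately show "gspan g (\<Union>(point_of g ` S)) \<subseteq> model_space g \<inter> span S"
    unfolding gspan_def by (intro Inter_lower) simp
  show "model_space g \<inter> span S \<subseteq> gspan g (\<Union>(point_of g ` S))"
    unfolding gspan_def
  proof (intro Inter_greatest, elim CollectE conjE)
    fix A assume A: "geometric_subspace g A" "\<Union>(point_of g ` S) \<subseteq> A"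
    then obtain V where V: "subspace V" "A = model_space g \<inter> V" by (auto simp: geometric_subspace_def)
    have "S \<subseteq> V" using A(2) V(2) mem_point_of by fastforce
    then show "model_space g \<inter> span S \<subseteq> A" using V by (auto dest: span_minimal)
  qed
qed

text \<open>Generation by points is used here: the geometric span of \<open>n\<close> independent
  vertices is an element of \<open>L\<close>, and its dimension makes it a hyperplane. This provides
  the facets of simplices.\<close>

lemma normal_of_vertices:
  assumes "S \<subseteq> vertices" "independent S" "card S = CARD('n)"
  shows "\<exists>a\<in>normals. span S = {x. a \<bullet> x = 0}"
proof -
  have fin: "finite S" using assms(3) by (intro card_ge_0_finite) simp
  have SX: "S \<subseteq> model_space g" using assms(1) by (auto simp: vertices_def)
  have sp: "span (model_space g \<inter> span S) = span S"
  proof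
    show "span (model_space g \<inter> span S) \<subseteq> span S" by (intro span_minimal) (auto simp: subspace_span)
    show "span S \<subseteq> span (model_space g \<inter> span S)" using SX by (intro span_mono) (auto intro: span_base)
  qed
  have "S \<noteq> {}" using assms(3) by auto
  then have "model_space g \<inter> span S \<noteq> {}" using SX span_superset by blast
  moreover have "finite (point_of g ` S)" "point_of g ` S \<subseteq> points L"
    using fin assms(1) by (auto simp: vertices_def)
  ultimately have "model_space g \<inter> span S \<in> {gspan g (\<Union>F) | F. finite F \<and> F \<subseteq> points L} - {{}}"
    using gspan_points[OF SX] by blast
  also have "\<dots> = L" using by_points by (simp add: generated_by_points_def)
  finally have "model_space g \<inter> span S \<in> L" .
  moreover have "dim (model_space g \<inter> span S) = CARD('n)"
    using sp dim_span assms(2,3) dim_eq_card_independent by metis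
  ultimately have "model_space g \<inter> span S \<in> hyperplanes L" by (simp add: level_def gdim_def)
  then obtain a where a: "a \<in> normals" "model_space g \<inter> span S = model_space g \<inter> {x. a \<bullet> x = 0}"
    using hyperplane_normal by blast
  have "span S = {x. a \<bullet> x = 0}"
  proof (rule subspace_dim_equal)
    have "S \<subseteq> {x. a \<bullet> x = 0}" using a(2) SX span_superset[of S] by blast
    then show "span S \<subseteq> {x. a \<bullet> x = 0}" by (intro span_minimal subspace_hyperplane)
    show "dim {x. a \<bullet> x = 0} \<le> dim (span S)"
      using assms(2,3) normals_nonzero[OF a(1)] DIM_eq[where 'n='n]
      by (simp add: dim_hyperplane dim_eq_card_independent)
  qed (auto simp: subspace_span subspace_hyperplane)
  then show ?thesis using a(1) by blast
qed

lemma span_vertices: "span vertices = UNIV"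
proof -
  obtain F where F: "finite F" "F \<subseteq> points L" "model_space g = gspan g (\<Union>F)"
    using whole by_points unfolding generated_by_points_def by blast
  have "\<Union>F \<subseteq> vertices"
  proof
    fix v assume "v \<in> \<Union>F"
    then obtain A where A: "A \<in> F" "v \<in> A" by auto
    then have "A \<in> L" "A \<in> points L" using F(2) by (auto simp: level_def)
    then have "v \<in> model_space g" using A(2) geometric by (auto simp: geometric_subspace_def)
    then show "v \<in> vertices" using point_eq[of A v] A F(2) by (auto simp: vertices_def)
  qed
  moreover have "vertices \<subseteq> model_space g \<inter> span vertices"
    using span_superset[of vertices] unfolding vertices_def by blast
  ultimately have "\<Union>F \<subseteq> model_space g \<inter> span vertices" by blast
  moreover have "geometric_subspace g (model_space g \<inter> span vertices)"
    by (auto simp: geometric_subspace_def intro: subspace_span)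
  ultimately have "gspan g (\<Union>F) \<subseteq> model_space g \<inter> span vertices"
    unfolding gspan_def by (intro Inter_lower) simp
  then have "span (model_space g) \<subseteq> span vertices"
    using F(3) by (intro span_minimal) (auto simp: subspace_span)
  then show ?thesis using span_model_space by auto
qed

lemma point_flat:
  assumes "v \<in> vertices"
  shows "\<exists>E. finite E \<and> E \<subseteq> normals \<and> model_space g \<inter> flat E \<subseteq> span {v}"
proof -
  have "point_of g v \<in> L" using assms by (simp add: vertices_def level_def)
  moreover have "L = {model_space g \<inter> \<Inter>F | F. finite F \<and> F \<subseteq> hyperplanes L} - {{}}"
    using by_hyperplanes by (simp only: generated_by_hyperplanes_def)
  then have "L \<subseteq> {model_space g \<inter> \<Inter>F | F. finite F \<and> F \<subseteq> hyperplanes L}"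
    by (rule subset_trans[OF equalityD1 Diff_subset])
  ultimately have "point_of g v \<in> {model_space g \<inter> \<Inter>F | F. finite F \<and> F \<subseteq> hyperplanes L}"
    by (rule subsetD[rotated])
  then obtain F where F: "finite F" "F \<subseteq> hyperplanes L" "point_of g v = model_space g \<inter> \<Inter>F"
    by blast
  have "\<forall>A\<in>F. \<exists>a. a \<in> normals \<and> A = model_space g \<inter> {x. a \<bullet> x = 0}"
    using F(2) hyperplane_normal by blast
  then obtain f where f: "\<forall>A\<in>F. f A \<in> normals \<and> A = model_space g \<inter> {x. f A \<bullet> x = 0}"
    by (rule bchoice[THEN exE])
  have "model_space g \<inter> flat (f ` F) \<subseteq> point_of g v"
    unfolding F(3) using f by (auto simp: flat_def)
  then show ?thesis
    using F(1) f point_of_subset_span[of g v] by (intro exI[of _ "f ` F"]) auto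
qed

text \<open>The hyperplanes that cut out two different points of \<open>L\<close> have only the
  origin in common. On the sphere boundedness says nothing about the cone over a cell, so its
  pointedness comes from adding these normals to the arrangement.\<close>

lemma spherical_normals:
  assumes "g = Spherical"
  shows "\<exists>E. finite E \<and> E \<subseteq> normals \<and> flat E = {0}"
proof -
  have "vertices \<noteq> {}" using span_vertices by (auto simp: span_empty)
  then obtain v where v: "v \<in> vertices" by auto
  have "\<not> vertices \<subseteq> span {v}"
  proof
    assume "vertices \<subseteq> span {v}"
    then have "span vertices \<subseteq> span {v}" by (intro span_minimal subspace_span)
    then have "dim (UNIV :: (real ^ 'n option) set) \<le> dim {v}"
      using span_vertices dim_subset[of UNIV "span {v}"] by simp
    also have "\<dots> \<le> 1" using dim_le_card'[of "{v}"] by simp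
    finally show False using DIM_eq[where 'n='n] by simp
  qed
  then obtain w where w: "w \<in> vertices" "w \<notin> span {v}" by auto
  obtain E where E: "finite E" "E \<subseteq> normals" "model_space g \<inter> flat E \<subseteq> span {v}"
    using point_flat[OF v] by blast
  obtain E' where E': "finite E'" "E' \<subseteq> normals" "model_space g \<inter> flat E' \<subseteq> span {w}"
    using point_flat[OF w(1)] by blast
  have "flat (E \<union> E') \<subseteq> {0}"
  proof
    fix y assume y: "y \<in> flat (E \<union> E')"
    show "y \<in> {0}"
    proof (rule ccontr)
      assume "y \<notin> {0}"
      let ?y = "(1 / norm y) *\<^sub>R y"
      have "?y \<in> model_space g" using \<open>y \<notin> {0}\<close> assms by simp
      moreover have "?y \<in> flat E" "?y \<in> flat E'" using y by (auto simp: flat_def)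
      ultimately have "?y \<in> span {v}" "?y \<in> span {w}" using E E' by auto
      then have "norm y *\<^sub>R ?y \<in> span {v}" "norm y *\<^sub>R ?y \<in> span {w}" by (auto intro!: span_scale simp del: scaleR_scaleR)
      then have "y \<in> span {v}" "y \<in> span {w}" using \<open>y \<notin> {0}\<close> by auto
      then obtain t where t: "y = t *\<^sub>R w" by (auto simp: span_singleton)
      have "(1 / t) *\<^sub>R y \<in> span {v}" by (rule span_scale) fact
      then have "w \<in> span {v}" using t \<open>y \<notin> {0}\<close> by auto
      then show False using w(2) by simp
    qed
  qed
  moreover have "0 \<in> flat (E \<union> E')" by (simp add: flat_def)
  ultimately show ?thesis using E E' by (intro exI[of _ "E \<union> E'"]) auto
qed

section \<open>Representatives in an open half-space\<close>

lemma vertices_minus: "g = Spherical \<Longrightarrow> v \<in> vertices \<Longrightarrow> - v \<in> vertices"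
  unfolding vertices_def using point_of_minus[of v] by simp

text \<open>Off the sphere the functional \<open>axis None 1\<close> is positive on all vertices. On
  the sphere a functional positive on \<open>S\<close> is perturbed until it does not vanish at
  \<open>p\<close>, and then \<open>p\<close> or \<open>- p\<close> is taken.\<close>

lemma positive_lift:
  assumes "finite S" "S \<subseteq> vertices" "\<exists>l. \<forall>y\<in>S. l \<bullet> y > 0" "p \<in> vertices"
  shows "\<exists>p'\<in>vertices. point_of g p' = point_of g p \<and> (p' = p \<or> p' = - p) \<and> (\<exists>l. \<forall>y\<in>insert p' S. l \<bullet> y > 0)"
proof (cases "g = Spherical")
  case False
  then show ?thesis
    using assms positive_functional[OF False] vertices_model_cone
    by (intro bexI[of _ p]) (auto intro!: exI[of _ "axis None 1"])
next
  case True
  obtain l where l: "\<forall>y\<in>S. l \<bullet> y > 0" using assms(3) by blast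
  obtain l' where l': "\<forall>y\<in>S. l' \<bullet> y > 0" "l' \<bullet> p \<noteq> 0"
  proof (cases "l \<bullet> p = 0")
    case True
    have "((\<lambda>t. (l + t *\<^sub>R p) \<bullet> y) \<longlongrightarrow> (l + 0 *\<^sub>R p) \<bullet> y) (at_right 0)" for y
      by (intro tendsto_intros)
    then have "\<forall>\<^sub>F t in at_right 0. (l + t *\<^sub>R p) \<bullet> y > 0" if "y \<in> S" for y
      using l that by (intro order_tendstoD(1)) auto
    then have "\<forall>\<^sub>F t in at_right 0. \<forall>y\<in>S. (l + t *\<^sub>R p) \<bullet> y > 0"
      using assms(1) by (intro eventually_ball_finite) auto
    moreover have "\<forall>\<^sub>F t in at_right (0::real). t > 0" by (simp add: eventually_at_right_less)
    ultimately have "\<forall>\<^sub>F t in at_right 0. (\<forall>y\<in>S. (l + t *\<^sub>R p) \<bullet> y > 0) \<and> t > 0"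
      by (rule eventually_conj)
    then obtain t where t: "\<forall>y\<in>S. (l + t *\<^sub>R p) \<bullet> y > 0" "t > 0"
      using eventually_happens'[OF trivial_limit_at_right_real] by blast
    have "(l + t *\<^sub>R p) \<bullet> p \<noteq> 0"
      using True t(2) vertices_nonzero[OF assms(4)] by (simp add: inner_add_left)
    then show ?thesis using t that by blast
  qed (use l that in blast)
  define p' where "p' = (if l' \<bullet> p > 0 then p else - p)"
  have "l' \<bullet> p' > 0" using l'(2) by (auto simp: p'_def)
  moreover have "p' \<in> vertices" using assms(4) vertices_minus[OF True] by (simp add: p'_def)
  moreover have "point_of g p' = point_of g p" using True by (auto simp: p'_def)
  moreover have "p' = p \<or> p' = - p" by (simp add: p'_def)
  ultimately show ?thesis using l' by blast
qed

text \<open>Supplies the hypothesis \<open>lift\<close> of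
  \<open>tuple_relations_if_cone_sign_eq_0\<close>. The starting point is a linear functional with
  value 1 on the independent vectors.\<close>

lemma independent_lift:
  assumes "p \<in> vertices" "set ys \<subseteq> vertices" "distinct ys" "independent (set ys)"
  shows "\<exists>p'\<in>vertices. point_of g p' = point_of g p \<and> (p' = p \<or> p' = - p) \<and> (\<exists>l. \<forall>y\<in>set (p' # ys). l \<bullet> y > 0)"
proof -
  obtain f :: "real ^ 'n option \<Rightarrow> real" where f: "linear f" "\<forall>y\<in>set ys. f y = 1"
    using linear_independent_extend[OF assms(4), of "\<lambda>_. 1"] by auto
  have "\<forall>y\<in>set ys. adjoint f 1 \<bullet> y > 0"
    using f adjoint_works[OF f(1), of _ 1] by (simp add: inner_commute)
  then show ?thesis using positive_lift[of "set ys" p] assms by auto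
qed

lemma lift_positive:
  assumes "set ys \<subseteq> vertices"
  shows "\<exists>ys'. length ys' = length ys \<and> set ys' \<subseteq> vertices \<and> map (point_of g) ys' = map (point_of g) ys \<and>
    list_all2 (\<lambda>y' y. y' = y \<or> g = Spherical \<and> y' = - y) ys' ys \<and> (\<exists>l. \<forall>y\<in>set ys'. l \<bullet> y > 0)"
  using assms
proof (induction ys)
  case (Cons y ys)
  then obtain ys' where ys': "length ys' = length ys" "set ys' \<subseteq> vertices"
    "map (point_of g) ys' = map (point_of g) ys" "list_all2 (\<lambda>y' y. y' = y \<or> g = Spherical \<and> y' = - y) ys' ys"
    "\<exists>l. \<forall>y\<in>set ys'. l \<bullet> y > 0"
    by auto
  obtain y' where y': "y' \<in> vertices" "point_of g y' = point_of g y" "\<exists>l. \<forall>y\<in>insert y' (set ys'). l \<bullet> y > 0"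
    using positive_lift[of "set ys'" y] ys' Cons.prems by auto
  have "y' = y \<or> g = Spherical \<and> y' = - y"
    using point_of_eq_iff[of y g y'] y' Cons.prems by (auto simp: vertices_def)
  then show ?case using ys' y' by (intro exI[of _ "y' # ys'"]) auto
qed auto

lemma degenerate_iff:
  assumes "set vs \<subseteq> vertices"
  shows "degenerate g (map (point_of g) vs) \<longleftrightarrow> dim (set vs) < Suc CARD('n)"
proof
  assume "degenerate g (map (point_of g) vs)"
  then obtain A where A: "gdim A \<le> int CARD('n) - 1" "\<Union>(set (map (point_of g) vs)) \<subseteq> A"
    by (auto simp: degenerate_def)
  then have "set vs \<subseteq> A" using mem_point_of by fastforce
  then have "dim (set vs) \<le> dim A" by (rule dim_subset)
  then show "dim (set vs) < Suc CARD('n)" using A(1) by (simp add: gdim_def)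
next
  assume d: "dim (set vs) < Suc CARD('n)"
  let ?A = "model_space g \<inter> span (set vs)"
  have "set vs \<subseteq> model_space g" using assms by (auto simp: vertices_def)
  then have "\<Union>(set (map (point_of g) vs)) \<subseteq> ?A"
    using point_of_eq span_mono[of "{_}" "set vs"] by fastforce
  moreover have "dim ?A \<le> dim (span (set vs))" by (intro dim_subset) auto
  then have "gdim ?A \<le> int CARD('n) - 1" using d by (simp add: gdim_def)
  moreover have "geometric_subspace g ?A" by (auto simp: geometric_subspace_def intro: subspace_span)
  ultimately show "degenerate g (map (point_of g) vs)" unfolding degenerate_def by blast
qed

section \<open>Polytopes and cells of a hyperplane arrangement\<close>

lemma openin_positive:
  assumes "finite A"
  shows "openin (top_of_set (model_space g)) {x \<in> model_space g. \<forall>a\<in>A. 0 < c a * (a \<bullet> x)}"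
proof -
  have "open (\<Inter>a\<in>A. {x. 0 < c a * (a \<bullet> x)})"
    using assms by (intro open_INT ballI open_Collect_less continuous_intros) auto
  moreover have "{x \<in> model_space g. \<forall>a\<in>A. 0 < c a * (a \<bullet> x)} = model_space g \<inter> (\<Inter>a\<in>A. {x. 0 < c a * (a \<bullet> x)})"
    by auto
  ultimately show ?thesis by (auto simp: openin_open)
qed

lemma generic_normals:
  assumes "finite A" "A \<subseteq> normals"
  shows "\<forall>\<^sub>F z in generic UNIV. \<forall>a\<in>A. a \<bullet> z \<noteq> 0"
proof -
  have "\<forall>\<^sub>F z in generic UNIV. z \<in> UNIV \<and> z \<notin> {x. a \<bullet> x = 0}" if "a \<in> A" for a
  proof (rule generic_subspace)
    have "a \<bullet> a \<noteq> 0" using normals_nonzero[of a] that assms(2) by auto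
    then show "\<not> UNIV \<subseteq> {x. a \<bullet> x = 0}" by blast
  qed (rule subspace_hyperplane)
  then show ?thesis using assms(1) by (intro eventually_ball_finite) auto
qed

lemma convex_polytope_iff:
  "convex_polytope g L P \<longleftrightarrow> bounded P \<and>
    (\<forall>A. geometric_subspace g A \<and> P \<subseteq> A \<longrightarrow> A = model_space g) \<and>
    (\<exists>F. finite F \<and> F \<subseteq> normals \<and> P = {x \<in> model_space g. \<forall>a\<in>F. a \<bullet> x \<le> 0})"
proof -
  have "(\<exists>F. finite F \<and> F \<subseteq> halfspaces g L \<and> P = model_space g \<inter> \<Inter>F) \<longleftrightarrow>
    (\<exists>F. finite F \<and> F \<subseteq> normals \<and> P = {x \<in> model_space g. \<forall>a\<in>F. a \<bullet> x \<le> 0})"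
    (is "?L \<longleftrightarrow> ?R")
  proof
    assume ?L
    then obtain F where F: "finite F" "F \<subseteq> (\<lambda>a. {x. a \<bullet> x \<le> 0}) ` normals" "P = model_space g \<inter> \<Inter>F"
      unfolding halfspaces_eq by blast
    then obtain F' where "F' \<subseteq> normals" "finite F'" "F = (\<lambda>a. {x. a \<bullet> x \<le> 0}) ` F'"
      using finite_subset_image[OF F(1,2)] by blast
    then show ?R using F(3) by (intro exI[of _ F']) auto
  next
    assume ?R
    then obtain F where "finite F" "F \<subseteq> normals" "P = {x \<in> model_space g. \<forall>a\<in>F. a \<bullet> x \<le> 0}" by blast
    then show ?L
      unfolding halfspaces_eq by (intro exI[of _ "(\<lambda>a. {x. a \<bullet> x \<le> 0}) ` F"]) auto
  qed
  then show ?thesis by (simp only: convex_polytope_def)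
qed

text \<open>Fullness is stated through geometric subspaces; this converts it into a point where all
  inequalities are strict. A point strict for the earlier normals and one strict for the new normal
  are added, and the sum is scaled back to the model space.\<close>

lemma strict_point:
  assumes F: "finite F" "F \<subseteq> normals"
    and full: "\<forall>A. geometric_subspace g A \<and> {x \<in> model_space g. \<forall>a\<in>F. a \<bullet> x \<le> 0} \<subseteq> A \<longrightarrow> A = model_space g"
  shows "\<exists>p\<in>model_space g. \<forall>a\<in>F. a \<bullet> p < 0"
proof -
  let ?R = "{x \<in> model_space g. \<forall>a\<in>F. a \<bullet> x \<le> 0}"
  have geo: "geometric_subspace g (model_space g \<inter> V)" if "subspace V" for V :: "(real ^ 'n option) set"
    using that by (auto simp: geometric_subspace_def)
  have full': "A = model_space g" if "geometric_subspace g A" "?R \<subseteq> A" for A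
    by (rule full[THEN spec, THEN mp, OF conjI[OF that]])
  have "\<exists>p\<in>?R. \<forall>a\<in>F'. a \<bullet> p < 0" if "finite F'" "F' \<subseteq> F" for F'
    using that
  proof (induction F' rule: finite_induct)
    case empty
    have "?R \<noteq> {}"
    proof
      assume "?R = {}"
      then have "?R \<subseteq> model_space g \<inter> {0}" by (simp only: empty_subsetI)
      then have eq: "model_space g \<inter> {0 :: real ^ 'n option} = model_space g"
        by (rule full'[OF geo[OF subspace_single_0]])
      obtain x where "x \<in> (model_space g :: (real ^ 'n option) set)"
        using model_space_nonempty[of g, where 'n = 'n] by blast
      then have x: "x \<in> model_space g \<inter> {0 :: real ^ 'n option}" by (simp only: eq)
      have "x \<noteq> 0"
        using subsetD[OF model_space_subset_cone IntD1[OF x]] zero_notin_model_cone[of g] by metis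
      then show False using IntD2[OF x] by simp
    qed
    then show ?case by auto
  next
    case (insert a F')
    then obtain p where p: "p \<in> ?R" "\<forall>b\<in>F'. b \<bullet> p < 0" by auto
    \<comment> \<open>Otherwise fullness would make the whole model space, and hence its linear
      span, orthogonal to \<open>a\<close>.\<close>
    have "\<not> ?R \<subseteq> {x. a \<bullet> x = 0}"
    proof
      assume "?R \<subseteq> {x. a \<bullet> x = 0}"
      then have "?R \<subseteq> model_space g \<inter> {x. a \<bullet> x = 0}" by auto
      then have "model_space g \<inter> {x. a \<bullet> x = 0} = model_space g"
        by (rule full'[OF geo[OF subspace_hyperplane[of a]]])
      then have "span (model_space g) \<subseteq> {x. a \<bullet> x = 0}"
        by (intro span_minimal subspace_hyperplane) auto
      then have "a \<bullet> a = 0" unfolding span_model_space by blast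
      then show False using normals_nonzero[of a] insert.prems F by auto
    qed
    then obtain q where q: "q \<in> ?R" "a \<bullet> q \<noteq> 0" by blast
    then have aq: "a \<bullet> q < 0" using insert.prems by force
    have apq: "a \<bullet> (p + q) < 0" using p(1) aq insert.prems by (force simp: inner_add_right)
    then have "p + q \<noteq> 0" by auto
    then have pq: "p + q \<in> model_cone g"
      using p(1) q(1) model_space_subset_cone by (intro model_cone_add) auto
    let ?z = "(1 / radial g (p + q)) *\<^sub>R (p + q)"
    have neg: "b \<bullet> ?z < 0" if "b \<bullet> (p + q) < 0" for b
      using that radial_pos[OF pq] by (simp add: divide_neg_pos)
    have "b \<bullet> (p + q) < 0" if "b \<in> insert a F'" for b
      using that apq p(2) q(1) insert.prems by (force simp: inner_add_right)
    moreover have "b \<bullet> (p + q) \<le> 0" if "b \<in> F" for b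
      using that p(1) q(1) by (force simp: inner_add_right)
    then have "?z \<in> ?R"
      using normalize_in_model_space[OF pq] radial_pos[OF pq] by (auto simp: divide_le_0_iff)
    ultimately show ?case using neg by blast
  qed
  from this[OF F(1)] show ?thesis by auto
qed

text \<open>\<open>A\<close> contains the normals of some decomposition of \<open>P\<close> into
  convex pieces. Since \<open>A\<close> may be enlarged, finitely many polytopes have a common
  \<open>A\<close>, and all of them are then unions of cells of one arrangement.\<close>

definition supports :: "(real ^ 'n option) set \<Rightarrow> (real ^ 'n option) set \<Rightarrow> bool" where
  "supports A P \<longleftrightarrow> finite A \<and> A \<subseteq> normals \<and>
     (\<exists>\<Q>. finite \<Q> \<and> P = \<Union>\<Q> \<and>
        (\<forall>Q\<in>\<Q>. convex_polytope g L Q \<and> (\<exists>F\<subseteq>A. Q = {x \<in> model_space g. \<forall>a\<in>F. a \<bullet> x \<le> 0})))"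

lemma supports_mono:
  assumes "supports A P" "A \<subseteq> B" "finite B" "B \<subseteq> normals"
  shows "supports B P"
proof -
  obtain \<Q> where \<Q>: "finite \<Q>" "P = \<Union>\<Q>"
    "\<forall>Q\<in>\<Q>. convex_polytope g L Q \<and> (\<exists>F\<subseteq>A. Q = {x \<in> model_space g. \<forall>a\<in>F. a \<bullet> x \<le> 0})"
    using assms(1) unfolding supports_def by (elim conjE exE)
  have "\<exists>F\<subseteq>B. Q = {x \<in> model_space g. \<forall>a\<in>F. a \<bullet> x \<le> 0}" if "Q \<in> \<Q>" for Q
  proof -
    obtain F where "F \<subseteq> A" "Q = {x \<in> model_space g. \<forall>a\<in>F. a \<bullet> x \<le> 0}"
      using bspec[OF \<Q>(3) \<open>Q \<in> \<Q>\<close>] by (elim conjE exE)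
    then show ?thesis using assms(2) by (intro exI[of _ F] conjI subset_trans[of F A B])
  qed
  then show ?thesis
    unfolding supports_def using \<Q> assms(3,4) by (intro conjI exI[of _ \<Q>] ballI) simp_all
qed

lemma L_polytope_supports:
  assumes "P \<in> L_polytopes g L"
  shows "\<exists>A. supports A P"
proof -
  obtain \<Q> where \<Q>: "finite \<Q>" "P = \<Union>\<Q>" "\<forall>Q\<in>\<Q>. convex_polytope g L Q"
    using assms by (auto simp: L_polytopes_def)
  have "\<forall>Q\<in>\<Q>. \<exists>F. finite F \<and> F \<subseteq> normals \<and> Q = {x \<in> model_space g. \<forall>a\<in>F. a \<bullet> x \<le> 0}"
    using \<Q>(3) convex_polytope_iff by blast
  then obtain F where F: "\<forall>Q\<in>\<Q>. finite (F Q) \<and> F Q \<subseteq> normals \<and> Q = {x \<in> model_space g. \<forall>a\<in>F Q. a \<bullet> x \<le> 0}"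
    by (rule bchoice[THEN exE])
  then have "finite (\<Union>(F ` \<Q>))" "\<Union>(F ` \<Q>) \<subseteq> normals" using \<Q>(1) by auto
  moreover have "\<exists>F'\<subseteq>\<Union>(F ` \<Q>). Q = {x \<in> model_space g. \<forall>a\<in>F'. a \<bullet> x \<le> 0}" if "Q \<in> \<Q>" for Q
    using F that by (intro exI[of _ "F Q"]) auto
  ultimately have "supports (\<Union>(F ` \<Q>)) P"
    unfolding supports_def using \<Q> by (intro conjI exI[of _ \<Q>] ballI) simp_all
  then show ?thesis ..
qed

lemma supportsE:
  assumes "supports A P" "x \<in> P"
  obtains F where "F \<subseteq> A" "x \<in> {x \<in> model_space g. \<forall>a\<in>F. a \<bullet> x \<le> 0}"
    "{x \<in> model_space g. \<forall>a\<in>F. a \<bullet> x \<le> 0} \<subseteq> P"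
    "convex_polytope g L {x \<in> model_space g. \<forall>a\<in>F. a \<bullet> x \<le> 0}"
proof -
  obtain \<Q> where \<Q>: "P = \<Union>\<Q>"
    "\<forall>Q\<in>\<Q>. convex_polytope g L Q \<and> (\<exists>F\<subseteq>A. Q = {x \<in> model_space g. \<forall>a\<in>F. a \<bullet> x \<le> 0})"
    using assms(1) unfolding supports_def by (elim conjE exE)
  obtain Q where Q: "Q \<in> \<Q>" "x \<in> Q" using assms(2) \<Q>(1) by blast
  obtain F where F: "F \<subseteq> A" "Q = {x \<in> model_space g. \<forall>a\<in>F. a \<bullet> x \<le> 0}" "convex_polytope g L Q"
    using bspec[OF \<Q>(2) Q(1)] by (elim conjE exE)
  have "Q \<subseteq> P" using Q(1) \<Q>(1) by blast
  then show ?thesis using that[OF F(1)] Q(2) F(3) unfolding F(2) by (simp only: simp_thms)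
qed

text \<open>The set \<open>B\<close> forces prescribed normals into the common arrangement, as
  needed to make the cones over its cells pointed.\<close>

lemma finite_L_polytopes_supports:
  assumes "finite \<P>" "\<P> \<subseteq> L_polytopes g L" "finite B" "B \<subseteq> normals"
  shows "\<exists>A. B \<subseteq> A \<and> finite A \<and> A \<subseteq> normals \<and> (\<forall>P\<in>\<P>. supports A P)"
  using assms(1,2)
proof (induction \<P> rule: finite_induct)
  case empty
  then show ?case using assms by blast
next
  case (insert P \<P>)
  then obtain A where A: "B \<subseteq> A" "finite A" "A \<subseteq> normals" "\<forall>P\<in>\<P>. supports A P" by auto
  obtain A' where A': "supports A' P" using L_polytope_supports insert.prems by blast
  then have fin: "finite (A \<union> A')" "A \<union> A' \<subseteq> normals" using A by (auto simp: supports_def)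
  then have "\<forall>P\<in>insert P \<P>. supports (A \<union> A') P"
    using A(4) A' by (auto intro: supports_mono)
  then show ?case using A(1) fin by (intro exI[of _ "A \<union> A'"]) auto
qed

lemma L_polytopes_subset: "P \<in> L_polytopes g L \<Longrightarrow> P \<subseteq> model_space g \<and> bounded P"
  by (auto simp: L_polytopes_def convex_polytope_def)

section \<open>Decomposition of a polytope into cells\<close>

definition off_walls :: "(real ^ 'n option) set \<Rightarrow> (real ^ 'n option) set" where
  "off_walls A = {z \<in> model_space g. \<forall>a\<in>A. a \<bullet> z \<noteq> 0}"

text \<open>For \<open>z\<close> off the walls this is the closed cell around \<open>z\<close>,
  encoded by a point inside instead of a sign vector: \<open>x\<close> belongs to it when no wall
  strictly separates \<open>x\<close> from \<open>z\<close>.\<close>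

definition cell :: "(real ^ 'n option) set \<Rightarrow> real ^ 'n option \<Rightarrow> (real ^ 'n option) set" where
  "cell A z = {x \<in> model_space g. \<forall>a\<in>A. 0 \<le> (a \<bullet> z) * (a \<bullet> x)}"

definition open_cell :: "(real ^ 'n option) set \<Rightarrow> real ^ 'n option \<Rightarrow> (real ^ 'n option) set" where
  "open_cell A z = {x \<in> model_space g. \<forall>a\<in>A. 0 < (a \<bullet> z) * (a \<bullet> x)}"

definition cells :: "(real ^ 'n option) set \<Rightarrow> (real ^ 'n option) set \<Rightarrow> (real ^ 'n option) set set" where
  "cells A P = cell A ` (P \<inter> off_walls A)"

lemma openin_open_cell: "finite A \<Longrightarrow> openin (top_of_set (model_space g)) (open_cell A z)"
  unfolding open_cell_def by (rule openin_positive)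

lemma mem_open_cell: "z \<in> off_walls A \<Longrightarrow> z \<in> open_cell A z"
  by (auto simp: open_cell_def off_walls_def simp flip: power2_eq_square)

lemma open_cell_subset: "open_cell A z \<subseteq> cell A z"
  by (auto simp: open_cell_def cell_def less_imp_le)

lemma mem_cell: "z \<in> off_walls A \<Longrightarrow> z \<in> cell A z"
  using mem_open_cell open_cell_subset by blast

lemma cell_eq:
  assumes "z \<in> off_walls A" "z' \<in> off_walls A" "z' \<in> cell A z"
  shows "cell A z' = cell A z"
proof -
  have "0 \<le> (a \<bullet> z) * (a \<bullet> x) \<longleftrightarrow> 0 \<le> (a \<bullet> z') * (a \<bullet> x)" if "a \<in> A" for a x
  proof -
    have "a \<bullet> z \<noteq> 0" "a \<bullet> z' \<noteq> 0" "0 \<le> (a \<bullet> z) * (a \<bullet> z')"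
      using assms that by (auto simp: off_walls_def cell_def)
    then show ?thesis by (auto simp: zero_le_mult_iff)
  qed
  then show ?thesis by (auto simp: cell_def)
qed

lemma finite_cells: "finite A \<Longrightarrow> finite (cells A P)"
proof -
  assume A: "finite A"
  have "cells A P \<subseteq> (\<lambda>B. {x \<in> model_space g. \<forall>a\<in>A. if a \<in> B then 0 \<le> a \<bullet> x else a \<bullet> x \<le> 0}) ` Pow A"
  proof
    fix Q assume "Q \<in> cells A P"
    then obtain z where z: "z \<in> off_walls A" "Q = cell A z" by (auto simp: cells_def)
    let ?B = "{a \<in> A. a \<bullet> z > 0}"
    have "0 \<le> (a \<bullet> z) * (a \<bullet> x) \<longleftrightarrow> (if a \<in> ?B then 0 \<le> a \<bullet> x else a \<bullet> x \<le> 0)" if "a \<in> A" for a x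
      using z(1) that by (auto simp: off_walls_def zero_le_mult_iff)
    then have "Q = {x \<in> model_space g. \<forall>a\<in>A. if a \<in> ?B then 0 \<le> a \<bullet> x else a \<bullet> x \<le> 0}"
      unfolding z(2) cell_def by (intro Collect_cong conj_cong ball_cong) auto
    then show "Q \<in> (\<lambda>B. {x \<in> model_space g. \<forall>a\<in>A. if a \<in> B then 0 \<le> a \<bullet> x else a \<bullet> x \<le> 0}) ` Pow A"
      by (intro image_eqI[of _ _ ?B]) auto
  qed
  then show ?thesis by (rule finite_subset) (simp add: A)
qed

lemma cell_subset_polytope:
  assumes "supports A P" "z \<in> P" "z \<in> off_walls A"
  shows "cell A z \<subseteq> P"
proof -
  obtain F where F0: "F \<subseteq> A" "z \<in> {x \<in> model_space g. \<forall>a\<in>F. a \<bullet> x \<le> 0}"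
    "{x \<in> model_space g. \<forall>a\<in>F. a \<bullet> x \<le> 0} \<subseteq> P"
    by (rule supportsE[OF assms(1,2)])
  define Q where "Q = {x \<in> model_space g. \<forall>a\<in>F. a \<bullet> x \<le> 0}"
  note F = F0(1) Q_def F0(2,3)[folded Q_def]
  have "cell A z \<subseteq> Q"
  proof
    fix x assume x: "x \<in> cell A z"
    have "a \<bullet> x \<le> 0" if "a \<in> F" for a
    proof -
      have "a \<bullet> z \<le> 0" "a \<bullet> z \<noteq> 0" "0 \<le> (a \<bullet> z) * (a \<bullet> x)"
        using F assms(3) x that by (auto simp: off_walls_def cell_def)
      then show ?thesis by (auto simp: zero_le_mult_iff)
    qed
    then show "x \<in> Q" using x F(2) by (simp add: cell_def)
  qed
  then show ?thesis using F(4) by blast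
qed

text \<open>A convex piece through \<open>x\<close> has strict points, and among them a generic one
  \<open>v\<close>. Adding a small multiple of \<open>v\<close> to \<open>x\<close> and normalizing
  stays in the piece and leaves all walls. Signs that were nonzero at \<open>x\<close> are kept, so
  \<open>x\<close> lies in the closed cell of the new point.\<close>

lemma polytope_covered:
  assumes P: "supports A P" and x: "x \<in> P"
  shows "\<exists>z\<in>P \<inter> off_walls A. x \<in> cell A z"
proof -
  obtain F where F0: "F \<subseteq> A" "x \<in> {x \<in> model_space g. \<forall>a\<in>F. a \<bullet> x \<le> 0}"
    "{x \<in> model_space g. \<forall>a\<in>F. a \<bullet> x \<le> 0} \<subseteq> P"
    "convex_polytope g L {x \<in> model_space g. \<forall>a\<in>F. a \<bullet> x \<le> 0}"
    by (rule supportsE[OF P x])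
  define Q where "Q = {x \<in> model_space g. \<forall>a\<in>F. a \<bullet> x \<le> 0}"
  note F = F0(1) Q_def F0(2,3,4)[folded Q_def]
  have A: "finite A" "A \<subseteq> normals" using P by (auto simp: supports_def)
  have finF: "finite F" using F(1) A(1) by (rule finite_subset)
  obtain p where p: "p \<in> model_space g" "\<forall>a\<in>F. a \<bullet> p < 0"
    using strict_point[OF finF subset_trans[OF F0(1) A(2)]] F0(4) unfolding convex_polytope_iff
    by (elim conjE) blast
  let ?O = "{x \<in> model_space g. \<forall>a\<in>F. 0 < (- 1) * (a \<bullet> x)}"
  have "\<exists>v\<in>?O. \<forall>a\<in>A. a \<bullet> v \<noteq> 0"
  proof (rule open_in_model_space_generic[where g = g])
    show "openin (top_of_set (model_space g)) ?O" by (rule openin_positive[OF finF])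
    show "?O \<noteq> {}" using p by auto
  qed (rule generic_normals[OF A])
  then obtain v where v: "v \<in> model_space g" "\<forall>a\<in>F. a \<bullet> v < 0" "\<forall>a\<in>A. a \<bullet> v \<noteq> 0" by auto
  have xX: "x \<in> model_space g" using F by auto
  have lim: "((\<lambda>t. x + t *\<^sub>R v) \<longlongrightarrow> x) (at_right 0)" by (auto intro!: tendsto_eq_intros)
  have 1: "\<forall>\<^sub>F t in at_right 0. x + t *\<^sub>R v \<in> model_cone g"
    using topological_tendstoD[OF lim open_model_cone] xX model_space_subset_cone by blast
  have "\<forall>\<^sub>F t in at_right 0. a \<bullet> x \<noteq> 0 \<longrightarrow> 0 < (a \<bullet> x) * (a \<bullet> (x + t *\<^sub>R v))" for a
  proof (cases "a \<bullet> x = 0")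
    case False
    have "((\<lambda>t. (a \<bullet> x) * (a \<bullet> (x + t *\<^sub>R v))) \<longlongrightarrow> (a \<bullet> x) * (a \<bullet> x)) (at_right 0)"
      by (intro tendsto_intros lim)
    moreover have "0 < (a \<bullet> x) * (a \<bullet> x)" using False by (simp flip: power2_eq_square)
    ultimately have "\<forall>\<^sub>F t in at_right 0. 0 < (a \<bullet> x) * (a \<bullet> (x + t *\<^sub>R v))"
      by (rule order_tendstoD(1))
    then show ?thesis by (rule eventually_mono) simp
  qed simp
  then have 2: "\<forall>\<^sub>F t in at_right 0. \<forall>a\<in>A. a \<bullet> x \<noteq> 0 \<longrightarrow> 0 < (a \<bullet> x) * (a \<bullet> (x + t *\<^sub>R v))"
    using A(1) by (intro eventually_ball_finite) auto
  have 3: "\<forall>\<^sub>F t in at_right (0::real). t > 0" by (simp add: eventually_at_right_less)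
  have "\<forall>\<^sub>F t in at_right (0::real). \<exists>z\<in>P \<inter> off_walls A. x \<in> cell A z"
    using 1 2 3
  proof eventually_elim
    case (elim t)
    let ?q = "x + t *\<^sub>R v"
    let ?z = "(1 / radial g ?q) *\<^sub>R ?q"
    have r: "radial g ?q > 0" by (rule radial_pos[OF elim(1)])
    have zX: "?z \<in> model_space g" by (rule normalize_in_model_space[OF elim(1)])
    have q: "a \<bullet> ?q \<noteq> 0 \<and> 0 \<le> (a \<bullet> ?q) * (a \<bullet> x)" if "a \<in> A" for a
    proof (cases "a \<bullet> x = 0")
      case True
      then show ?thesis using v(3) elim(3) that by (simp add: inner_add_right)
    next
      case False
      then have "0 < (a \<bullet> x) * (a \<bullet> ?q)" using elim(2) that by blast
      then show ?thesis by (auto simp: mult.commute)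
    qed
    have "?z \<in> off_walls A" using zX q r by (auto simp: off_walls_def)
    moreover have "a \<bullet> ?z \<le> 0" if "a \<in> F" for a
    proof -
      have "a \<bullet> x \<le> 0" "a \<bullet> v < 0" using F(2,3) v(2) that by auto
      then have "a \<bullet> ?q \<le> 0" using elim(3) by (simp add: inner_add_right add_nonpos_nonpos mult_nonneg_nonpos)
      then show ?thesis using r by (simp add: divide_le_0_iff)
    qed
    then have "?z \<in> P" using zX F(2,4) by auto
    moreover have "0 \<le> (a \<bullet> ?z) * (a \<bullet> x)" if "a \<in> A" for a
    proof -
      have "0 \<le> (1 / radial g ?q) * ((a \<bullet> ?q) * (a \<bullet> x))"
        by (rule mult_nonneg_nonneg) (use q[OF that] r in simp_all)
      then show ?thesis by simp
    qed
    then have "x \<in> cell A ?z" using xX by (simp add: cell_def)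
    ultimately show ?case by blast
  qed
  then show ?thesis by simp
qed

lemma cell_generic:
  assumes "finite A" "A \<subseteq> normals" "z \<in> off_walls A" "\<forall>\<^sub>F x in generic UNIV. P x"
  shows "\<exists>z'\<in>open_cell A z. z' \<in> off_walls A \<and> P z'"
proof -
  have "\<forall>\<^sub>F x in generic UNIV. (\<forall>a\<in>A. a \<bullet> x \<noteq> 0) \<and> P x"
    using generic_normals[OF assms(1,2)] assms(4) by (rule eventually_conj)
  then have "\<exists>x\<in>open_cell A z. (\<forall>a\<in>A. a \<bullet> x \<noteq> 0) \<and> P x"
    using openin_open_cell[OF assms(1)] mem_open_cell[OF assms(3)]
    by (intro open_in_model_space_generic[where g = g]) auto
  then show ?thesis by (auto simp: off_walls_def open_cell_def)
qed

text \<open>Signs are chosen to make every normal negative at \<open>z\<close>, which brings the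
  cell into the form \<open>a \<bullet> x \<le> 0\<close> used for polytopes and for
  \<open>polyhedral_cone\<close>.\<close>

definition inner_normals :: "(real ^ 'n option) set \<Rightarrow> real ^ 'n option \<Rightarrow> (real ^ 'n option) set" where
  "inner_normals A z = (\<lambda>a. if a \<bullet> z > 0 then - a else a) ` A"

lemma inner_normals:
  assumes "finite A" "A \<subseteq> normals" "z \<in> off_walls A"
  shows "finite (inner_normals A z)" "inner_normals A z \<subseteq> normals"
    and "\<forall>a\<in>inner_normals A z. a \<bullet> z < 0"
    and "cell A z = {x \<in> model_space g. \<forall>a\<in>inner_normals A z. a \<bullet> x \<le> 0}"
proof -
  show "finite (inner_normals A z)" "inner_normals A z \<subseteq> normals"
    using assms normals_minus by (auto simp: inner_normals_def)
  show "\<forall>a\<in>inner_normals A z. a \<bullet> z < 0"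
    using assms by (auto simp: inner_normals_def off_walls_def)
  have "0 \<le> (a \<bullet> z) * (a \<bullet> x) \<longleftrightarrow> (if a \<bullet> z > 0 then - a else a) \<bullet> x \<le> 0" if "a \<in> A" for a x
    using assms that by (auto simp: off_walls_def zero_le_mult_iff)
  then show "cell A z = {x \<in> model_space g. \<forall>a\<in>inner_normals A z. a \<bullet> x \<le> 0}"
    unfolding cell_def inner_normals_def ball_simps by simp
qed

lemma supports_normals: "supports A P \<Longrightarrow> finite A \<and> A \<subseteq> normals"
  by (simp add: supports_def)

lemma supports_L_polytope: "supports A P \<Longrightarrow> P \<in> L_polytopes g L"
  by (auto simp: supports_def L_polytopes_def)

lemma convex_polytope_cell:
  assumes "supports A P" "z \<in> P" "z \<in> off_walls A"
  shows "convex_polytope g L (cell A z)"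
  unfolding convex_polytope_iff
proof (intro conjI allI impI)
  have A: "finite A" "A \<subseteq> normals" using supports_normals[OF assms(1)] by auto
  show "bounded (cell A z)"
    using cell_subset_polytope[OF assms] L_polytopes_subset[OF supports_L_polytope[OF assms(1)]]
    by (blast intro: bounded_subset)
  show "\<exists>F. finite F \<and> F \<subseteq> normals \<and> cell A z = {x \<in> model_space g. \<forall>a\<in>F. a \<bullet> x \<le> 0}"
    using inner_normals[OF A assms(3)] by blast
  fix S assume S: "geometric_subspace g S \<and> cell A z \<subseteq> S"
  then obtain V where V: "subspace V" "S = model_space g \<inter> V" by (auto simp: geometric_subspace_def)
  have "V = UNIV"
  proof (rule ccontr)
    assume "V \<noteq> UNIV"
    then have "\<forall>\<^sub>F x in generic UNIV. x \<in> UNIV \<and> x \<notin> V"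
      using V(1) by (intro generic_subspace) auto
    then obtain x where "x \<in> open_cell A z" "x \<notin> V" using cell_generic[OF A assms(3)] by blast
    then show False using S V(2) open_cell_subset by blast
  qed
  then show "S = model_space g" using V(2) by simp
qed

lemma interior_polytope:
  assumes "supports A P" "z \<in> P" "z \<in> off_walls A"
  shows "z \<in> top_of_set (model_space g) interior_of P"
proof -
  have "open_cell A z \<subseteq> P" using cell_subset_polytope[OF assms] open_cell_subset by blast
  moreover have "openin (top_of_set (model_space g)) (open_cell A z)"
    using openin_open_cell supports_normals[OF assms(1)] by blast
  ultimately have "open_cell A z \<subseteq> top_of_set (model_space g) interior_of P"
    by (rule interior_of_maximal)
  then show ?thesis using mem_open_cell[OF assms(3)] by blast
qed

lemma mem_cells_iff:
  assumes "supports A P" "z \<in> off_walls A"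
  shows "cell A z \<in> cells A P \<longleftrightarrow> z \<in> P"
proof
  assume "cell A z \<in> cells A P"
  then obtain z' where "z' \<in> P" "z' \<in> off_walls A" "cell A z = cell A z'" by (auto simp: cells_def)
  then show "z \<in> P" using cell_subset_polytope[OF assms(1), of z'] mem_cell[OF assms(2)] by blast
qed (use assms in \<open>auto simp: cells_def\<close>)

lemma subdivision_cells:
  assumes "supports A P"
  shows "subdivision g L P (cells A P)"
  unfolding subdivision_def
proof (intro conjI)
  have A: "finite A" "A \<subseteq> normals" using supports_normals[OF assms] by auto
  show "finite (cells A P)" by (rule finite_cells[OF A(1)])
  show "cells A P \<subseteq> L_polytopes g L"
  proof
    fix Q assume "Q \<in> cells A P"
    then have "convex_polytope g L Q" using convex_polytope_cell[OF assms] by (auto simp: cells_def)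
    then show "Q \<in> L_polytopes g L" unfolding L_polytopes_def by (intro CollectI exI[of _ "{Q}"]) auto
  qed
  show "\<Union>(cells A P) = P"
    using cell_subset_polytope[OF assms] polytope_covered[OF assms] by (fastforce simp: cells_def)
  show "pairwise (\<lambda>Q R. disjnt (top_of_set (model_space g) interior_of Q)
      (top_of_set (model_space g) interior_of R)) (cells A P)"
  proof (rule pairwiseI, rule ccontr)
    fix Q R assume QR: "Q \<in> cells A P" "R \<in> cells A P" "Q \<noteq> R"
    let ?O = "top_of_set (model_space g) interior_of Q \<inter> top_of_set (model_space g) interior_of R"
    assume "\<not> disjnt (top_of_set (model_space g) interior_of Q) (top_of_set (model_space g) interior_of R)"
    then have "?O \<noteq> {}" by (simp add: disjnt_def)
    moreover have "openin (top_of_set (model_space g)) ?O" by (intro openin_Int openin_interior_of)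
    ultimately obtain x where x: "x \<in> ?O" "\<forall>a\<in>A. a \<bullet> x \<noteq> 0"
      using open_in_model_space_generic[OF _ _ generic_normals[OF A]] by blast
    then have xQR: "x \<in> Q" "x \<in> R"
      using interior_of_subset[of "top_of_set (model_space g)"] by blast+
    then have "x \<in> off_walls A" using x(2) QR by (auto simp: off_walls_def cells_def cell_def)
    then have "cell A x = Q" "cell A x = R"
      using QR(1,2) xQR cell_eq by (auto simp: cells_def)
    then show False using QR(3) by simp
  qed
qed

section \<open>Indicator functions and the relations between polytopes\<close>

lemma subdivision_eval:
  assumes "P \<in> L_polytopes g L" "subdivision g L P F"
  shows "\<forall>\<^sub>F z in generic UNIV. z \<in> model_space g \<longrightarrow> of_bool (z \<in> P) = (\<Sum>Q\<in>F. of_bool (z \<in> Q) :: int)"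
proof -
  have F: "finite F" "F \<subseteq> L_polytopes g L" "\<Union>F = P"
    "pairwise (\<lambda>Q R. disjnt (top_of_set (model_space g) interior_of Q)
                            (top_of_set (model_space g) interior_of R)) F"
    using assms(2) by (auto simp: subdivision_def)
  obtain A where A: "finite A" "A \<subseteq> normals" "\<forall>Q\<in>F. supports A Q"
    using finite_L_polytopes_supports[OF F(1,2), of "{}"] by auto
  from generic_normals[OF A(1,2)] show ?thesis
  proof (eventually_elim, intro impI)
    fix z assume z: "\<forall>a\<in>A. a \<bullet> z \<noteq> 0" "z \<in> model_space g"
    then have zA: "z \<in> off_walls A" by (simp add: off_walls_def)
    \<comment> \<open>Off the walls every point of a piece is an interior point of it, so disjoint
      interiors leave at most one piece through \<open>z\<close>.\<close>
    have uniq: "Q = R" if "Q \<in> F" "R \<in> F" "z \<in> Q" "z \<in> R" for Q R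
    proof (rule ccontr)
      assume "Q \<noteq> R"
      then have "disjnt (top_of_set (model_space g) interior_of Q) (top_of_set (model_space g) interior_of R)"
        using F(4) that by (auto simp: pairwise_def)
      then show False
        using interior_polytope[of A Q z] interior_polytope[of A R z] A(3) that zA
        by (auto simp: disjnt_def)
    qed
    have "(\<Sum>Q\<in>F. of_bool (z \<in> Q) :: int) = int (card {Q \<in> F. z \<in> Q})"
      using F(1) by (simp add: of_bool_def sum.If_cases Int_def)
    also have "card {Q \<in> F. z \<in> Q} = of_bool (z \<in> P)"
    proof (cases "z \<in> P")
      case True
      then obtain Q where "Q \<in> F" "z \<in> Q" using F(3) by auto
      then have "{Q \<in> F. z \<in> Q} = {Q}" using uniq by auto
      then show ?thesis using True by simp
    next
      case False
      then have "{Q \<in> F. z \<in> Q} = {}" using F(3) by auto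
      then show ?thesis using False by (simp del: Collect_empty_eq)
    qed
    finally show "of_bool (z \<in> P) = (\<Sum>Q\<in>F. of_bool (z \<in> Q) :: int)" by simp
  qed
qed

text \<open>The premise \<open>z \<in> model_space g\<close> stands inside because the filter lives
  on the ambient vector space: the indicator function vanishes on the model space off finitely many
  proper linear subspaces.\<close>

definition negligible_frag :: "((real ^ 'n option) set \<Rightarrow>\<^sub>0 int) \<Rightarrow> bool" where
  "negligible_frag \<xi> \<longleftrightarrow>
     (\<forall>\<^sub>F z in generic UNIV. z \<in> model_space g \<longrightarrow> frag_eval (\<lambda>P. of_bool (z \<in> P)) \<xi> = 0)"

lemma Pt_relations_carrier: "Pt_relations g L \<subseteq> carrier (free_Abelian_group (L_polytopes g L))"
proof
  fix r assume "r \<in> Pt_relations g L"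
  then obtain P F where r: "r = frag_of P - (\<Sum>Q\<in>F. frag_of Q)" "P \<in> L_polytopes g L" "F \<subseteq> L_polytopes g L"
    by (auto simp: Pt_relations_def subdivision_def)
  have "Poly_Mapping.keys (\<Sum>Q\<in>F. frag_of Q) \<subseteq> L_polytopes g L"
    using keys_sum[of frag_of F] r(3) by (auto simp: keys_frag_of)
  then show "r \<in> carrier (free_Abelian_group (L_polytopes g L))"
    unfolding r(1) carrier_free_Abelian_group_iff
    using keys_diff[of "frag_of P" "\<Sum>Q\<in>F. frag_of Q"] r(2) by (auto simp: keys_frag_of)
qed

lemma Pt_null_eq: "Pt_null g L = zmod.span (Pt_relations g L)"
  unfolding Pt_null_def by (rule generate_free_Abelian_group[OF Pt_relations_carrier])

lemma negligible_subspace: "zmod.subspace {\<xi>. negligible_frag \<xi>}"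
  unfolding zmod.subspace_def
proof (intro conjI ballI allI)
  show "0 \<in> {\<xi>. negligible_frag \<xi>}" by (simp add: negligible_frag_def)
  fix x y assume "x \<in> {\<xi>. negligible_frag \<xi>}" "y \<in> {\<xi>. negligible_frag \<xi>}"
  then show "x + y \<in> {\<xi>. negligible_frag \<xi>}"
    unfolding negligible_frag_def mem_Collect_eq
    by eventually_elim (simp add: frag_eval_add)
next
  fix c x assume "x \<in> {\<xi>. negligible_frag \<xi>}"
  then show "frag_cmul c x \<in> {\<xi>. negligible_frag \<xi>}"
    unfolding negligible_frag_def mem_Collect_eq
    by eventually_elim (simp add: frag_eval_cmul)
qed

lemma Pt_null_negligible:
  assumes "\<xi> \<in> Pt_null g L"
  shows "negligible_frag \<xi>"
proof -
  have "Pt_relations g L \<subseteq> {\<xi>. negligible_frag \<xi>}"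
  proof
    fix r assume "r \<in> Pt_relations g L"
    then obtain P F where r: "r = frag_of P - (\<Sum>Q\<in>F. frag_of Q)" "P \<in> L_polytopes g L" "subdivision g L P F"
      by (auto simp: Pt_relations_def)
    from subdivision_eval[OF r(2,3)] show "r \<in> {\<xi>. negligible_frag \<xi>}"
      unfolding negligible_frag_def mem_Collect_eq r(1)
      by eventually_elim (simp add: frag_eval_diff frag_eval_sum)
  qed
  then have "zmod.span (Pt_relations g L) \<subseteq> {\<xi>. negligible_frag \<xi>}"
    by (rule zmod.span_minimal[OF _ negligible_subspace])
  then show ?thesis using assms by (auto simp: Pt_null_eq)
qed

text \<open>Modulo the relations every polytope is the sum of its cells in one common arrangement.
  The coefficient of a cell in the resulting combination is the value of the indicator function at a
  generic point of the open cell, hence zero for a negligible combination.\<close>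

theorem Pt_null_iff:
  assumes "Poly_Mapping.keys \<xi> \<subseteq> L_polytopes g L"
  shows "\<xi> \<in> Pt_null g L \<longleftrightarrow> negligible_frag \<xi>"
proof
  assume neg: "negligible_frag \<xi>"
  obtain A where A: "finite A" "A \<subseteq> normals" "\<forall>P\<in>Poly_Mapping.keys \<xi>. supports A P"
    using finite_L_polytopes_supports[OF finite_keys assms, of "{}"] by auto
  let ?\<eta> = "frag_extend (\<lambda>P. \<Sum>Q\<in>cells A P. frag_of Q) \<xi>"
  have "frag_of P - (\<Sum>Q\<in>cells A P. frag_of Q) \<in> zmod.span (Pt_relations g L)"
    if "P \<in> Poly_Mapping.keys \<xi>" for P
    using assms that subdivision_cells[of A P] A(3) unfolding Pt_relations_def
    by (intro zmod.span_base CollectI exI[of _ P] exI[of _ "cells A P"]) auto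
  then have "frag_extend (\<lambda>P. frag_of P - (\<Sum>Q\<in>cells A P. frag_of Q)) \<xi> \<in> zmod.span (Pt_relations g L)"
    by (rule frag_extend_in_span)
  then have 1: "\<xi> - ?\<eta> \<in> zmod.span (Pt_relations g L)"
    using frag_expansion[of \<xi>] by (simp add: frag_extend_fun_diff)
  have "Poly_Mapping.lookup ?\<eta> Q = 0" for Q
  proof -
    have "Poly_Mapping.lookup (\<Sum>Q\<in>cells A P. frag_of Q) Q = of_bool (Q \<in> cells A P)" for P
      using finite_cells[OF A(1)] by (simp add: lookup_sum lookup_single when_def sum.delta)
    then have look: "Poly_Mapping.lookup ?\<eta> Q = frag_eval (\<lambda>P. of_bool (Q \<in> cells A P)) \<xi>"
      by (simp add: frag_extend_def lookup_sum frag_eval_def)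
    show ?thesis
    proof (cases "Q \<in> cell A ` off_walls A")
      case False
      then have "Q \<notin> cells A P" for P by (auto simp: cells_def)
      then show ?thesis unfolding look by (simp add: frag_eval_def)
    next
      case True
      then obtain z where z: "z \<in> off_walls A" "Q = cell A z" by auto
      obtain z' where z': "z' \<in> open_cell A z" "z' \<in> off_walls A"
        "z' \<in> model_space g \<longrightarrow> frag_eval (\<lambda>P. of_bool (z' \<in> P)) \<xi> = 0"
        using cell_generic[OF A(1,2) z(1) neg[unfolded negligible_frag_def]] by blast
      have "Q = cell A z'" using cell_eq[OF z(1) z'(2)] z'(1) open_cell_subset z(2) by blast
      then have "frag_eval (\<lambda>P. of_bool (Q \<in> cells A P)) \<xi> = frag_eval (\<lambda>P. of_bool (z' \<in> P)) \<xi>"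
        using A(3) z'(2) by (intro frag_eval_cong) (simp add: mem_cells_iff)
      also have "\<dots> = 0" using z'(2,3) by (simp add: off_walls_def)
      finally show ?thesis unfolding look .
    qed
  qed
  then have "?\<eta> = 0" by (intro poly_mapping_eqI) simp
  then show "\<xi> \<in> Pt_null g L" using 1 by (simp add: Pt_null_eq)
qed (rule Pt_null_negligible)

section \<open>Polytopes and simplices\<close>

text \<open>Normals to be added to an arrangement so that the cones over its bounded cells are
  pointed: on the sphere they have no common zero, and in the other geometries having at least one
  is enough.\<close>

lemma ex_normals: "\<exists>E. finite E \<and> E \<subseteq> normals \<and> E \<noteq> {} \<and> (g = Spherical \<longrightarrow> flat E = {0})"
proof -
  have nontrivial: "(UNIV :: (real ^ 'n option) set) \<noteq> {0}"
  proof
    assume "(UNIV :: (real ^ 'n option) set) = {0}"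
    then have "dim (UNIV :: (real ^ 'n option) set) = dim {0 :: real ^ 'n option}" by (rule arg_cong)
    then show False using DIM_eq[where 'n='n] by simp
  qed
  show ?thesis
  proof (cases "g = Spherical")
    case True
    then obtain E where E: "finite E" "E \<subseteq> normals" "flat E = {0}" using spherical_normals by auto
    have "E \<noteq> {}"
    proof
      assume "E = {}"
      then show False using E(3) nontrivial by (simp add: flat_def)
    qed
    then show ?thesis using E by blast
  next
    case False
    have "vertices \<noteq> {}"
    proof
      assume "vertices = {}"
      then show False using span_vertices nontrivial by simp
    qed
    then obtain v where v: "v \<in> vertices" by blast
    obtain E where E: "finite E" "E \<subseteq> normals" "model_space g \<inter> flat E \<subseteq> span {v}" using point_flat[OF v] by blast
    have "E \<noteq> {}"
    proof
      assume "E = {}"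
      then have "span (model_space g) \<subseteq> span {v}"
        using E(3) by (intro span_minimal subspace_span) (auto simp: flat_def)
      then have "dim (UNIV :: (real ^ 'n option) set) \<le> dim (span {v})"
        unfolding span_model_space by (rule dim_subset)
      also have "\<dots> \<le> 1" using dim_le_card'[of "{v}"] by simp
      finally show False using DIM_eq[where 'n='n] by simp
    qed
    then show ?thesis using E False by blast
  qed
qed

text \<open>On the sphere minus the sum of the normals is positive on nonzero vectors of the cone,
  since the normals have no common zero. Otherwise boundedness of the cell gives
  \<open>norm y \<le> M * radial g y\<close> for \<open>y\<close> in both the cone and the model
  cone, so the segment from \<open>z\<close> to a nonzero \<open>x\<close> of the cone cannot leave
  the model cone, and \<open>axis None 1\<close> is the functional.\<close>

lemma cell_cone_pointed:
  assumes A: "supports A P" "z \<in> P" "z \<in> off_walls A" "A \<noteq> {}" "g = Spherical \<longrightarrow> flat A = {0}"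
  shows "\<exists>l. \<forall>x\<in>polyhedral_cone {} (inner_normals A z). x \<noteq> 0 \<longrightarrow> x \<in> model_cone g \<and> l \<bullet> x > 0"
proof -
  let ?A = "inner_normals A z" and ?K = "polyhedral_cone {} (inner_normals A z)"
  have A': "finite A" "A \<subseteq> normals" using supports_normals[OF A(1)] by auto
  note inn = inner_normals[OF A' A(3)]
  show ?thesis
  proof (cases "g = Spherical")
    case True
    have "(\<Sum>a\<in>?A. - a) \<bullet> x > 0" if x: "x \<in> ?K" "x \<noteq> 0" for x
    proof -
      have nn: "- a \<bullet> x \<ge> 0" if "a \<in> ?A" for a using x(1) that by (simp add: polyhedral_cone_def)
      have "(\<Sum>a\<in>?A. - a) \<bullet> x = (\<Sum>a\<in>?A. - a \<bullet> x)" by (rule inner_sum_left)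
      moreover have "(\<Sum>a\<in>?A. - a \<bullet> x) \<ge> 0" using nn by (rule sum_nonneg)
      moreover have "(\<Sum>a\<in>?A. - a \<bullet> x) \<noteq> 0"
      proof
        assume "(\<Sum>a\<in>?A. - a \<bullet> x) = 0"
        then have "\<forall>a\<in>?A. - a \<bullet> x = 0" using sum_nonneg_eq_0_iff[OF inn(1), of "\<lambda>a. - a \<bullet> x"] nn by blast
        then have "x \<in> flat A" unfolding inner_normals_def ball_simps flat_def by (auto split: if_splits)
        then show False using A(5) True x(2) by auto
      qed
      ultimately show ?thesis by linarith
    qed
    then show ?thesis using True by (intro exI[of _ "\<Sum>a\<in>?A. - a"]) (auto simp: model_cone_Spherical)
  next
    case False
    obtain M where M: "\<And>x. x \<in> cell A z \<Longrightarrow> norm x \<le> M"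
      using convex_polytope_cell[OF A(1-3)] by (auto simp: convex_polytope_def bounded_iff)
    have zC: "z \<in> model_cone g" using A(3) model_space_subset_cone by (auto simp: off_walls_def)
    have zK: "z \<in> ?K" using inn(3) by (auto simp: polyhedral_cone_def flat_def less_imp_le)
    have conv: "convex ?K"
      unfolding polyhedral_cone_def flat_def convex_def
      by (auto simp: inner_add_right intro!: add_nonpos_nonpos mult_nonneg_nonpos)
    have "x \<in> model_cone g" if x: "x \<in> ?K" "x \<noteq> 0" for x
    proof (rule segment_in_model_cone[OF False _ zC, where M = M])
      fix y assume y: "y \<in> closed_segment z x" "y \<in> model_cone g"
      have yK: "y \<in> ?K" using y(1) conv x(1) zK closed_segment_subset by blast
      have r: "radial g y > 0" by (rule radial_pos[OF y(2)])
      have "(1 / radial g y) *\<^sub>R y \<in> cell A z"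
        unfolding inn(4) using normalize_in_model_space[OF y(2)] yK r
        by (auto simp: polyhedral_cone_def divide_le_0_iff)
      then have "norm ((1 / radial g y) *\<^sub>R y) \<le> M" by (rule M)
      then show "norm y \<le> M * radial g y" using r by (simp add: pos_divide_le_eq)
    next
      \<comment> \<open>Some normal is strictly negative at \<open>z\<close> and nonpositive at
        \<open>x\<close>, so 0 could only be the end \<open>x\<close>, which is nonzero.\<close>
      show "0 \<notin> closed_segment z x"
      proof
        assume "0 \<in> closed_segment z x"
        then obtain u where u: "0 \<le> u" "u \<le> 1" "0 = (1 - u) *\<^sub>R z + u *\<^sub>R x" by (auto simp: in_segment)
        obtain a where a: "a \<in> ?A" using A(4) by (auto simp: inner_normals_def)
        have "0 = (1 - u) * (a \<bullet> z) + u * (a \<bullet> x)"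
          using arg_cong[OF u(3), of "\<lambda>y. a \<bullet> y"] by (simp add: inner_add_right)
        moreover have "(1 - u) * (a \<bullet> z) \<le> 0" "u * (a \<bullet> x) \<le> 0"
          using u inn(3) a x(1) by (auto simp: polyhedral_cone_def less_imp_le intro!: mult_nonneg_nonpos)
        ultimately have "(1 - u) * (a \<bullet> z) = 0" by linarith
        then have "u = 1" using inn(3) a by auto
        then show False using u(3) x(2) by simp
      qed
    qed
    then show ?thesis using positive_functional[OF False] by (intro exI[of _ "axis None 1"]) auto
  qed
qed

text \<open>The decomposition of pointed cones is applied, with no equations, to each cell of an
  arrangement that includes the normals of \<open>ex_normals\<close>; the results are summed over
  the cells of \<open>P\<close>.\<close>

theorem polytope_simplices:
  assumes "P \<in> L_polytopes g L"
  shows "\<exists>c. (\<forall>vs\<in>Poly_Mapping.keys c. length vs = Suc CARD('n) \<and> set vs \<subseteq> vertices) \<and>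
    (\<forall>\<^sub>F z in generic UNIV. z \<in> model_space g \<longrightarrow>
       frag_eval (\<lambda>vs. of_bool (z \<in> convex_cone hull (set vs))) c = of_bool (z \<in> P))"
proof -
  obtain E where E: "finite E" "E \<subseteq> normals" "E \<noteq> {}" "g = Spherical \<longrightarrow> flat E = {0}"
    using ex_normals by blast
  obtain A where A: "E \<subseteq> A" "finite A" "A \<subseteq> normals" "supports A P"
    using finite_L_polytopes_supports[of "{P}" E] assms E by auto
  have flatA: "g = Spherical \<longrightarrow> flat A = {0}"
  proof
    assume "g = Spherical"
    then have "flat A \<subseteq> {0}" using E(4) A(1) by (auto simp: flat_def)
    moreover have "0 \<in> flat A" by (simp add: flat_def)
    ultimately show "flat A = {0}" by auto
  qed
  let ?good = "\<lambda>Q c. (\<forall>vs\<in>Poly_Mapping.keys c. length vs = Suc CARD('n) \<and> set vs \<subseteq> vertices) \<and>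
    (\<forall>\<^sub>F z in generic UNIV. z \<in> model_space g \<longrightarrow>
       frag_eval (\<lambda>vs. of_bool (z \<in> convex_cone hull (set vs))) c = of_bool (z \<in> Q))"
  have "\<exists>c. ?good Q c" if Q: "Q \<in> cells A P" for Q
  proof -
    obtain z where z: "z \<in> P" "z \<in> off_walls A" "Q = cell A z" using Q by (auto simp: cells_def)
    note inn = inner_normals[OF A(2,3) z(2)]
    obtain l where l: "\<forall>x\<in>polyhedral_cone {} (inner_normals A z). x \<noteq> 0 \<longrightarrow> x \<in> model_cone g \<and> l \<bullet> x > 0"
      using cell_cone_pointed[OF A(4) z(1,2) _ flatA] A(1) E(3) by blast
    have flat0: "flat {} = (UNIV :: (real ^ 'n option) set)" by (simp add: flat_def)
    have "\<exists>c. (\<forall>ys\<in>Poly_Mapping.keys c. length ys = Suc CARD('n) \<and> set ys \<subseteq> vertices \<inter> flat {}) \<and>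
        (\<forall>\<^sub>F x in generic (flat {}).
           frag_eval (\<lambda>ys. of_bool (x \<in> convex_cone hull (set ys))) c
             = of_bool (x \<in> polyhedral_cone {} (inner_normals A z)))"
    proof (rule polyhedral_cone_eq_simplicial_cones[where N = normals and C = "model_cone g" and l = l])
      show "\<exists>t>0. t *\<^sub>R x \<in> vertices"
        if "finite E" "E \<subseteq> normals" "dim (flat E) = 1" "x \<in> flat E" "x \<noteq> 0" "x \<in> model_cone g" for E x
        using vertex_of_flat that by blast
      show "dim (flat {} :: (real ^ 'n option) set) = Suc CARD('n)"
        unfolding flat0 using DIM_eq[where 'n='n] by simp
    qed (use inn(1,2) l in auto)
    then obtain c where c: "\<forall>ys\<in>Poly_Mapping.keys c. length ys = Suc CARD('n) \<and> set ys \<subseteq> vertices"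
      "\<forall>\<^sub>F x in generic UNIV. frag_eval (\<lambda>ys. of_bool (x \<in> convex_cone hull (set ys))) c
             = of_bool (x \<in> polyhedral_cone {} (inner_normals A z))"
      unfolding flat0 by auto
    have "x \<in> polyhedral_cone {} (inner_normals A z) \<longleftrightarrow> x \<in> Q" if "x \<in> model_space g" for x
      using that unfolding z(3) inn(4) by (auto simp: polyhedral_cone_def flat_def)
    then have "\<forall>\<^sub>F x in generic UNIV. x \<in> model_space g \<longrightarrow>
        frag_eval (\<lambda>ys. of_bool (x \<in> convex_cone hull (set ys))) c = of_bool (x \<in> Q)"
      using c(2) by (auto elim!: eventually_mono)
    then show ?thesis using c(1) by blast
  qed
  then have "\<forall>Q\<in>cells A P. \<exists>c. ?good Q c" by blast
  then obtain c where c: "\<forall>Q\<in>cells A P. ?good Q (c Q)" by (rule bchoice[THEN exE])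
  let ?c = "\<Sum>Q\<in>cells A P. c Q"
  have "\<forall>vs\<in>Poly_Mapping.keys ?c. length vs = Suc CARD('n) \<and> set vs \<subseteq> vertices"
  proof
    fix vs assume "vs \<in> Poly_Mapping.keys ?c"
    then have "vs \<in> (\<Union>Q\<in>cells A P. Poly_Mapping.keys (c Q))" by (rule subsetD[OF keys_sum])
    then show "length vs = Suc CARD('n) \<and> set vs \<subseteq> vertices" using c by blast
  qed
  moreover have "\<forall>\<^sub>F z in generic UNIV. \<forall>Q\<in>cells A P. z \<in> model_space g \<longrightarrow>
      frag_eval (\<lambda>vs. of_bool (z \<in> convex_cone hull (set vs))) (c Q) = of_bool (z \<in> Q)"
    using c finite_cells[OF A(2)] by (intro eventually_ball_finite) auto
  then have "\<forall>\<^sub>F z in generic UNIV. z \<in> model_space g \<longrightarrow>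
      frag_eval (\<lambda>vs. of_bool (z \<in> convex_cone hull (set vs))) ?c = of_bool (z \<in> P)"
    using subdivision_eval[OF assms subdivision_cells[OF A(4)]]
    by eventually_elim (simp add: frag_eval_sum)
  ultimately show ?thesis by blast
qed

text \<open>Each facet is spanned by \<open>n\<close> independent vertices and therefore lies in a
  hyperplane of \<open>L\<close>. The resulting normals are, up to negative factors, the dual basis
  of the vertices, so their inequalities say that all coordinates are nonnegative. For boundedness,
  the convex hull of the vertices is compact, avoids the origin and projects radially onto the
  simplex.\<close>

lemma convex_polytope_gsimplex:
  assumes vs: "set vs \<subseteq> vertices" "length vs = Suc CARD('n)" "distinct vs" "independent (set vs)"
  shows "convex_polytope g L (gsimplex g vs)"
  unfolding convex_polytope_iff
proof (intro conjI allI impI)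
  have card: "card (set vs) = Suc CARD('n)" using vs distinct_card by metis
  have sp: "span (set vs) = UNIV"
    using vs(4) card DIM_eq[where 'n='n]
    by (metis UNIV_I card_eq_dim dim_UNIV finite_set order_refl subsetI subset_antisym subset_UNIV)
  have vsC: "set vs \<subseteq> model_cone g" using vs(1) vertices_model_cone by blast
  show "bounded (gsimplex g vs)"
  proof -
    let ?f = "\<lambda>x. (1 / radial g x) *\<^sub>R x"
    have "0 \<notin> convex hull (set vs)"
    proof
      assume "0 \<in> convex hull (set vs)"
      then obtain u where u: "\<forall>x\<in>set vs. 0 \<le> u x" "sum u (set vs) = 1" "(\<Sum>x\<in>set vs. u x *\<^sub>R x) = 0"
        by (auto simp: convex_hull_finite)
      then have "\<forall>x\<in>set vs. u x = 0" using vs(4) independent_explicit_finite_subsets[of "set vs"] by auto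
      then show False using u(2) by simp
    qed
    then have C: "convex hull (set vs) \<subseteq> model_cone g"
      using model_cone_convex_cone_hull[OF vsC] convex_hull_subset_convex_cone_hull[of "set vs"] by blast
    have "compact (?f ` (convex hull (set vs)))"
      using C radial_pos[of _ g]
      by (intro compact_continuous_image continuous_intros continuous_on_subset[OF continuous_radial]
          finite_imp_compact_convex_hull) force+
    then have "bounded (?f ` (convex hull (set vs)))" by (rule compact_imp_bounded)
    moreover have "gsimplex g vs \<subseteq> ?f ` (convex hull (set vs))"
    proof
      fix z assume z: "z \<in> gsimplex g vs"
      have "set vs \<noteq> {}" using card by auto
      then obtain x c where x: "x \<in> convex hull (set vs)" "c \<ge> 0" "z = c *\<^sub>R x"
        using z by (auto simp: gsimplex_def convex_cone_hull_convex_hull_nonempty)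
      have "radial g z = 1" using z by (simp add: gsimplex_def model_space_eq)
      then have "c * radial g x = 1" using x by (simp add: radial_scale)
      then have "c = 1 / radial g x" by (metis mult_zero_right nonzero_eq_divide_eq zero_neq_one)
      then show "z \<in> ?f ` (convex hull (set vs))" using x by auto
    qed
    ultimately show ?thesis by (rule bounded_subset)
  qed
  show "S = model_space g" if S: "geometric_subspace g S \<and> gsimplex g vs \<subseteq> S" for S
  proof -
    obtain V where V: "subspace V" "S = model_space g \<inter> V" using S by (auto simp: geometric_subspace_def)
    have "set vs \<subseteq> gsimplex g vs"
      using vs(1) hull_inc by (fastforce simp: gsimplex_def vertices_def)
    then have "span (set vs) \<subseteq> V" using S V by (intro span_minimal) auto
    then show ?thesis using sp V by auto
  qed
  have "\<exists>a\<in>normals. a \<bullet> (vs ! i) < 0 \<and> (\<forall>j<length vs. j \<noteq> i \<longrightarrow> a \<bullet> (vs ! j) = 0)" if i: "i < length vs" for i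
  proof -
    let ?S = "set vs - {vs ! i}"
    have "independent ?S" by (rule independent_mono[OF vs(4)]) auto
    moreover have "card ?S = CARD('n)" using card i by simp
    ultimately obtain a where a: "a \<in> normals" "span ?S = {x. a \<bullet> x = 0}"
      using normal_of_vertices[of ?S] vs(1) by blast
    have "vs ! i \<notin> span ?S" using vs(4) i by (auto simp: dependent_def)
    then have ai: "a \<bullet> (vs ! i) \<noteq> 0" using a(2) by auto
    have aj: "a \<bullet> (vs ! j) = 0" if "j < length vs" "j \<noteq> i" for j
    proof -
      have "vs ! j \<in> ?S" using that i vs(3) by (simp add: nth_eq_iff_index_eq)
      then have "vs ! j \<in> span ?S" by (rule span_base)
      then show ?thesis using a(2) by simp
    qed
    let ?a = "if a \<bullet> (vs ! i) < 0 then a else - a"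
    show ?thesis using a(1) ai aj normals_minus by (intro bexI[of _ ?a]) auto
  qed
  then have "\<forall>i\<in>{..<length vs}. \<exists>a. a \<in> normals \<and> a \<bullet> (vs ! i) < 0 \<and> (\<forall>j<length vs. j \<noteq> i \<longrightarrow> a \<bullet> (vs ! j) = 0)"
    by blast
  then obtain a where a: "\<forall>i\<in>{..<length vs}. a i \<in> normals \<and> a i \<bullet> (vs ! i) < 0 \<and>
      (\<forall>j<length vs. j \<noteq> i \<longrightarrow> a i \<bullet> (vs ! j) = 0)"
    by (rule bchoice[THEN exE])
  have coord: "a i \<bullet> (\<Sum>j<length vs. c j *\<^sub>R vs ! j) = c i * (a i \<bullet> (vs ! i))" if "i < length vs" for c i
  proof -
    have "a i \<bullet> (\<Sum>j<length vs. c j *\<^sub>R vs ! j) = (\<Sum>j<length vs. c j * (a i \<bullet> (vs ! j)))"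
      by (simp add: inner_sum_right)
    also have "\<dots> = (\<Sum>j\<in>{i}. c j * (a i \<bullet> (vs ! j)))"
      using a that by (intro sum.mono_neutral_right) auto
    finally show ?thesis by simp
  qed
  have "gsimplex g vs = {x \<in> model_space g. \<forall>b\<in>a ` {..<length vs}. b \<bullet> x \<le> 0}"
  proof (intro equalityI subsetI)
    fix x assume "x \<in> gsimplex g vs"
    then obtain c where c: "x \<in> model_space g" "\<forall>i. 0 \<le> c i" "x = (\<Sum>i<length vs. c i *\<^sub>R vs ! i)"
      by (auto simp: gsimplex_def convex_cone_hull_list)
    then show "x \<in> {x \<in> model_space g. \<forall>b\<in>a ` {..<length vs}. b \<bullet> x \<le> 0}"
      using a by (auto simp: coord less_imp_le intro!: mult_nonneg_nonpos)
  next
    fix x assume x: "x \<in> {x \<in> model_space g. \<forall>b\<in>a ` {..<length vs}. b \<bullet> x \<le> 0}"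
    obtain c where c: "x = (\<Sum>i<length vs. c i *\<^sub>R vs ! i)" using sp span_list[of x vs] by auto
    let ?c = "\<lambda>i. if i < length vs then c i else 0"
    have "0 \<le> c i" if "i < length vs" for i
    proof -
      have "c i * (a i \<bullet> (vs ! i)) \<le> 0" using x that by (auto simp: c coord)
      moreover have "a i \<bullet> (vs ! i) < 0" using a that by blast
      ultimately show ?thesis by (auto simp: mult_le_0_iff)
    qed
    then have "(\<forall>i. 0 \<le> ?c i) \<and> x = (\<Sum>i<length vs. ?c i *\<^sub>R vs ! i)" using c by auto
    then have "x \<in> convex_cone hull (set vs)" unfolding convex_cone_hull_list by (rule exI[of _ ?c])
    then show "x \<in> gsimplex g vs" using x by (simp add: gsimplex_def)
  qed
  then show "\<exists>F. finite F \<and> F \<subseteq> normals \<and> gsimplex g vs = {x \<in> model_space g. \<forall>a\<in>F. a \<bullet> x \<le> 0}"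
    using a by (intro exI[of _ "a ` {..<length vs}"]) auto
qed

lemma convex_imp_L_polytope: "convex_polytope g L P \<Longrightarrow> P \<in> L_polytopes g L"
  unfolding L_polytopes_def by (intro CollectI exI[of _ "{P}"]) auto

end

section \<open>Orientations\<close>

text \<open>An arbitrary enumeration of the index type, used to read a list of vectors as a matrix.
  Another enumeration would change all determinants by a common sign, which cancels in the product
  \<open>orient\<close>.\<close>

definition row_index :: "'m::finite \<Rightarrow> nat" where
  "row_index = (SOME f. bij_betw f (UNIV :: 'm set) {..<CARD('m)})"

lemma bij_row_index: "bij_betw row_index (UNIV :: 'm::finite set) {..<CARD('m)}"
proof -
  have "\<exists>f. bij_betw f (UNIV :: 'm set) {..<CARD('m)}"
    using ex_bij_betw_finite_nat[OF finite[of "UNIV :: 'm set"]] by (simp add: atLeast0LessThan)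
  then show ?thesis unfolding row_index_def by (rule someI_ex)
qed

definition list_det :: "(real ^ 'm::finite) list \<Rightarrow> real" where
  "list_det vs = det (\<chi> i. vs ! row_index i)"

lemma list_det_rows:
  fixes as bs :: "(real ^ 'm::finite) list"
  assumes "Suc (length as + length bs) = CARD('m)"
  shows "\<exists>k. \<forall>x. (\<chi> i::'m. (as @ x # bs) ! row_index i) = (\<chi> i. if i = k then x else (as @ 0 # bs) ! row_index i)"
proof -
  have "length as \<in> row_index ` (UNIV :: 'm set)"
    using bij_row_index[where 'm = 'm] assms by (auto simp: bij_betw_def)
  then obtain k :: 'm where k: "row_index k = length as" by (metis imageE)
  have inj: "inj (row_index :: 'm \<Rightarrow> nat)" using bij_row_index[where 'm = 'm] by (simp add: bij_betw_def)
  have "(as @ x # bs) ! row_index i = (if i = k then x else (as @ 0 # bs) ! row_index i)" for x and i :: 'm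
  proof (cases "i = k")
    case True
    then show ?thesis using k by simp
  next
    case False
    then have "row_index i \<noteq> length as" using k injD[OF inj] by metis
    then show ?thesis using False by (simp add: nth_append nth_Cons')
  qed
  then show ?thesis by (intro exI[of _ k]) (simp add: vec_eq_iff)
qed

lemma list_det_nonzero_iff:
  fixes vs :: "(real ^ 'm::finite) list"
  assumes "length vs = CARD('m)"
  shows "list_det vs \<noteq> 0 \<longleftrightarrow> span (set vs) = UNIV"
proof -
  let ?A = "\<chi> i::'m. vs ! row_index i"
  have "rows ?A = range (\<lambda>i::'m. vs ! row_index i)"
    by (auto simp: rows_def row_def vec_lambda_eta)
  also have "\<dots> = (\<lambda>k. vs ! k) ` (row_index ` (UNIV :: 'm set))"
    by (simp add: image_image)
  also have "row_index ` (UNIV :: 'm set) = {..<length vs}"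
    using bij_row_index[where 'm = 'm] assms by (simp add: bij_betw_def)
  also have "(\<lambda>k. vs ! k) ` {..<length vs} = set vs"
    by (auto simp: set_conv_nth)
  finally have "rows ?A = set vs" .
  then show ?thesis
    unfolding list_det_def
    by (metis invertible_det_nz invertible_left_inverse matrix_left_invertible_span_rows)
qed

lemma list_det_volume_form:
  fixes c :: real
  assumes "c \<noteq> 0"
  shows "volume_form (\<lambda>vs :: (real ^ 'm::finite) list. list_det vs * c)"
proof -
  have add: "list_det (as @ (x + y) # bs) = list_det (as @ x # bs) + list_det (as @ y # bs)"
    if l: "Suc (length as + length bs) = CARD('m)" for as bs :: "(real ^ 'm) list" and x y
  proof -
    obtain k where k: "\<And>x. (\<chi> i::'m. (as @ x # bs) ! row_index i) = (\<chi> i. if i = k then x else (as @ 0 # bs) ! row_index i)"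
      using list_det_rows[OF l] by blast
    show ?thesis unfolding list_det_def k by (rule det_row_add)
  qed
  have scale: "list_det (as @ (t *\<^sub>R x) # bs) = t * list_det (as @ x # bs)"
    if l: "Suc (length as + length bs) = CARD('m)" for as bs :: "(real ^ 'm) list" and x t
  proof -
    obtain k where k: "\<And>x. (\<chi> i::'m. (as @ x # bs) ! row_index i) = (\<chi> i. if i = k then x else (as @ 0 # bs) ! row_index i)"
      using list_det_rows[OF l] by blast
    show ?thesis unfolding list_det_def k scalar_mult_eq_scaleR[symmetric] by (rule det_row_mul)
  qed
  have repeat: "list_det (as @ x # x # bs) = 0"
    if "Suc (Suc (length as + length bs)) = CARD('m)" for as bs :: "(real ^ 'm) list" and x
  proof (rule ccontr)
    assume "list_det (as @ x # x # bs) \<noteq> 0"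
    then have "span (set (as @ x # x # bs)) = UNIV" using that by (subst (asm) list_det_nonzero_iff) auto
    then have "dim (set (as @ x # bs)) = CARD('m)" using dim_span[of "set (as @ x # bs)"] by simp
    moreover have "dim (set (as @ x # bs)) \<le> card (set (as @ x # bs))" by (rule dim_le_card') simp
    moreover have "card (set (as @ x # bs)) \<le> length (as @ x # bs)" by (rule card_length)
    ultimately show False using that by simp
  qed
  have swap: "list_det (as @ x # y # bs) = - list_det (as @ y # x # bs)"
    if l: "Suc (Suc (length as + length bs)) = CARD('m)" for as bs :: "(real ^ 'm) list" and x y
  proof -
    \<comment> \<open>Antisymmetry by polarization: the determinant with the row
      \<open>x + y\<close> repeated vanishes.\<close>
    have "list_det (as @ (x + y) # (x + y) # bs)
        = list_det (as @ x # (x + y) # bs) + list_det (as @ y # (x + y) # bs)"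
      using l by (intro add) simp
    moreover have "list_det (as @ x # (x + y) # bs) = list_det (as @ x # x # bs) + list_det (as @ x # y # bs)"
      using add[of "as @ [x]" bs] l by simp
    moreover have "list_det (as @ y # (x + y) # bs) = list_det (as @ y # x # bs) + list_det (as @ y # y # bs)"
      using add[of "as @ [y]" bs] l by simp
    ultimately show ?thesis using repeat[OF l] by simp
  qed
  show ?thesis
  proof
    fix as bs :: "(real ^ 'm) list" and x y :: "real ^ 'm" and t
    {
      assume "Suc (length as + length bs) = DIM(real ^ 'm)"
      then have l: "Suc (length as + length bs) = CARD('m)" by simp
      show "list_det (as @ (x + y) # bs) * c = list_det (as @ x # bs) * c + list_det (as @ y # bs) * c"
        unfolding add[OF l] by (rule distrib_right)
      show "list_det (as @ (t *\<^sub>R x) # bs) * c = t * (list_det (as @ x # bs) * c)"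
        unfolding scale[OF l] by (rule mult.assoc)
    next
      assume "Suc (Suc (length as + length bs)) = DIM(real ^ 'm)"
      then have l: "Suc (Suc (length as + length bs)) = CARD('m)" by simp
      show "list_det (as @ x # y # bs) * c = - (list_det (as @ y # x # bs) * c)"
        by (subst swap[OF l]) (rule minus_mult_left[symmetric])
    }
  next
    fix vs :: "(real ^ 'm) list"
    assume "length vs = DIM(real ^ 'm)"
    then show "list_det vs * c \<noteq> 0 \<longleftrightarrow> span (set vs) = UNIV"
      using list_det_nonzero_iff[of vs] assms by simp
  qed
qed

lemma list_det_map:
  fixes bs :: "(real ^ 'm::finite) list"
  assumes "length bs = CARD('m)" "linear f"
  shows "list_det (map f bs) = det (matrix f) * list_det bs"
proof -
  have "row_index i < length bs" for i :: 'm
    using bij_row_index[where 'm = 'm] assms(1) by (auto simp: bij_betw_def)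
  then have "(\<chi> i::'m. map f bs ! row_index i) = (\<chi> i. bs ! row_index i) ** transpose (matrix f)"
    using fun_cong[OF matrix_vector_mul(2)[OF assms(2)], symmetric]
    by (simp add: vec_eq_iff matrix_matrix_mult_def transpose_def)
      (simp add: matrix_vector_mult_def mult.commute)
  then show ?thesis by (simp add: list_det_def det_mul)
qed

lemma ordered_basis_det:
  fixes b :: "(real ^ 'n::finite option) list"
  assumes "ordered_basis b"
  shows "length b = Suc CARD('n)" "list_det b \<noteq> 0"
proof -
  have b: "distinct b" "independent (set b)" "span (set b) = UNIV" using assms by (auto simp: ordered_basis_def)
  have "length b = card (set b)" using b(1) distinct_card by metis
  also have "\<dots> = dim (UNIV :: (real ^ 'n option) set)"
    using b(2,3) dim_span dim_eq_card_independent by metis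
  finally show l: "length b = Suc CARD('n)" using DIM_eq[where 'n = 'n] by simp
  show "list_det b \<noteq> 0" using list_det_nonzero_iff[of b] l b(3) by (simp add: card_option)
qed

text \<open>A linear map multiplies \<open>list_det\<close> by its determinant, so agreement of
  orientations becomes the sign of a product of two determinants. For the converse the map is
  prescribed on the basis \<open>b\<close>.\<close>

lemma agrees_with_orientation_iff:
  fixes b :: "(real ^ 'n::finite option) list"
  assumes "ordered_basis b"
  shows "agrees_with_orientation b vs \<longleftrightarrow> length vs = Suc CARD('n) \<and> list_det vs * list_det b > 0"
proof
  note b = ordered_basis_det[OF assms]
  have lb: "length b = CARD('n option)" using b(1) by (simp add: card_option)
  have sq: "list_det b * list_det b > 0" using b(2) by (simp flip: power2_eq_square)
  {
    assume "agrees_with_orientation b vs"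
    then obtain f where f: "linear f" "det (matrix f) > 0" "vs = map f b"
      by (auto simp: agrees_with_orientation_def)
    have "list_det vs * list_det b = det (matrix f) * (list_det b * list_det b)"
      unfolding f(3) list_det_map[OF lb f(1)] by simp
    also have "\<dots> > 0" using f(2) sq by (rule mult_pos_pos)
    finally show "length vs = Suc CARD('n) \<and> list_det vs * list_det b > 0" using f(3) b(1) by simp
  next
    assume vs: "length vs = Suc CARD('n) \<and> list_det vs * list_det b > 0"
    have ind: "distinct b" "independent (set b)" using assms by (auto simp: ordered_basis_def)
    obtain f where f: "linear f" "\<forall>x\<in>set b. f x = the (map_of (zip b vs) x)"
      using linear_independent_extend[OF ind(2), of "\<lambda>x. the (map_of (zip b vs) x)"] by auto
    have m: "vs = map f b"
    proof (rule nth_equalityI)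
      fix i assume i: "i < length vs"
      then have "map_of (zip b vs) (b ! i) = Some (vs ! i)"
        using map_of_zip_nth[of b vs i] ind(1) vs b(1) by simp
      then show "vs ! i = map f b ! i" using f(2) i vs b(1) by simp
    qed (use vs b(1) in simp)
    have "list_det vs * list_det b = det (matrix f) * (list_det b * list_det b)"
      unfolding m list_det_map[OF lb f(1)] by simp
    then have "0 < det (matrix f) * (list_det b * list_det b)" using vs by (simp only:)
    then have "det (matrix f) > 0" using sq by (simp only: zero_less_mult_pos2)
    then show "agrees_with_orientation b vs" using f(1) m by (auto simp: agrees_with_orientation_def)
  }
qed

section \<open>Signed simplices and their tuples\<close>

locale oriented_collection = generated_collection g L
  for g and L :: "(real ^ 'n::finite option) set set" +
  fixes b :: "(real ^ 'n option) list"
  assumes basis: "ordered_basis b"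
begin

definition orient :: "(real ^ 'n option) list \<Rightarrow> real" where
  "orient vs = list_det vs * list_det b"

sublocale volume_form orient
  unfolding orient_def [abs_def] by (rule list_det_volume_form[OF ordered_basis_det(2)[OF basis]])

definition vertex_lists :: "(real ^ 'n option) list set" where
  "vertex_lists = {vs. length vs = Suc CARD('n) \<and> set vs \<subseteq> vertices}"

text \<open>Lists of negative orientation count negatively and degenerate ones as 0. With these
  signs the alternating relations hold up to negligible combinations whenever all vertices lie in an
  open half-space.\<close>

definition simplex_frag :: "(real ^ 'n option) list \<Rightarrow> (real ^ 'n option) set \<Rightarrow>\<^sub>0 int" where
  "simplex_frag vs = frag_cmul (isgn (orient vs)) (frag_of (gsimplex g vs))"

text \<open>\<open>poly_frag\<close> and \<open>tuple_frag\<close> are the two images of a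
  combination of vertex lists, as polytopes and as tuples of points. Modulo relations both are onto,
  and the canonical map sends the class of \<open>poly_frag c\<close> to that of
  \<open>tuple_frag c\<close>; everything reduces to comparing their kernels.\<close>

definition poly_frag :: "((real ^ 'n option) list \<Rightarrow>\<^sub>0 int) \<Rightarrow> (real ^ 'n option) set \<Rightarrow>\<^sub>0 int" where
  "poly_frag = frag_extend simplex_frag"

definition tuple_frag :: "((real ^ 'n option) list \<Rightarrow>\<^sub>0 int) \<Rightarrow> (real ^ 'n option) set list \<Rightarrow>\<^sub>0 int" where
  "tuple_frag = frag_extend (\<lambda>vs. frag_of (map (point_of g) vs))"

lemma orient_nonzero:
  assumes "length vs = Suc CARD('n)" "orient vs \<noteq> 0"
  shows "distinct vs" "independent (set vs)"
  using nonzero_independent[of vs] assms DIM_eq[where 'n = 'n] by auto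

lemma orient_eq_0:
  assumes "length vs = Suc CARD('n)" "dim (set vs) < Suc CARD('n)"
  shows "orient vs = 0"
proof (rule ccontr)
  assume "orient vs \<noteq> 0"
  then have "span (set vs) = UNIV" using nonzero_iff[of vs] assms DIM_eq[where 'n = 'n] by simp
  then have "dim (set vs) = Suc CARD('n)" using dim_span[of "set vs"] DIM_eq[where 'n = 'n] by simp
  then show False using assms(2) by simp
qed

lemma gsimplex_L_polytope:
  assumes "vs \<in> vertex_lists" "orient vs \<noteq> 0"
  shows "gsimplex g vs \<in> L_polytopes g L"
  using assms orient_nonzero[of vs]
  by (intro convex_imp_L_polytope convex_polytope_gsimplex) (auto simp: vertex_lists_def)

lemma keys_simplex_frag:
  assumes "vs \<in> vertex_lists"
  shows "Poly_Mapping.keys (simplex_frag vs) \<subseteq> L_polytopes g L"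
  using gsimplex_L_polytope[OF assms] by (auto simp: simplex_frag_def)

lemma keys_poly_frag:
  assumes "Poly_Mapping.keys c \<subseteq> vertex_lists"
  shows "Poly_Mapping.keys (poly_frag c) \<subseteq> L_polytopes g L"
  unfolding poly_frag_def
  using keys_frag_extend[of simplex_frag c] keys_simplex_frag assms by blast

lemma eval_poly_frag:
  assumes "z \<in> model_space g"
  shows "frag_eval (\<lambda>P. of_bool (z \<in> P)) (poly_frag c) = frag_eval (cone_sign [] z) c"
  unfolding poly_frag_def frag_eval_extend
  by (rule frag_eval_cong) (use assms in \<open>simp add: simplex_frag_def frag_eval_cmul cone_sign_def gsimplex_def\<close>)

lemma poly_frag_diff: "poly_frag (c - d) = poly_frag c - poly_frag d"
  by (simp add: poly_frag_def frag_extend_diff)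

lemma poly_frag_add: "poly_frag (c + d) = poly_frag c + poly_frag d"
  by (simp add: poly_frag_def frag_extend_add)

lemma tuple_frag_diff: "tuple_frag (c - d) = tuple_frag c - tuple_frag d"
  by (simp add: tuple_frag_def frag_extend_diff)

lemma tuple_frag_add: "tuple_frag (c + d) = tuple_frag c + tuple_frag d"
  by (simp add: tuple_frag_def frag_extend_add)

section \<open>The group of tuples\<close>

lemma tuples_eq: "tuples L m = {map (point_of g) vs | vs. length vs = m \<and> set vs \<subseteq> vertices}"
proof (intro equalityI subsetI)
  fix As assume "As \<in> tuples L m"
  then have As: "length As = m" "set As \<subseteq> points L" by (auto simp: tuples_def)
  then have "\<forall>A\<in>set As. \<exists>v. v \<in> vertices \<and> point_of g v = A" using point_lift by blast
  then obtain f where f: "\<forall>A\<in>set As. f A \<in> vertices \<and> point_of g (f A) = A" by (rule bchoice[THEN exE])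
  then have "map (point_of g) (map f As) = As" by (simp add: map_idI)
  then show "As \<in> {map (point_of g) vs | vs. length vs = m \<and> set vs \<subseteq> vertices}"
    using As(1) f by (intro CollectI exI[of _ "map f As"]) auto
qed (auto simp: tuples_def vertices_def)

lemma Ls_relations_eq: "Ls_relations g L = tuple_relations (point_of g) vertices (Suc CARD('n))"
proof -
  have "{frag_of ys | ys. ys \<in> tuples L (CARD('n) + 1) \<and> degenerate g ys}
      = {frag_of (map (point_of g) vs) | vs. length vs = Suc CARD('n) \<and> set vs \<subseteq> vertices \<and> dim (set vs) < Suc CARD('n)}"
    (is "?A = ?B")
  proof (intro equalityI subsetI)
    fix r assume "r \<in> ?A"
    then obtain ys where ys: "r = frag_of ys" "ys \<in> tuples L (CARD('n) + 1)" "degenerate g ys" by blast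
    then obtain vs where "ys = map (point_of g) vs" "length vs = Suc CARD('n)" "set vs \<subseteq> vertices"
      unfolding tuples_eq by auto
    then show "r \<in> ?B" using ys degenerate_iff[of vs] by blast
  next
    fix r assume "r \<in> ?B"
    then obtain vs where vs: "r = frag_of (map (point_of g) vs)" "length vs = Suc CARD('n)" "set vs \<subseteq> vertices"
      "dim (set vs) < Suc CARD('n)" by blast
    then have "map (point_of g) vs \<in> tuples L (CARD('n) + 1)" unfolding tuples_eq by auto
    then show "r \<in> ?A" using vs degenerate_iff[of vs] by blast
  qed
  moreover have "{(\<Sum>i = 0..CARD('n) + 1. frag_cmul ((-1) ^ i) (frag_of (omit i ys))) | ys. ys \<in> tuples L (CARD('n) + 2)}
      = {(\<Sum>i<Suc (Suc CARD('n)). frag_cmul ((- 1) ^ i) (frag_of (omit i (map (point_of g) vs)))) | vs.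
          length vs = Suc (Suc CARD('n)) \<and> set vs \<subseteq> vertices}"
    (is "?A = ?B")
  proof (intro equalityI subsetI)
    have eq: "{0..CARD('n) + 1} = {..<Suc (Suc CARD('n))}" by auto
    fix r
    {
      assume "r \<in> ?A"
      then obtain ys where ys: "r = (\<Sum>i = 0..CARD('n) + 1. frag_cmul ((-1) ^ i) (frag_of (omit i ys)))"
        "ys \<in> tuples L (CARD('n) + 2)" by blast
      from ys(2) obtain vs where vs: "ys = map (point_of g) vs" "length vs = Suc (Suc CARD('n))" "set vs \<subseteq> vertices"
        unfolding tuples_eq by auto
      show "r \<in> ?B" unfolding ys(1) vs(1) eq by (intro CollectI exI[of _ vs] conjI refl vs(2,3))
    next
      assume "r \<in> ?B"
      then obtain vs where vs: "length vs = Suc (Suc CARD('n))" "set vs \<subseteq> vertices"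
        "r = (\<Sum>i<Suc (Suc CARD('n)). frag_cmul ((- 1) ^ i) (frag_of (omit i (map (point_of g) vs))))"
        by blast
      from vs(1,2) have "map (point_of g) vs \<in> tuples L (CARD('n) + 2)" unfolding tuples_eq by auto
      then show "r \<in> ?A" unfolding vs(3) eq by (intro CollectI exI[of _ "map (point_of g) vs"] conjI refl)
    }
  qed
  ultimately show ?thesis unfolding Ls_relations_def tuple_relations_def by (simp only:)
qed

lemma Ls_relations_carrier: "Ls_relations g L \<subseteq> carrier (free_Abelian_group (tuples L (CARD('n) + 1)))"
proof
  fix r assume "r \<in> Ls_relations g L"
  then consider ys where "r = frag_of ys" "ys \<in> tuples L (CARD('n) + 1)"
    | ys where "r = (\<Sum>i = 0..CARD('n) + 1. frag_cmul ((-1) ^ i) (frag_of (omit i ys)))" "ys \<in> tuples L (CARD('n) + 2)"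
    unfolding Ls_relations_def by blast
  then show "r \<in> carrier (free_Abelian_group (tuples L (CARD('n) + 1)))"
  proof cases
    case 1
    then show ?thesis by (simp add: keys_frag_of)
  next
    case 2
    have "omit i ys \<in> tuples L (CARD('n) + 1)" if "i \<in> {0..CARD('n) + 1}" for i
      using 2(2) that set_omit_subset[of i ys] by (auto simp: tuples_def)
    then have "Poly_Mapping.keys (frag_cmul ((-1) ^ i) (frag_of (omit i ys))) \<subseteq> tuples L (CARD('n) + 1)"
      if "i \<in> {0..CARD('n) + 1}" for i
      using that keys_cmul[of "(-1) ^ i" "frag_of (omit i ys)"] by (auto simp: keys_frag_of)
    then show ?thesis unfolding 2(1) by (intro sum_closed_free_Abelian_group) simp
  qed
qed

lemma Ls_null_eq: "Ls_null g L = zmod.span (tuple_relations (point_of g) vertices (Suc CARD('n)))"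
  unfolding Ls_null_def generate_free_Abelian_group[OF Ls_relations_carrier]
  by (simp only: Ls_relations_eq)

lemma keys_tuple_frag:
  assumes "Poly_Mapping.keys c \<subseteq> vertex_lists"
  shows "Poly_Mapping.keys (tuple_frag c) \<subseteq> tuples L (CARD('n) + 1)"
proof
  fix As assume "As \<in> Poly_Mapping.keys (tuple_frag c)"
  then have "As \<in> (\<Union>vs\<in>Poly_Mapping.keys c. Poly_Mapping.keys (frag_of (map (point_of g) vs)))"
    unfolding tuple_frag_def by (rule subsetD[OF keys_frag_extend])
  then obtain vs where "vs \<in> Poly_Mapping.keys c" "As = map (point_of g) vs" by (auto simp: keys_frag_of)
  then show "As \<in> tuples L (CARD('n) + 1)"
    unfolding tuples_eq using assms by (auto simp: vertex_lists_def)
qed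

section \<open>Chains of simplices with the same indicator function\<close>

text \<open>Exceptional sets are linear subspaces and hence invariant under scaling, so a generic
  property of the model space carries over to the cone over it.\<close>

lemma generic_model_space:
  assumes "\<forall>\<^sub>F z in generic UNIV. z \<in> model_space g \<longrightarrow> P z"
  shows "\<forall>\<^sub>F z in generic UNIV. z \<in> model_cone g \<longrightarrow> P ((1 / radial g z) *\<^sub>R z)"
proof -
  obtain \<B> where \<B>: "finite \<B>" "\<forall>B\<in>\<B>. subspace B \<and> \<not> UNIV \<subseteq> B" "\<forall>z\<in>UNIV. z \<notin> \<Union>\<B> \<longrightarrow> z \<in> model_space g \<longrightarrow> P z"
    using assms unfolding eventually_generic by blast
  have "z \<in> model_cone g \<longrightarrow> P ((1 / radial g z) *\<^sub>R z)" if "z \<notin> \<Union>\<B>" for z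
  proof
    assume z: "z \<in> model_cone g"
    have "(1 / radial g z) *\<^sub>R z \<notin> \<Union>\<B>"
      using that radial_pos[OF z] \<B>(2) by (auto simp: scale_mem_subspace_iff)
    then show "P ((1 / radial g z) *\<^sub>R z)" using \<B>(3) normalize_in_model_space[OF z] by blast
  qed
  then show ?thesis unfolding eventually_generic using \<B>(1,2) by (intro exI[of _ \<B>]) auto
qed

text \<open>This makes the canonical map well defined. Vanishing at generic points of the model
  space extends to the model cone by scaling, and off the model cone no nonzero vector lies in a
  cone over vertices; so \<open>tuple_relations_if_cone_sign_eq_0\<close> applies to the whole
  space.\<close>

theorem tuple_frag_null:
  assumes c: "Poly_Mapping.keys c \<subseteq> vertex_lists" and neg: "negligible_frag (poly_frag c)"
  shows "tuple_frag c \<in> Ls_null g L"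
proof -
  have "\<forall>\<^sub>F z in generic UNIV. z \<in> model_space g \<longrightarrow> frag_eval (cone_sign [] z) c = 0"
    using neg unfolding negligible_frag_def by eventually_elim (simp add: eval_poly_frag)
  then have "\<forall>\<^sub>F z in generic UNIV. z \<in> model_cone g \<longrightarrow> frag_eval (cone_sign [] ((1 / radial g z) *\<^sub>R z)) c = 0"
    by (rule generic_model_space)
  moreover have "\<forall>\<^sub>F z :: real ^ 'n option in generic UNIV. z \<in> UNIV \<and> z \<notin> {0}"
  proof (rule generic_subspace)
    show "\<not> (UNIV :: (real ^ 'n option) set) \<subseteq> {0}"
      using dim_subset[of UNIV "{0 :: real ^ 'n option}"] DIM_eq[where 'n = 'n] by auto
  qed (rule subspace_single_0)
  ultimately have ev: "\<forall>\<^sub>F z in generic UNIV. frag_eval (cone_sign [] z) c = 0"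
  proof eventually_elim
    case (elim z)
    show ?case
    proof (cases "z \<in> model_cone g")
      case True
      let ?t = "1 / radial g z"
      have t: "?t > 0" using radial_pos[OF True] by simp
      have "cone_sign [] (?t *\<^sub>R z) vs = cone_sign [] z vs" for vs
      proof -
        have "?t *\<^sub>R z \<in> convex_cone hull (set vs) \<longleftrightarrow> z \<in> convex_cone hull (set vs)"
          using t convex_cone_hull_mul[of z "set vs" ?t] convex_cone_hull_mul[of "?t *\<^sub>R z" "set vs" "1 / ?t"] by auto
        then show ?thesis by (simp add: cone_sign_def)
      qed
      then have "cone_sign [] (?t *\<^sub>R z) = cone_sign [] z" by (rule ext)
      then show ?thesis using elim(1) True by simp
    next
      case False
      have "cone_sign [] z vs = 0" if "vs \<in> Poly_Mapping.keys c" for vs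
      proof -
        have "set vs \<subseteq> model_cone g" using c that vertices_model_cone by (auto simp: vertex_lists_def)
        then have "z \<notin> convex_cone hull (set vs)"
          using model_cone_convex_cone_hull[of "set vs" g z] elim(2) False by auto
        then show ?thesis by (simp add: cone_sign_def)
      qed
      then show ?thesis by (simp add: frag_eval_def)
    qed
  qed
  have "frag_extend (\<lambda>ys. frag_of (map (point_of g) ys)) c
      \<in> zmod.span (tuple_relations (point_of g) (vertices \<inter> UNIV) (Suc CARD('n)))"
  proof (rule tuple_relations_if_cone_sign_eq_0[OF _ _ _ _ _ _ ev])
    show "\<exists>p'\<in>vertices. point_of g p' = point_of g p \<and> (p' = p \<or> p' = - p) \<and> (\<exists>l. \<forall>y\<in>set (p' # ys). l \<bullet> y > 0)"
      if "p \<in> vertices" "set ys \<subseteq> vertices" "distinct ys" "independent (set ys)" for p ys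
      using independent_lift that by blast
  qed (use c DIM_eq[where 'n = 'n] in \<open>auto simp: vertex_lists_def\<close>)
  then show ?thesis by (simp add: Ls_null_eq tuple_frag_def)
qed

lemma ex_poly_frag_polytope:
  assumes "P \<in> L_polytopes g L"
  shows "\<exists>c. Poly_Mapping.keys c \<subseteq> vertex_lists \<and> negligible_frag (frag_of P - poly_frag c)"
proof -
  obtain c where c: "\<forall>vs\<in>Poly_Mapping.keys c. length vs = Suc CARD('n) \<and> set vs \<subseteq> vertices"
    "\<forall>\<^sub>F z in generic UNIV. z \<in> model_space g \<longrightarrow>
       frag_eval (\<lambda>vs. of_bool (z \<in> convex_cone hull (set vs))) c = of_bool (z \<in> P)"
    using polytope_simplices[OF assms] by blast
  \<comment> \<open>\<open>poly_frag\<close> multiplies by the sign of the orientation, so this sign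
    is put in once more. Its square is 1 unless the list is degenerate, and then the cone lies in a
    proper subspace.\<close>
  let ?c = "frag_extend (\<lambda>vs. frag_cmul (isgn (orient vs)) (frag_of vs)) c"
  have keys: "Poly_Mapping.keys ?c \<subseteq> vertex_lists"
    using keys_frag_extend[of "\<lambda>vs. frag_cmul (isgn (orient vs)) (frag_of vs)" c] c(1)
    by (fastforce simp: vertex_lists_def split: if_splits)
  have "\<forall>\<^sub>F z in generic UNIV. isgn (orient vs) * cone_sign [] z vs = of_bool (z \<in> convex_cone hull (set vs))"
    if vs: "vs \<in> Poly_Mapping.keys c" for vs
  proof (cases "orient vs = 0")
    case True
    then have "span (set vs) \<noteq> UNIV" using nonzero_iff[of vs] c(1) vs DIM_eq[where 'n = 'n] by auto
    then have "\<forall>\<^sub>F z in generic UNIV. z \<in> UNIV \<and> z \<notin> span (set vs)"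
      by (intro generic_subspace) (auto simp: subspace_span)
    then show ?thesis
    proof eventually_elim
      case (elim z)
      have "convex_cone hull (set vs) \<subseteq> span (set vs)"
        by (intro hull_minimal convex_cone_span span_superset)
      then show ?case using True elim by (auto simp: cone_sign_def)
    qed
  next
    case False
    then show ?thesis by (intro always_eventually) (auto simp: cone_sign_def isgn_def)
  qed
  then have "\<forall>\<^sub>F z in generic UNIV. \<forall>vs\<in>Poly_Mapping.keys c.
      isgn (orient vs) * cone_sign [] z vs = of_bool (z \<in> convex_cone hull (set vs))"
    by (intro eventually_ball_finite) auto
  then have "negligible_frag (frag_of P - poly_frag ?c)"
    using c(2) unfolding negligible_frag_def
  proof (eventually_elim, intro impI)
    fix z assume z: "\<forall>vs\<in>Poly_Mapping.keys c. isgn (orient vs) * cone_sign [] z vs = of_bool (z \<in> convex_cone hull (set vs))"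
      "z \<in> model_space g \<longrightarrow> frag_eval (\<lambda>vs. of_bool (z \<in> convex_cone hull (set vs))) c = of_bool (z \<in> P)"
      "z \<in> model_space g"
    have "frag_eval (cone_sign [] z) ?c = frag_eval (\<lambda>vs. of_bool (z \<in> convex_cone hull (set vs))) c"
      unfolding frag_eval_extend using z(1) by (intro frag_eval_cong) (simp add: frag_eval_cmul)
    then show "frag_eval (\<lambda>P. of_bool (z \<in> P)) (frag_of P - poly_frag ?c) = 0"
      using z(2,3) by (simp add: frag_eval_diff eval_poly_frag)
  qed
  then show ?thesis using keys by blast
qed

lemma ex_poly_frag:
  assumes "Poly_Mapping.keys \<xi> \<subseteq> L_polytopes g L"
  shows "\<exists>c. Poly_Mapping.keys c \<subseteq> vertex_lists \<and> \<xi> - poly_frag c \<in> Pt_null g L"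
proof -
  have "\<forall>P\<in>L_polytopes g L. \<exists>c. Poly_Mapping.keys c \<subseteq> vertex_lists \<and> negligible_frag (frag_of P - poly_frag c)"
    using ex_poly_frag_polytope by blast
  then obtain f where f: "\<forall>P\<in>L_polytopes g L. Poly_Mapping.keys (f P) \<subseteq> vertex_lists \<and>
      negligible_frag (frag_of P - poly_frag (f P))"
    by (rule bchoice[THEN exE])
  have "frag_of P - poly_frag (f P) \<in> zmod.span (Pt_relations g L)" if "P \<in> Poly_Mapping.keys \<xi>" for P
  proof -
    have P: "P \<in> L_polytopes g L" using that assms by auto
    have "Poly_Mapping.keys (frag_of P - poly_frag (f P)) \<subseteq> L_polytopes g L"
      using keys_diff[of "frag_of P" "poly_frag (f P)"] P keys_poly_frag[of "f P"] f by (auto simp: keys_frag_of)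
    then show ?thesis using Pt_null_iff f P Pt_null_eq by blast
  qed
  then have "frag_extend (\<lambda>P. frag_of P - poly_frag (f P)) \<xi> \<in> zmod.span (Pt_relations g L)"
    by (rule frag_extend_in_span)
  then have "\<xi> - poly_frag (frag_extend f \<xi>) \<in> Pt_null g L"
    unfolding frag_extend_fun_diff Pt_null_eq
    using frag_expansion[of \<xi>] by (simp add: poly_frag_def frag_extend_extend)
  moreover have "Poly_Mapping.keys (frag_extend f \<xi>) \<subseteq> vertex_lists"
    using keys_frag_extend[of f \<xi>] f assms by blast
  ultimately show ?thesis by blast
qed

end

section \<open>Joins with antipodal points\<close>

text \<open>The join splits into two halves, one for \<open>x\<close> and one for
  \<open>- x\<close>. As neither vector lies in the span of \<open>vs\<close>, no segment of the
  join passes through the origin, and each half is the simplex with one more vertex.\<close>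

lemma antipodal_join_eq:
  fixes x :: "real ^ 'n::finite option"
  assumes "norm x = 1" "x \<notin> span (set vs)" "vs \<noteq> []" "\<forall>v\<in>set vs. norm v = 1"
  shows "antipodal_join x (gsimplex Spherical vs) = gsimplex Spherical (x # vs) \<union> gsimplex Spherical ((- x) # vs)"
proof -
  let ?Q = "gsimplex Spherical vs"
  have Qspan: "?Q \<subseteq> span (set vs)"
  proof -
    have "convex_cone hull (set vs) \<subseteq> span (set vs)"
      by (intro hull_minimal convex_cone_span span_superset)
    then show ?thesis by (auto simp: gsimplex_def)
  qed
  have one: "{sgn ((1 - t) *\<^sub>R y + t *\<^sub>R p) | t p. t \<in> {0..1} \<and> p \<in> ?Q} = gsimplex Spherical (y # vs)"
    if y: "norm y = 1" "y \<notin> span (set vs)" for y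
  proof (intro equalityI subsetI)
    fix z assume "z \<in> {sgn ((1 - t) *\<^sub>R y + t *\<^sub>R p) | t p. t \<in> {0..1} \<and> p \<in> ?Q}"
    then obtain t p where z: "z = sgn ((1 - t) *\<^sub>R y + t *\<^sub>R p)" "0 \<le> t" "t \<le> 1" "p \<in> ?Q" by auto
    let ?w = "(1 - t) *\<^sub>R y + t *\<^sub>R p"
    have "?w \<noteq> 0"
    proof
      assume w0: "?w = 0"
      have "t = 1"
      proof (rule ccontr)
        assume "t \<noteq> 1"
        have "(1 - t) *\<^sub>R y = - (t *\<^sub>R p)" using w0 by (simp add: eq_neg_iff_add_eq_0)
        then have "(1 / (1 - t)) *\<^sub>R (1 - t) *\<^sub>R y \<in> span (set vs)"
          using Qspan z(4) by (auto intro!: span_scale span_neg simp del: scaleR_scaleR)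
        then show False using \<open>t \<noteq> 1\<close> y(2) by simp
      qed
      then show False using w0 z(4) by (auto simp: gsimplex_def)
    qed
    have "?w \<in> convex_cone hull (insert y (set vs))"
      using z by (intro convex_cone_hull_add convex_cone_hull_mul)
        (auto simp: gsimplex_def intro: hull_inc subsetD[OF hull_mono, rotated])
    then have "(1 / norm ?w) *\<^sub>R ?w \<in> convex_cone hull (insert y (set vs))"
      by (intro convex_cone_hull_mul) auto
    then have "z \<in> convex_cone hull (set (y # vs))"
      unfolding z(1) sgn_div_norm by (simp add: inverse_eq_divide)
    moreover have "norm z = 1" unfolding z(1) using \<open>?w \<noteq> 0\<close> by (simp add: norm_sgn)
    ultimately show "z \<in> gsimplex Spherical (y # vs)" by (simp add: gsimplex_def)
  next
    fix z assume "z \<in> gsimplex Spherical (y # vs)"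
    then obtain a where z: "norm z = 1" "a \<ge> 0" "z - a *\<^sub>R y \<in> convex_cone hull (set vs)"
      by (auto simp: gsimplex_def mem_convex_cone_hull_insert)
    define q where "q = z - a *\<^sub>R y"
    show "z \<in> {sgn ((1 - t) *\<^sub>R y + t *\<^sub>R p) | t p. t \<in> {0..1} \<and> p \<in> ?Q}"
    proof (cases "q = 0")
      case True
      then have "z = a *\<^sub>R y" by (simp add: q_def)
      then have "a = 1" using z y by auto
      then have "z = sgn ((1 - 0) *\<^sub>R y + 0 *\<^sub>R hd vs)" using \<open>z = a *\<^sub>R y\<close> y by (simp add: sgn_div_norm)
      moreover have "hd vs \<in> ?Q" using assms(3,4) by (auto simp: gsimplex_def intro: hull_inc)
      ultimately show ?thesis by force
    next
      case False
      let ?r = "norm q" and ?p = "(1 / norm q) *\<^sub>R q"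
      have r: "?r > 0" using False by simp
      have p: "?p \<in> ?Q"
        using z(3) False by (auto simp: gsimplex_def q_def[symmetric] intro!: convex_cone_hull_mul)
      \<comment> \<open>With \<open>z = a y + q\<close>, this weight makes the point on the segment
        from \<open>y\<close> to the normalized \<open>q\<close> equal to
        \<open>z / (a + norm q)\<close>.\<close>
      let ?t = "?r / (a + ?r)"
      have ar: "a + ?r > 0" by (rule add_nonneg_pos[OF z(2) r])
      have "?t \<le> 1" unfolding divide_le_eq_1_pos[OF ar] using z(2) by simp
      moreover have "0 \<le> ?t" using r ar by (intro divide_nonneg_pos) simp_all
      ultimately have t: "0 \<le> ?t" "?t \<le> 1" by simp_all
      have "(1 - ?t) *\<^sub>R y + ?t *\<^sub>R ?p = (1 / (a + ?r)) *\<^sub>R z"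
      proof -
        have "1 - ?t = (1 / (a + ?r)) * a" using ar by (simp add: field_simps)
        moreover have "?t *\<^sub>R ?p = (1 / (a + ?r)) *\<^sub>R q" using r by simp
        ultimately have "(1 - ?t) *\<^sub>R y + ?t *\<^sub>R ?p = (1 / (a + ?r)) *\<^sub>R (a *\<^sub>R y + q)"
          by (simp only: scaleR_add_right scaleR_scaleR)
        then show ?thesis by (simp add: q_def)
      qed
      then have "sgn ((1 - ?t) *\<^sub>R y + ?t *\<^sub>R ?p) = sgn z" using ar by (simp add: sgn_scaleR)
      also have "sgn z = z" using z(1) by (simp add: sgn_div_norm)
      finally have "z = sgn ((1 - ?t) *\<^sub>R y + ?t *\<^sub>R ?p)" by simp
      then show ?thesis using t p by (intro CollectI exI[of _ ?t] exI[of _ ?p]) auto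
    qed
  qed
  have "antipodal_join x ?Q = {sgn ((1 - t) *\<^sub>R x + t *\<^sub>R p) | t p. t \<in> {0..1} \<and> p \<in> ?Q}
      \<union> {sgn ((1 - t) *\<^sub>R (- x) + t *\<^sub>R p) | t p. t \<in> {0..1} \<and> p \<in> ?Q}"
    unfolding antipodal_join_def by blast
  moreover have "- x \<notin> span (set vs)" using assms(2) span_neg[of "- x" "set vs"] by auto
  ultimately show ?thesis using one[of x] one[of "- x"] assms(1,2) by simp
qed

context oriented_collection
begin

definition join_lists :: "((real ^ 'n option) \<times> (real ^ 'n option) list) set" where
  "join_lists = {(x, vs). x # vs \<in> vertex_lists \<and> orient (x # vs) \<noteq> 0}"

lemma gspan_gsimplex:
  assumes "set vs \<subseteq> model_space g"
  shows "gspan g (gsimplex g vs) = model_space g \<inter> span (set vs)"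
proof
  have "convex_cone hull (set vs) \<subseteq> span (set vs)"
    by (intro hull_minimal convex_cone_span span_superset)
  then have "gsimplex g vs \<subseteq> model_space g \<inter> span (set vs)" by (auto simp: gsimplex_def)
  moreover have "geometric_subspace g (model_space g \<inter> span (set vs))"
    by (auto simp: geometric_subspace_def intro: subspace_span)
  ultimately show "gspan g (gsimplex g vs) \<subseteq> model_space g \<inter> span (set vs)"
    unfolding gspan_def by (intro Inter_lower) simp
  have vs: "set vs \<subseteq> gsimplex g vs" using assms by (auto simp: gsimplex_def intro: hull_inc)
  show "model_space g \<inter> span (set vs) \<subseteq> gspan g (gsimplex g vs)"
    unfolding gspan_def
  proof (intro Inter_greatest, elim CollectE conjE)
    fix A assume A: "geometric_subspace g A" "gsimplex g vs \<subseteq> A"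
    then obtain V where V: "subspace V" "A = model_space g \<inter> V" by (auto simp: geometric_subspace_def)
    have "span (set vs) \<subseteq> V" using A(2) V vs by (intro span_minimal) auto
    then show "model_space g \<inter> span (set vs) \<subseteq> A" using V by auto
  qed
qed

lemma orient_Cons_nonzero:
  assumes "length (x # vs) = Suc CARD('n)"
  shows "orient (x # vs) \<noteq> 0 \<longleftrightarrow> distinct vs \<and> independent (set vs) \<and> x \<notin> span (set vs)"
proof
  assume "orient (x # vs) \<noteq> 0"
  then have d: "distinct (x # vs)" "independent (set (x # vs))"
    using orient_nonzero[OF assms] by auto
  then have "x \<notin> span (set (x # vs) - {x})" unfolding dependent_def by auto
  moreover have "set (x # vs) - {x} = set vs" using d(1) by auto
  moreover have "independent (set vs)" using independent_mono[OF d(2)] by auto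
  ultimately show "distinct vs \<and> independent (set vs) \<and> x \<notin> span (set vs)" using d(1) by auto
next
  assume a: "distinct vs \<and> independent (set vs) \<and> x \<notin> span (set vs)"
  then have i: "independent (set (x # vs))" by (simp add: independent_insert)
  have "x \<notin> set vs" using a span_base by auto
  then have "card (set (x # vs)) = Suc CARD('n)" using a assms distinct_card[of vs] by simp
  then have "span (set (x # vs)) = UNIV"
    using i DIM_eq[where 'n='n] by (intro subspace_dim_equal) (auto simp: subspace_span dim_eq_card_independent)
  then show "orient (x # vs) \<noteq> 0"
    using nonzero_iff[of "x # vs"] assms DIM_eq[where 'n='n] by simp
qed

lemma join_polytopes_eq:
  assumes "g = Spherical"
  shows "join_polytopes L = (\<lambda>(x, vs). antipodal_join x (gsimplex g vs)) ` join_lists"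
proof -
  have mem: "x # vs \<in> vertex_lists \<and> orient (x # vs) \<noteq> 0 \<longleftrightarrow>
      length vs = CARD('n) \<and> distinct vs \<and> independent (set vs) \<and>
        set vs \<subseteq> model_space g \<and> (\<forall>v\<in>set vs. point_of g v \<in> points L) \<and>
        x \<in> model_space g \<and> point_of g x \<in> points L \<and>
        x \<notin> gspan g (gsimplex g vs)" for x vs
  proof (cases "length vs = CARD('n) \<and> set vs \<subseteq> vertices \<and> x \<in> vertices")
    case True
    then have "set vs \<subseteq> model_space g" "x \<in> model_space g" by (auto simp: vertices_def)
    then show ?thesis
      using True orient_Cons_nonzero[of x vs] gspan_gsimplex[of vs]
      by (auto simp: vertex_lists_def vertices_def)
  qed (auto simp: vertex_lists_def vertices_def)
  show ?thesis
    unfolding join_polytopes_def join_lists_def mem assms[symmetric] by auto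
qed

lemma gsimplex_cong: "set vs = set ws \<Longrightarrow> gsimplex g vs = gsimplex g ws"
  by (simp add: gsimplex_def)

lemma join_list_minus:
  assumes "g = Spherical" "(x, vs) \<in> join_lists"
  shows "(- x, vs) \<in> join_lists" "orient ((- x) # vs) = - orient (x # vs)"
proof -
  have len: "length (x # vs) = Suc CARD('n)" and v: "set (x # vs) \<subseteq> vertices"
    using assms(2) by (auto simp: join_lists_def vertex_lists_def)
  show o: "orient ((- x) # vs) = - orient (x # vs)"
    using scale[of "[]" vs "- 1" x] len DIM_eq[where 'n='n] by simp
  show "(- x, vs) \<in> join_lists"
    using assms(2) o vertices_minus[OF assms(1), of x] by (auto simp: join_lists_def vertex_lists_def)
qed

text \<open>If both \<open>z - s x\<close> and \<open>z + t x\<close> lie in the span of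
  \<open>vs\<close> with \<open>s\<close> and \<open>t\<close> nonnegative, then so does
  \<open>(s + t) x\<close>; as \<open>x\<close> is outside that span, \<open>s = t = 0\<close>. So
  the two halves of a join overlap only in a proper subspace.\<close>

lemma join_decomposition:
  assumes "g = Spherical" "(x, vs) \<in> join_lists"
  shows "antipodal_join x (gsimplex g vs) \<in> L_polytopes g L"
    and "negligible_frag (frag_of (antipodal_join x (gsimplex g vs))
      - (frag_of (gsimplex g (x # vs)) + frag_of (gsimplex g ((- x) # vs))))"
proof -
  have len: "length (x # vs) = Suc CARD('n)" and v: "set (x # vs) \<subseteq> vertices" and nz: "orient (x # vs) \<noteq> 0"
    using assms(2) by (auto simp: join_lists_def vertex_lists_def)
  have xn: "x \<notin> span (set vs)" using orient_Cons_nonzero[OF len] nz by simp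
  have norm1: "norm w = 1" if "w \<in> set (x # vs)" for w
  proof -
    have "w \<in> model_space g" using v that by (auto simp: vertices_def)
    then show ?thesis unfolding assms(1) by simp
  qed
  have "vs \<noteq> []" using len by auto
  then have eq: "antipodal_join x (gsimplex g vs) = gsimplex g (x # vs) \<union> gsimplex g ((- x) # vs)"
    unfolding assms(1) using norm1 xn by (intro antipodal_join_eq) auto
  have P: "convex_polytope g L (gsimplex g (y # vs))" if "(y, vs) \<in> join_lists" for y
    using that orient_nonzero[of "y # vs"]
    by (intro convex_polytope_gsimplex) (auto simp: join_lists_def vertex_lists_def)
  show "antipodal_join x (gsimplex g vs) \<in> L_polytopes g L"
    unfolding eq L_polytopes_def using P[OF assms(2)] P[OF join_list_minus(1)[OF assms]]
    by (intro CollectI exI[of _ "{gsimplex g (x # vs), gsimplex g ((- x) # vs)}"]) auto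
  have "\<forall>\<^sub>F z in generic UNIV. z \<in> UNIV \<and> z \<notin> span (set vs)"
    using xn by (intro generic_subspace) (auto simp: subspace_span)
  then show "negligible_frag (frag_of (antipodal_join x (gsimplex g vs))
      - (frag_of (gsimplex g (x # vs)) + frag_of (gsimplex g ((- x) # vs))))"
    unfolding negligible_frag_def
  proof (eventually_elim, intro impI)
    fix z assume z: "z \<in> UNIV \<and> z \<notin> span (set vs)"
    have "\<not> (z \<in> gsimplex g (x # vs) \<and> z \<in> gsimplex g ((- x) # vs))"
    proof
      assume "z \<in> gsimplex g (x # vs) \<and> z \<in> gsimplex g ((- x) # vs)"
      then obtain s t where st: "s \<ge> 0" "t \<ge> 0" "z - s *\<^sub>R x \<in> convex_cone hull (set vs)"
        "z - t *\<^sub>R (- x) \<in> convex_cone hull (set vs)"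
        by (auto simp: gsimplex_def mem_convex_cone_hull_insert)
      have "convex_cone hull (set vs) \<subseteq> span (set vs)"
        by (intro hull_minimal convex_cone_span span_superset)
      then have sp: "z - s *\<^sub>R x \<in> span (set vs)" "z + t *\<^sub>R x \<in> span (set vs)" using st by auto
      have "(z + t *\<^sub>R x) - (z - s *\<^sub>R x) \<in> span (set vs)" by (rule span_diff[OF sp(2,1)])
      then have "(s + t) *\<^sub>R x \<in> span (set vs)" by (simp add: algebra_simps)
      then have "(1 / (s + t)) *\<^sub>R (s + t) *\<^sub>R x \<in> span (set vs)" by (rule span_scale)
      then have "s + t = 0" using xn by (cases "s + t = 0") auto
      then have "s = 0" using st by linarith
      then show False using sp(1) z by simp
    qed
    then show "frag_eval (\<lambda>P. of_bool (z \<in> P)) (frag_of (antipodal_join x (gsimplex g vs))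
      - (frag_of (gsimplex g (x # vs)) + frag_of (gsimplex g ((- x) # vs)))) = 0"
      unfolding eq by (auto simp: frag_eval_diff frag_eval_add)
  qed
qed

text \<open>Empty off the sphere, so that one statement, that the kernel is generated by joins, also
  covers injectivity in the other two geometries.\<close>

definition joins :: "(real ^ 'n option) set set" where
  "joins = (if g = Spherical then join_polytopes L else {})"

lemma joins_eq:
  assumes "g = Spherical"
  shows "joins = (\<lambda>(x, vs). antipodal_join x (gsimplex g vs)) ` join_lists"
  unfolding joins_def if_P[OF assms] by (rule join_polytopes_eq[OF assms])

lemma joins_L_polytopes: "joins \<subseteq> L_polytopes g L"
proof (cases "g = Spherical")
  case True
  show ?thesis unfolding joins_eq[OF True] using join_decomposition(1)[OF True] by auto
qed (simp add: joins_def)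

text \<open>The lists \<open>x # vs\<close> and \<open>(- x) # vs\<close> have opposite orientations
  but the same points. Their difference therefore gives, up to sign, the sum of the two halves as
  polytopes and 0 as tuples; the factor \<open>?s\<close> corrects the sign.\<close>

lemma join_is_poly_frag:
  assumes "J \<in> joins"
  shows "\<exists>c. Poly_Mapping.keys c \<subseteq> vertex_lists \<and> tuple_frag c = 0 \<and> negligible_frag (frag_of J - poly_frag c)"
proof -
  have S: "g = Spherical" using assms by (auto simp: joins_def split: if_splits)
  have "J \<in> (\<lambda>(x, vs). antipodal_join x (gsimplex g vs)) ` join_lists"
    using assms unfolding joins_eq[OF S] .
  then obtain x vs where J: "J = antipodal_join x (gsimplex g vs)" "(x, vs) \<in> join_lists" by auto
  let ?s = "isgn (orient (x # vs))"
  let ?c = "frag_cmul ?s (frag_of (x # vs) - frag_of ((- x) # vs))"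
  have "?s * ?s = 1" using J(2) by (auto simp: join_lists_def isgn_def)
  moreover have "simplex_frag (x # vs) - simplex_frag ((- x) # vs)
      = frag_cmul ?s (frag_of (gsimplex g (x # vs)) + frag_of (gsimplex g ((- x) # vs)))"
    by (simp only: simplex_frag_def join_list_minus(2)[OF S J(2)] isgn_minus frag_cmul_distrib2
        zmod.scale_minus_left diff_minus_eq_add)
  ultimately have "poly_frag ?c = frag_of (gsimplex g (x # vs)) + frag_of (gsimplex g ((- x) # vs))"
    by (simp only: poly_frag_def frag_extend_cmul frag_extend_diff frag_extend_of frag_cmul_cmul frag_cmul_one)
  then have "negligible_frag (frag_of J - poly_frag ?c)"
    using join_decomposition(2)[OF S J(2)] by (simp add: J(1))
  moreover have "point_of g (- x) = point_of g x" unfolding S by (rule point_of_minus)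
  then have "tuple_frag ?c = 0"
    by (simp add: tuple_frag_def frag_extend_cmul frag_extend_diff)
  moreover have "Poly_Mapping.keys ?c \<subseteq> vertex_lists"
    using J(2) join_list_minus(1)[OF S J(2)] keys_cmul[of ?s "frag_of (x # vs) - frag_of ((- x) # vs)"]
      keys_diff[of "frag_of (x # vs)" "frag_of ((- x) # vs)"]
    by (auto simp: join_lists_def keys_frag_of)
  ultimately show ?thesis by blast
qed

text \<open>Integer combinations of joins, up to negligible ones. With
  \<open>negligible_frag\<close> in place of \<open>Pt_null\<close> no condition on keys has to be
  carried along.\<close>

definition join_span :: "((real ^ 'n option) set \<Rightarrow>\<^sub>0 int) set" where
  "join_span = {\<xi>. \<exists>j\<in>zmod.span (frag_of ` joins). negligible_frag (\<xi> - j)}"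

lemma negligible_zero: "negligible_frag 0"
  using zmod.subspace_0[OF negligible_subspace] by simp

lemma negligible_add: "negligible_frag x \<Longrightarrow> negligible_frag y \<Longrightarrow> negligible_frag (x + y)"
  using zmod.subspace_add[OF negligible_subspace] by simp

lemma negligible_cmul: "negligible_frag x \<Longrightarrow> negligible_frag (frag_cmul n x)"
  using zmod.subspace_scale[OF negligible_subspace] by simp

lemma subspace_join_span: "zmod.subspace join_span"
  unfolding zmod.subspace_def
proof (intro conjI ballI allI)
  show "0 \<in> join_span"
    unfolding join_span_def using negligible_zero by (intro CollectI bexI[of _ 0]) (auto simp: zmod.span_zero)
  fix x y assume "x \<in> join_span" "y \<in> join_span"
  then obtain j k where jk: "j \<in> zmod.span (frag_of ` joins)" "negligible_frag (x - j)"
    "k \<in> zmod.span (frag_of ` joins)" "negligible_frag (y - k)" by (auto simp: join_span_def)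
  have "negligible_frag ((x - j) + (y - k))" using jk by (intro negligible_add)
  then have "negligible_frag (x + y - (j + k))" by (simp add: algebra_simps)
  then show "x + y \<in> join_span"
    unfolding join_span_def using jk zmod.span_add[of j "frag_of ` joins" k] by blast
next
  fix n x assume "x \<in> join_span"
  then obtain j where j: "j \<in> zmod.span (frag_of ` joins)" "negligible_frag (x - j)" by (auto simp: join_span_def)
  then have "negligible_frag (frag_cmul n x - frag_cmul n j)"
    using negligible_cmul[of "x - j" n] by (simp add: zmod.scale_right_diff_distrib)
  then show "frag_cmul n x \<in> join_span"
    unfolding join_span_def using j zmod.span_scale[of j "frag_of ` joins" n] by blast
qed

lemma negligible_join_span: "negligible_frag \<xi> \<Longrightarrow> \<xi> \<in> join_span"
  unfolding join_span_def by (intro CollectI bexI[of _ 0]) (auto simp: zmod.span_zero)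

text \<open>Replacing a vertex by its antipode reverses the orientation, so the difference of the
  signed simplices is, up to sign, the sum of the two simplices that make up a join. Moving
  \<open>v\<close> to the front does not change the simplices.\<close>

lemma simplex_frag_minus:
  assumes "g = Spherical" "as @ v # bs \<in> vertex_lists"
  shows "simplex_frag (as @ v # bs) - simplex_frag (as @ (- v) # bs) \<in> join_span"
proof -
  let ?s = "isgn (orient (as @ v # bs))"
  have len: "Suc (length as + length bs) = DIM(real ^ 'n option)" and v: "set (v # as @ bs) \<subseteq> vertices"
    using assms(2) DIM_eq[where 'n='n] by (auto simp: vertex_lists_def)
  have o: "orient (as @ (- v) # bs) = - orient (as @ v # bs)" using scale[OF len, of "- 1" v] by simp
  have gs: "gsimplex g (w # as @ bs) = gsimplex g (as @ w # bs)" for w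
    by (rule gsimplex_cong) simp
  have eq: "simplex_frag (as @ v # bs) - simplex_frag (as @ (- v) # bs)
      = frag_cmul ?s (frag_of (gsimplex g (v # as @ bs)) + frag_of (gsimplex g ((- v) # as @ bs)))"
    unfolding gs
    by (simp only: simplex_frag_def o isgn_minus frag_cmul_distrib2 zmod.scale_minus_left diff_minus_eq_add)
  show ?thesis
  proof (cases "orient (as @ v # bs) = 0")
    case True
    then show ?thesis using eq zmod.subspace_0[OF subspace_join_span] by simp
  next
    case False
    have "orient (v # as @ bs) = (- 1) ^ length as * orient (as @ v # bs)"
      using move[of "[]" as bs v] len by simp
    then have J: "(v, as @ bs) \<in> join_lists"
      using False len v DIM_eq[where 'n='n] by (auto simp: join_lists_def vertex_lists_def)
    let ?J = "antipodal_join v (gsimplex g (as @ bs))"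
    let ?G = "frag_of (gsimplex g (v # as @ bs)) + frag_of (gsimplex g ((- v) # as @ bs))"
    have "?J \<in> joins" unfolding joins_eq[OF assms(1)] using J by force
    then have "frag_of ?J \<in> zmod.span (frag_of ` joins)" by (intro zmod.span_base) auto
    moreover have "negligible_frag (?G - frag_of ?J)"
      using negligible_cmul[OF join_decomposition(2)[OF assms(1) J], of "- 1"] by simp
    ultimately have "?G \<in> join_span" unfolding join_span_def by blast
    then show ?thesis unfolding eq by (rule zmod.subspace_scale[OF subspace_join_span])
  qed
qed

lemma simplex_frag_lift:
  assumes "vs \<in> vertex_lists" "ws \<in> vertex_lists" "map (point_of g) vs = map (point_of g) ws"
  shows "simplex_frag vs - simplex_frag ws \<in> join_span"
proof -
  \<comment> \<open>Vertices are exchanged one at a time; the prefix \<open>as\<close> collects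
    those already exchanged.\<close>
  have gen: "as @ vs \<in> vertex_lists \<Longrightarrow> as @ ws \<in> vertex_lists \<Longrightarrow> map (point_of g) vs = map (point_of g) ws \<Longrightarrow>
      simplex_frag (as @ vs) - simplex_frag (as @ ws) \<in> join_span" for as vs ws
  proof (induction vs arbitrary: as ws)
    case Nil
    then show ?case using zmod.subspace_0[OF subspace_join_span] by simp
  next
    case (Cons v vs)
    then obtain w ws' where ws: "ws = w # ws'" by (cases ws) auto
    have vw: "w = v \<or> g = Spherical \<and> w = - v"
      using point_of_eq_iff[of v g w] Cons.prems ws by (auto simp: vertex_lists_def vertices_def)
    have "simplex_frag (as @ v # vs) - simplex_frag (as @ w # vs) \<in> join_span"
      using vw simplex_frag_minus[of as v vs] Cons.prems(1) zmod.subspace_0[OF subspace_join_span] by auto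
    moreover have "simplex_frag ((as @ [w]) @ vs) - simplex_frag ((as @ [w]) @ ws') \<in> join_span"
      using Cons.prems ws by (intro Cons.IH) (auto simp: vertex_lists_def)
    ultimately have "(simplex_frag (as @ v # vs) - simplex_frag (as @ w # vs))
        + (simplex_frag (as @ w # vs) - simplex_frag (as @ w # ws')) \<in> join_span"
      by (intro zmod.subspace_add[OF subspace_join_span]) simp_all
    then show ?case by (simp add: ws)
  qed
  show ?thesis using gen[of "[]" vs ws] assms by simp
qed

section \<open>Lifting tuples of points to vertex lists\<close>

definition lift_point :: "(real ^ 'n option) set \<Rightarrow> real ^ 'n option" where
  "lift_point A = (SOME v. v \<in> vertices \<and> point_of g v = A)"

lemma lift_point:
  assumes "A \<in> points L"
  shows "lift_point A \<in> vertices" "point_of g (lift_point A) = A"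
proof -
  have "\<exists>v. v \<in> vertices \<and> point_of g v = A" using point_lift[OF assms] by blast
  from someI_ex[OF this] show "lift_point A \<in> vertices" "point_of g (lift_point A) = A"
    by (auto simp: lift_point_def)
qed

text \<open>A right inverse of \<open>tuple_frag\<close>, from an arbitrary choice of
  representatives. By \<open>simplex_frag_lift\<close> another choice changes
  \<open>poly_frag\<close> only within \<open>join_span\<close>.\<close>

definition lift_frag :: "((real ^ 'n option) set list \<Rightarrow>\<^sub>0 int) \<Rightarrow> (real ^ 'n option) list \<Rightarrow>\<^sub>0 int" where
  "lift_frag = frag_extend (\<lambda>As. frag_of (map lift_point As))"

lemma lift_tuple:
  assumes "As \<in> tuples L (CARD('n) + 1)"
  shows "map lift_point As \<in> vertex_lists" "map (point_of g) (map lift_point As) = As"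
proof -
  have As: "length As = Suc CARD('n)" "set As \<subseteq> points L" using assms by (auto simp: tuples_def)
  then show "map lift_point As \<in> vertex_lists" using lift_point(1) by (auto simp: vertex_lists_def)
  show "map (point_of g) (map lift_point As) = As" unfolding map_map
    by (rule map_idI) (use As(2) lift_point(2) in auto)
qed

lemma tuple_frag_lift:
  assumes "Poly_Mapping.keys t \<subseteq> tuples L (CARD('n) + 1)"
  shows "Poly_Mapping.keys (lift_frag t) \<subseteq> vertex_lists" "tuple_frag (lift_frag t) = t"
proof -
  show "Poly_Mapping.keys (lift_frag t) \<subseteq> vertex_lists"
  proof
    fix vs assume "vs \<in> Poly_Mapping.keys (lift_frag t)"
    then have "vs \<in> (\<Union>As\<in>Poly_Mapping.keys t. Poly_Mapping.keys (frag_of (map lift_point As)))"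
      unfolding lift_frag_def by (rule subsetD[OF keys_frag_extend])
    then show "vs \<in> vertex_lists" using assms lift_tuple(1) by (auto simp: keys_frag_of)
  qed
  have "tuple_frag (lift_frag t) = frag_extend (\<lambda>As. frag_of (map (point_of g) (map lift_point As))) t"
    by (simp add: tuple_frag_def lift_frag_def frag_extend_extend)
  also have "\<dots> = frag_extend frag_of t"
    by (rule frag_extend_eq) (use assms lift_tuple(2) in auto)
  also have "\<dots> = t" by (rule frag_expansion[symmetric])
  finally show "tuple_frag (lift_frag t) = t" .
qed

lemma map_point_in_tuples: "vs \<in> vertex_lists \<Longrightarrow> map (point_of g) vs \<in> tuples L (CARD('n) + 1)"
  unfolding tuples_eq by (auto simp: vertex_lists_def)

lemma simplex_frag_lift_point:
  assumes "vs \<in> vertex_lists" "As = map (point_of g) vs"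
  shows "simplex_frag vs - simplex_frag (map lift_point As) \<in> join_span"
  using assms lift_tuple[OF map_point_in_tuples[OF assms(1)]] by (intro simplex_frag_lift) auto

text \<open>The chosen lifts need not lie in an open half-space, so the alternating sum of their
  signed simplices need not be negligible. For lifts \<open>ys'\<close> that do, it is, and the
  change back to the chosen lifts costs only joins.\<close>

lemma relation_join_span:
  assumes "r \<in> tuple_relations (point_of g) vertices (Suc CARD('n))"
  shows "poly_frag (lift_frag r) \<in> join_span"
  using assms unfolding tuple_relations_def
proof (elim UnE CollectE exE conjE)
  fix ys assume ys: "r = frag_of (map (point_of g) ys)" "length ys = Suc CARD('n)" "set ys \<subseteq> vertices"
    "dim (set ys) < Suc CARD('n)"
  have vl: "ys \<in> vertex_lists" using ys by (simp add: vertex_lists_def)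
  have "orient ys = 0" using ys orient_eq_0 by blast
  then have "simplex_frag ys = 0" by (simp add: simplex_frag_def)
  then have "0 - simplex_frag (map lift_point (map (point_of g) ys)) \<in> join_span"
    using simplex_frag_lift_point[OF vl refl] by simp
  then have "0 - (0 - simplex_frag (map lift_point (map (point_of g) ys))) \<in> join_span"
    by (rule zmod.subspace_diff[OF subspace_join_span zmod.subspace_0[OF subspace_join_span]])
  then show ?thesis by (simp add: ys(1) poly_frag_def lift_frag_def)
next
  fix ys assume ys: "r = (\<Sum>i<Suc (Suc CARD('n)). frag_cmul ((- 1) ^ i) (frag_of (omit i (map (point_of g) ys))))"
    "length ys = Suc (Suc CARD('n))" "set ys \<subseteq> vertices"
  obtain ys' where ys': "length ys' = length ys" "set ys' \<subseteq> vertices"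
    "map (point_of g) ys' = map (point_of g) ys" "\<exists>l. \<forall>y\<in>set ys'. l \<bullet> y > 0"
    using lift_positive[OF ys(3)] by blast
  obtain l where l: "\<forall>y\<in>set ys'. l \<bullet> y > 0" using ys'(4) by blast
  let ?N = "Suc (Suc CARD('n))"
  let ?lift = "\<lambda>i. map lift_point (omit i (map (point_of g) ys))"
  have vl: "omit i ys' \<in> vertex_lists" if "i < ?N" for i
    using that ys'(1,2) ys(2) set_omit_subset[of i ys'] by (auto simp: vertex_lists_def)
  have "\<forall>\<^sub>F z in generic UNIV. (\<Sum>i<length ys'. (- 1) ^ i *
      (isgn (orient ([] @ omit i ys')) * of_bool (z \<in> convex_cone hull (set (omit i ys'))))) = 0"
    by (rule alternating_cone_sum[where l = l]) (use ys'(1) ys(2) l DIM_eq[where 'n='n] in auto)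
  then have neg: "negligible_frag (\<Sum>i<?N. frag_cmul ((- 1) ^ i) (simplex_frag (omit i ys')))"
    unfolding negligible_frag_def
  proof (eventually_elim, intro impI)
    fix z assume z: "(\<Sum>i<length ys'. (- 1) ^ i *
        (isgn (orient ([] @ omit i ys')) * of_bool (z \<in> convex_cone hull (set (omit i ys'))))) = 0"
      "z \<in> model_space g"
    have "frag_eval (\<lambda>P. of_bool (z \<in> P)) (\<Sum>i<?N. frag_cmul ((- 1) ^ i) (simplex_frag (omit i ys')))
      = (\<Sum>i<length ys'. (- 1) ^ i *
        (isgn (orient ([] @ omit i ys')) * of_bool (z \<in> convex_cone hull (set (omit i ys')))))"
      unfolding frag_eval_sum ys'(1) ys(2)
      by (rule sum.cong) (use z(2) in \<open>auto simp: frag_eval_cmul simplex_frag_def gsimplex_def\<close>)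
    then show "frag_eval (\<lambda>P. of_bool (z \<in> P)) (\<Sum>i<?N. frag_cmul ((- 1) ^ i) (simplex_frag (omit i ys'))) = 0"
      using z(1) by (simp only:)
  qed
  have "simplex_frag (omit i ys') - simplex_frag (?lift i) \<in> join_span" if "i < ?N" for i
    using vl[OF that] ys'(3) by (intro simplex_frag_lift_point) (simp_all add: map_omit)
  then have "(\<Sum>i<?N. frag_cmul ((- 1) ^ i) (simplex_frag (omit i ys') - simplex_frag (?lift i))) \<in> join_span"
    by (intro zmod.subspace_sum[OF subspace_join_span] zmod.subspace_scale[OF subspace_join_span]) auto
  then have "(\<Sum>i<?N. frag_cmul ((- 1) ^ i) (simplex_frag (omit i ys')))
      - (\<Sum>i<?N. frag_cmul ((- 1) ^ i) (simplex_frag (?lift i))) \<in> join_span"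
    unfolding zmod.scale_right_diff_distrib sum_subtractf .
  from zmod.subspace_diff[OF subspace_join_span negligible_join_span[OF neg] this]
  have "(\<Sum>i<?N. frag_cmul ((- 1) ^ i) (simplex_frag (?lift i))) \<in> join_span"
    unfolding diff_diff_eq2 add_diff_cancel_left' .
  moreover have "poly_frag (lift_frag r) = (\<Sum>i<?N. frag_cmul ((- 1) ^ i) (simplex_frag (?lift i)))"
    unfolding ys(1) poly_frag_def lift_frag_def frag_extend_sum[OF finite_lessThan] o_def
      frag_extend_cmul frag_extend_of ..
  ultimately show ?thesis by (simp only:)
qed

text \<open>The converse of \<open>tuple_frag_null\<close> up to joins. Lifting and then taking
  \<open>poly_frag\<close> sends relations into \<open>join_span\<close>, and lifting the tuples of
  \<open>c\<close> anew changes \<open>poly_frag c\<close> by joins only.\<close>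

theorem poly_frag_join_span:
  assumes c: "Poly_Mapping.keys c \<subseteq> vertex_lists" and t: "tuple_frag c \<in> Ls_null g L"
  shows "poly_frag c \<in> join_span"
proof -
  have "zmod.span (tuple_relations (point_of g) vertices (Suc CARD('n))) \<subseteq> {t. poly_frag (lift_frag t) \<in> join_span}"
  proof (rule zmod.span_minimal)
    show "tuple_relations (point_of g) vertices (Suc CARD('n)) \<subseteq> {t. poly_frag (lift_frag t) \<in> join_span}"
      using relation_join_span by auto
    show "zmod.subspace {t. poly_frag (lift_frag t) \<in> join_span}"
      unfolding zmod.subspace_def poly_frag_def lift_frag_def
      using subspace_join_span by (auto simp: frag_extend_add frag_extend_cmul zmod.subspace_def)
  qed
  then have 1: "poly_frag (lift_frag (tuple_frag c)) \<in> join_span" using t by (auto simp: Ls_null_eq)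
  have "frag_extend (\<lambda>vs. simplex_frag vs - simplex_frag (map lift_point (map (point_of g) vs))) c \<in> join_span"
    unfolding frag_extend_eq_sum using c simplex_frag_lift_point
    by (intro zmod.subspace_sum[OF subspace_join_span] zmod.subspace_scale[OF subspace_join_span]) auto
  also have "frag_extend (\<lambda>vs. simplex_frag vs - simplex_frag (map lift_point (map (point_of g) vs))) c
      = poly_frag c - poly_frag (lift_frag (tuple_frag c))"
    unfolding frag_extend_fun_diff by (simp add: poly_frag_def lift_frag_def tuple_frag_def frag_extend_extend)
  finally show ?thesis using zmod.subspace_add[OF subspace_join_span _ 1] by fastforce
qed

end

section \<open>The canonical map\<close>

lemma r_coset_free_Abelian_group: "N #>\<^bsub>free_Abelian_group S\<^esub> x = {h + x | h. h \<in> N}"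
  by (auto simp: r_coset_def)

lemma r_coset_eq_iff:
  assumes "zmod.subspace N"
  shows "N #>\<^bsub>free_Abelian_group S\<^esub> x = N #>\<^bsub>free_Abelian_group S\<^esub> y \<longleftrightarrow> x - y \<in> N"
proof
  assume "N #>\<^bsub>free_Abelian_group S\<^esub> x = N #>\<^bsub>free_Abelian_group S\<^esub> y"
  moreover have "0 + x \<in> {h + x | h. h \<in> N}" using zmod.subspace_0[OF assms] by blast
  ultimately obtain h where "h \<in> N" "0 + x = h + y" unfolding r_coset_free_Abelian_group by blast
  then show "x - y \<in> N" by simp
next
  assume xy: "x - y \<in> N"
  show "N #>\<^bsub>free_Abelian_group S\<^esub> x = N #>\<^bsub>free_Abelian_group S\<^esub> y"
    unfolding r_coset_free_Abelian_group
  proof (intro equalityI subsetI)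
    fix z assume "z \<in> {h + x | h. h \<in> N}"
    then obtain h where h: "h \<in> N" "z = h + x" by blast
    then have "z = (h + (x - y)) + y" by simp
    moreover have "h + (x - y) \<in> N" using h(1) xy by (rule zmod.subspace_add[OF assms])
    ultimately show "z \<in> {h + y | h. h \<in> N}" by blast
  next
    fix z assume "z \<in> {h + y | h. h \<in> N}"
    then obtain h where h: "h \<in> N" "z = h + y" by blast
    then have "z = (h - (x - y)) + x" by simp
    moreover have "h - (x - y) \<in> N" using h(1) xy by (rule zmod.subspace_diff[OF assms])
    ultimately show "z \<in> {h + x | h. h \<in> N}" by blast
  qed
qed

lemma normal_span:
  assumes "R \<subseteq> carrier (free_Abelian_group S)"
  shows "zmod.span R \<lhd> free_Abelian_group S"
proof -
  interpret F: comm_group "free_Abelian_group S" by (rule abelian_free_Abelian_group)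
  show ?thesis
    unfolding generate_free_Abelian_group[OF assms, symmetric]
    by (rule F.subgroup_imp_normal[OF F.generate_is_subgroup[OF assms]])
qed

lemma carrier_quotient:
  "carrier (free_Abelian_group S Mod N) = {N #>\<^bsub>free_Abelian_group S\<^esub> x | x. Poly_Mapping.keys x \<subseteq> S}"
  by (auto simp: FactGroup_def RCOSETS_def)

lemma mult_quotient:
  assumes "R \<subseteq> carrier (free_Abelian_group S)" "Poly_Mapping.keys x \<subseteq> S" "Poly_Mapping.keys y \<subseteq> S"
  shows "(zmod.span R #>\<^bsub>free_Abelian_group S\<^esub> x) \<otimes>\<^bsub>free_Abelian_group S Mod zmod.span R\<^esub>
      (zmod.span R #>\<^bsub>free_Abelian_group S\<^esub> y) = zmod.span R #>\<^bsub>free_Abelian_group S\<^esub> (x + y)"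
  using normal.rcos_sum[OF normal_span[OF assms(1)], of x y] assms(2,3)
  by (simp add: FactGroup_def)

lemma one_quotient:
  assumes "R \<subseteq> carrier (free_Abelian_group S)"
  shows "\<one>\<^bsub>free_Abelian_group S Mod zmod.span R\<^esub> = zmod.span R #>\<^bsub>free_Abelian_group S\<^esub> 0"
  by (simp add: FactGroup_def r_coset_free_Abelian_group)

lemma keys_diff_subset:
  "Poly_Mapping.keys c \<subseteq> S \<Longrightarrow> Poly_Mapping.keys d \<subseteq> S \<Longrightarrow> Poly_Mapping.keys (c - d) \<subseteq> S"
  using keys_diff[of c d] by blast

lemma keys_add_subset:
  "Poly_Mapping.keys c \<subseteq> S \<Longrightarrow> Poly_Mapping.keys d \<subseteq> S \<Longrightarrow> Poly_Mapping.keys (c + d) \<subseteq> S"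
  using keys_add[of c d] by blast

context oriented_collection
begin

definition Pt_cl :: "((real ^ 'n option) set \<Rightarrow>\<^sub>0 int) \<Rightarrow> ((real ^ 'n option) set \<Rightarrow>\<^sub>0 int) set" where
  "Pt_cl \<xi> = Pt_null g L #>\<^bsub>free_Abelian_group (L_polytopes g L)\<^esub> \<xi>"

definition Ls_cl :: "((real ^ 'n option) set list \<Rightarrow>\<^sub>0 int) \<Rightarrow> ((real ^ 'n option) set list \<Rightarrow>\<^sub>0 int) set" where
  "Ls_cl t = Ls_null g L #>\<^bsub>free_Abelian_group (tuples L (CARD('n) + 1))\<^esub> t"

lemma Pt_class_eq: "Pt_class g L P = Pt_cl (frag_of P)"
  by (simp add: Pt_class_def Pt_cl_def)

lemma Ls_class_eq: "Ls_class g L ys = Ls_cl (frag_of ys)"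
  by (simp add: Ls_class_def Ls_cl_def)

lemma Ls_null_span: "Ls_null g L = zmod.span (Ls_relations g L)"
  by (simp only: Ls_null_eq Ls_relations_eq)

lemma subspace_Pt_null: "zmod.subspace (Pt_null g L)"
  unfolding Pt_null_eq by (rule zmod.subspace_span)

lemma subspace_Ls_null: "zmod.subspace (Ls_null g L)"
  unfolding Ls_null_eq by (rule zmod.subspace_span)

lemma Pt_cl_eq_iff: "Pt_cl x = Pt_cl y \<longleftrightarrow> x - y \<in> Pt_null g L"
  unfolding Pt_cl_def by (rule r_coset_eq_iff[OF subspace_Pt_null])

lemma Ls_cl_eq_iff: "Ls_cl x = Ls_cl y \<longleftrightarrow> x - y \<in> Ls_null g L"
  unfolding Ls_cl_def by (rule r_coset_eq_iff[OF subspace_Ls_null])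

lemma group_Pt: "group (Pt g L)"
  unfolding Pt_def Pt_null_eq by (rule normal.factorgroup_is_group[OF normal_span[OF Pt_relations_carrier]])

lemma group_Ls: "group (Ls g L)"
  unfolding Ls_def Ls_null_span by (rule normal.factorgroup_is_group[OF normal_span[OF Ls_relations_carrier]])

lemma Pt_mult:
  "Poly_Mapping.keys x \<subseteq> L_polytopes g L \<Longrightarrow> Poly_Mapping.keys y \<subseteq> L_polytopes g L \<Longrightarrow>
   Pt_cl x \<otimes>\<^bsub>Pt g L\<^esub> Pt_cl y = Pt_cl (x + y)"
  unfolding Pt_def Pt_cl_def Pt_null_eq by (rule mult_quotient[OF Pt_relations_carrier])

lemma Ls_mult:
  "Poly_Mapping.keys x \<subseteq> tuples L (CARD('n) + 1) \<Longrightarrow> Poly_Mapping.keys y \<subseteq> tuples L (CARD('n) + 1) \<Longrightarrow>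
   Ls_cl x \<otimes>\<^bsub>Ls g L\<^esub> Ls_cl y = Ls_cl (x + y)"
  unfolding Ls_def Ls_cl_def Ls_null_span by (rule mult_quotient[OF Ls_relations_carrier])

lemma Pt_one: "\<one>\<^bsub>Pt g L\<^esub> = Pt_cl 0"
  unfolding Pt_def Pt_cl_def Pt_null_eq by (rule one_quotient[OF Pt_relations_carrier])

lemma Ls_one: "\<one>\<^bsub>Ls g L\<^esub> = Ls_cl 0"
  unfolding Ls_def Ls_cl_def Ls_null_span by (rule one_quotient[OF Ls_relations_carrier])

lemma Pt_carrier: "carrier (Pt g L) = {Pt_cl x | x. Poly_Mapping.keys x \<subseteq> L_polytopes g L}"
  unfolding Pt_def Pt_cl_def by (rule carrier_quotient)

lemma Ls_carrier: "carrier (Ls g L) = {Ls_cl x | x. Poly_Mapping.keys x \<subseteq> tuples L (CARD('n) + 1)}"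
  unfolding Ls_def Ls_cl_def by (rule carrier_quotient)

lemma Pt_carrier_poly_frag: "carrier (Pt g L) = {Pt_cl (poly_frag c) | c. Poly_Mapping.keys c \<subseteq> vertex_lists}"
proof (intro equalityI subsetI)
  fix X assume "X \<in> carrier (Pt g L)"
  then obtain \<xi> where \<xi>: "X = Pt_cl \<xi>" "Poly_Mapping.keys \<xi> \<subseteq> L_polytopes g L" unfolding Pt_carrier by blast
  obtain c where "Poly_Mapping.keys c \<subseteq> vertex_lists" "\<xi> - poly_frag c \<in> Pt_null g L"
    using ex_poly_frag[OF \<xi>(2)] by blast
  then show "X \<in> {Pt_cl (poly_frag c) | c. Poly_Mapping.keys c \<subseteq> vertex_lists}"
    unfolding \<xi>(1) using Pt_cl_eq_iff by blast
next
  fix X assume "X \<in> {Pt_cl (poly_frag c) | c. Poly_Mapping.keys c \<subseteq> vertex_lists}"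
  then show "X \<in> carrier (Pt g L)" unfolding Pt_carrier using keys_poly_frag by blast
qed

lemma Ls_carrier_tuple_frag: "carrier (Ls g L) = {Ls_cl (tuple_frag c) | c. Poly_Mapping.keys c \<subseteq> vertex_lists}"
proof (intro equalityI subsetI)
  fix X assume "X \<in> carrier (Ls g L)"
  then obtain t where t: "X = Ls_cl t" "Poly_Mapping.keys t \<subseteq> tuples L (CARD('n) + 1)" unfolding Ls_carrier by blast
  have "X = Ls_cl (tuple_frag (lift_frag t))" unfolding tuple_frag_lift(2)[OF t(2)] t(1) ..
  then show "X \<in> {Ls_cl (tuple_frag c) | c. Poly_Mapping.keys c \<subseteq> vertex_lists}"
    using tuple_frag_lift(1)[OF t(2)] by blast
next
  fix X assume "X \<in> {Ls_cl (tuple_frag c) | c. Poly_Mapping.keys c \<subseteq> vertex_lists}"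
  then show "X \<in> carrier (Ls g L)" unfolding Ls_carrier using keys_tuple_frag by blast
qed

lemma Ls_cl_well_defined:
  assumes c: "Poly_Mapping.keys c \<subseteq> vertex_lists" and d: "Poly_Mapping.keys d \<subseteq> vertex_lists"
    and eq: "Pt_cl (poly_frag c) = Pt_cl (poly_frag d)"
  shows "Ls_cl (tuple_frag c) = Ls_cl (tuple_frag d)"
proof -
  have "poly_frag (c - d) \<in> Pt_null g L" using eq unfolding Pt_cl_eq_iff poly_frag_diff .
  then have "tuple_frag (c - d) \<in> Ls_null g L"
    by (intro tuple_frag_null keys_diff_subset c d Pt_null_negligible)
  then show ?thesis unfolding Ls_cl_eq_iff tuple_frag_diff .
qed

text \<open>A preimage under \<open>poly_frag\<close> is chosen; by
  \<open>Ls_cl_well_defined\<close> the choice is immaterial. Restriction to the carrier matches the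
  extensionality demanded in \<open>canonical_map\<close>.\<close>

definition canonical :: "((real ^ 'n option) set \<Rightarrow>\<^sub>0 int) set \<Rightarrow> ((real ^ 'n option) set list \<Rightarrow>\<^sub>0 int) set" where
  "canonical = restrict (\<lambda>X. Ls_cl (tuple_frag (SOME c. Poly_Mapping.keys c \<subseteq> vertex_lists \<and> X = Pt_cl (poly_frag c))))
     (carrier (Pt g L))"

lemma canonical_poly_frag:
  assumes "Poly_Mapping.keys c \<subseteq> vertex_lists"
  shows "canonical (Pt_cl (poly_frag c)) = Ls_cl (tuple_frag c)"
proof -
  let ?d = "SOME d. Poly_Mapping.keys d \<subseteq> vertex_lists \<and> Pt_cl (poly_frag c) = Pt_cl (poly_frag d)"
  have "\<exists>d. Poly_Mapping.keys d \<subseteq> vertex_lists \<and> Pt_cl (poly_frag c) = Pt_cl (poly_frag d)"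
    using assms by blast
  from someI_ex[OF this] have d: "Poly_Mapping.keys ?d \<subseteq> vertex_lists" "Pt_cl (poly_frag c) = Pt_cl (poly_frag ?d)"
    by blast+
  have "Pt_cl (poly_frag c) \<in> carrier (Pt g L)" unfolding Pt_carrier_poly_frag using assms by blast
  then have "canonical (Pt_cl (poly_frag c)) = Ls_cl (tuple_frag ?d)" by (simp add: canonical_def)
  also have "\<dots> = Ls_cl (tuple_frag c)" by (rule Ls_cl_well_defined[OF assms d, symmetric])
  finally show ?thesis .
qed

lemma canonical_hom: "canonical \<in> hom (Pt g L) (Ls g L)"
proof (rule homI)
  fix X assume "X \<in> carrier (Pt g L)"
  then obtain c where c: "Poly_Mapping.keys c \<subseteq> vertex_lists" "X = Pt_cl (poly_frag c)"
    unfolding Pt_carrier_poly_frag by blast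
  then show "canonical X \<in> carrier (Ls g L)" unfolding Ls_carrier_tuple_frag using canonical_poly_frag by blast
next
  fix X Y assume "X \<in> carrier (Pt g L)" "Y \<in> carrier (Pt g L)"
  then obtain c d where c: "Poly_Mapping.keys c \<subseteq> vertex_lists" "X = Pt_cl (poly_frag c)"
    and d: "Poly_Mapping.keys d \<subseteq> vertex_lists" "Y = Pt_cl (poly_frag d)"
    unfolding Pt_carrier_poly_frag by blast
  have "X \<otimes>\<^bsub>Pt g L\<^esub> Y = Pt_cl (poly_frag (c + d))"
    unfolding c(2) d(2) poly_frag_add by (rule Pt_mult[OF keys_poly_frag[OF c(1)] keys_poly_frag[OF d(1)]])
  then have "canonical (X \<otimes>\<^bsub>Pt g L\<^esub> Y) = Ls_cl (tuple_frag (c + d))"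
    using canonical_poly_frag[OF keys_add_subset[OF c(1) d(1)]] by simp
  also have "\<dots> = canonical X \<otimes>\<^bsub>Ls g L\<^esub> canonical Y"
    unfolding c(2) d(2) canonical_poly_frag[OF c(1)] canonical_poly_frag[OF d(1)] tuple_frag_add
    by (rule Ls_mult[OF keys_tuple_frag[OF c(1)] keys_tuple_frag[OF d(1)], symmetric])
  finally show "canonical (X \<otimes>\<^bsub>Pt g L\<^esub> Y) = canonical X \<otimes>\<^bsub>Ls g L\<^esub> canonical Y" .
qed

section \<open>Uniqueness of the canonical map\<close>

definition positive_simplex :: "(real ^ 'n option) list \<Rightarrow> bool" where
  "positive_simplex vs \<longleftrightarrow> set vs \<subseteq> model_space g \<and> (\<forall>v\<in>set vs. point_of g v \<in> points L) \<and>
     agrees_with_orientation b vs"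

lemma positive_simplex_iff: "positive_simplex vs \<longleftrightarrow> vs \<in> vertex_lists \<and> orient vs > 0"
  unfolding positive_simplex_def agrees_with_orientation_iff[OF basis]
  by (auto simp: vertex_lists_def vertices_def orient_def)

lemma positive_simplex_frag: "orient vs > 0 \<Longrightarrow> simplex_frag vs = frag_of (gsimplex g vs)"
  by (simp add: simplex_frag_def isgn_def)

lemma canonical_simplex:
  assumes "positive_simplex vs"
  shows "canonical (Pt_class g L (gsimplex g vs)) = Ls_class g L (map (point_of g) vs)"
proof -
  have vs: "vs \<in> vertex_lists" "orient vs > 0" using assms by (auto simp: positive_simplex_iff)
  then have "canonical (Pt_cl (poly_frag (frag_of vs))) = Ls_cl (tuple_frag (frag_of vs))"
    by (intro canonical_poly_frag) (simp add: keys_frag_of)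
  then show ?thesis
    using positive_simplex_frag[OF vs(2)] by (simp add: Pt_class_eq Ls_class_eq poly_frag_def tuple_frag_def)
qed

text \<open>Positively oriented simplices generate the polytope group: a degenerate list has
  \<open>poly_frag\<close> equal to 0, and a negatively oriented one is cancelled by the positive
  list with its first two vertices exchanged. \<open>Q_cancel\<close> makes the property pass to
  differences, as induction over the free abelian group requires.\<close>

lemma canonical_unique:
  assumes hom: "\<phi> \<in> hom (Pt g L) (Ls g L)"
    and simplex: "\<And>vs. positive_simplex vs \<Longrightarrow> \<phi> (Pt_class g L (gsimplex g vs)) = Ls_class g L (map (point_of g) vs)"
    and c: "Poly_Mapping.keys c \<subseteq> vertex_lists"
  shows "\<phi> (Pt_cl (poly_frag c)) = Ls_cl (tuple_frag c)"
proof -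
  interpret G: group "Pt g L" by (rule group_Pt)
  interpret H: group "Ls g L" by (rule group_Ls)
  interpret \<phi>: group_hom "Pt g L" "Ls g L" \<phi> by unfold_locales (rule hom)
  define Q where "Q c \<longleftrightarrow> \<phi> (Pt_cl (poly_frag c)) = Ls_cl (tuple_frag c)" for c
  have Q0: "Q 0" using \<phi>.hom_one by (simp add: Q_def poly_frag_def tuple_frag_def Pt_one Ls_one)
  have Q_cancel: "Q y" if x: "Poly_Mapping.keys x \<subseteq> vertex_lists" "Q x"
    and y: "Poly_Mapping.keys y \<subseteq> vertex_lists" and xy: "Q (x + y)" for x y
  proof -
    have X: "Pt_cl (poly_frag x) \<in> carrier (Pt g L)" and Y: "Pt_cl (poly_frag y) \<in> carrier (Pt g L)"
      unfolding Pt_carrier_poly_frag using x y by blast+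
    have TX: "Ls_cl (tuple_frag x) \<in> carrier (Ls g L)" and TY: "Ls_cl (tuple_frag y) \<in> carrier (Ls g L)"
      unfolding Ls_carrier_tuple_frag using x y by blast+
    have "\<phi> (Pt_cl (poly_frag x)) \<otimes>\<^bsub>Ls g L\<^esub> \<phi> (Pt_cl (poly_frag y)) = \<phi> (Pt_cl (poly_frag x) \<otimes>\<^bsub>Pt g L\<^esub> Pt_cl (poly_frag y))"
      using X Y by simp
    also have "Pt_cl (poly_frag x) \<otimes>\<^bsub>Pt g L\<^esub> Pt_cl (poly_frag y) = Pt_cl (poly_frag (x + y))"
      unfolding poly_frag_add by (rule Pt_mult[OF keys_poly_frag[OF x(1)] keys_poly_frag[OF y]])
    also have "\<phi> \<dots> = Ls_cl (tuple_frag (x + y))" using xy by (simp only: Q_def)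
    also have "\<dots> = Ls_cl (tuple_frag x) \<otimes>\<^bsub>Ls g L\<^esub> Ls_cl (tuple_frag y)"
      unfolding tuple_frag_add by (rule Ls_mult[OF keys_tuple_frag[OF x(1)] keys_tuple_frag[OF y], symmetric])
    finally have "Ls_cl (tuple_frag x) \<otimes>\<^bsub>Ls g L\<^esub> \<phi> (Pt_cl (poly_frag y)) = Ls_cl (tuple_frag x) \<otimes>\<^bsub>Ls g L\<^esub> Ls_cl (tuple_frag y)"
      using x(2) by (simp only: Q_def)
    then have "\<phi> (Pt_cl (poly_frag y)) = Ls_cl (tuple_frag y)"
      using TX TY \<phi>.hom_closed[OF Y] H.Units_l_cancel H.Units_eq by blast
    then show ?thesis by (simp only: Q_def)
  qed
  have Q_null: "Q x" if "Poly_Mapping.keys x \<subseteq> vertex_lists" "poly_frag x = 0" for x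
  proof -
    have "Pt_cl (poly_frag x) = Pt_cl (poly_frag 0)" using that(2) by (simp add: poly_frag_def)
    moreover from this have "Ls_cl (tuple_frag x) = Ls_cl (tuple_frag 0)"
      by (intro Ls_cl_well_defined that) auto
    ultimately show ?thesis using Q0 by (simp only: Q_def)
  qed
  have Q_pos: "Q (frag_of vs)" if "vs \<in> vertex_lists" "orient vs > 0" for vs
    using simplex[of vs] that positive_simplex_frag[of vs]
    by (simp add: Q_def positive_simplex_iff Pt_class_eq Ls_class_eq poly_frag_def tuple_frag_def)
  have Q_of: "Q (frag_of vs)" if vs: "vs \<in> vertex_lists" for vs
  proof (cases "orient vs" "0 :: real" rule: linorder_cases)
    case greater
    then show ?thesis using Q_pos vs by simp
  next
    case equal
    then show ?thesis using vs by (intro Q_null) (auto simp: keys_frag_of poly_frag_def simplex_frag_def)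
  next
    case less
    \<comment> \<open>There are at least two vertices to exchange, as
      \<open>n \<ge> 1\<close>.\<close>
    obtain x y r where xy: "vs = x # y # r"
      using vs zero_less_card_finite[where 'a = 'n] by (cases vs rule: remdups_adj.cases) (auto simp: vertex_lists_def)
    define ws where "ws = y # x # r"
    have ws: "ws \<in> vertex_lists" using vs by (auto simp: ws_def xy vertex_lists_def)
    have o: "orient vs = - orient ws"
      using swap[of "[]" r x y] vs DIM_eq[where 'n = 'n] by (simp add: ws_def xy vertex_lists_def)
    have "gsimplex g vs = gsimplex g ws" by (rule gsimplex_cong) (auto simp: ws_def xy)
    then have "simplex_frag ws + simplex_frag vs = 0"
      by (simp only: simplex_frag_def o isgn_minus zmod.scale_minus_left add.right_inverse)
    then have "Q (frag_of ws + frag_of vs)"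
      using vs ws by (intro Q_null keys_add_subset) (auto simp: keys_frag_of poly_frag_def frag_extend_add)
    then show ?thesis
      using Q_pos[OF ws] less o vs ws by (intro Q_cancel[of "frag_of ws" "frag_of vs"]) (auto simp: keys_frag_of)
  qed
  have "Q c"
  proof (rule free_Abelian_group_induct[OF c])
    show "Q (x - y)" if "Poly_Mapping.keys x \<subseteq> vertex_lists" "Poly_Mapping.keys y \<subseteq> vertex_lists" "Q x" "Q y" for x y
      using that by (intro Q_cancel[of y "x - y"] keys_diff_subset) simp_all
  qed (simp_all add: Q0 Q_of)
  then show ?thesis by (simp only: Q_def)
qed

theorem canonical_map_eq: "canonical_map g L b = canonical"
  unfolding canonical_map_def positive_simplex_def[symmetric]
proof (rule the_equality, intro conjI allI impI canonical_hom)
  show "canonical \<in> extensional (carrier (Pt g L))" by (simp add: canonical_def)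
  fix \<phi> assume \<phi>: "\<phi> \<in> hom (Pt g L) (Ls g L) \<and> \<phi> \<in> extensional (carrier (Pt g L)) \<and>
    (\<forall>vs. positive_simplex vs \<longrightarrow> \<phi> (Pt_class g L (gsimplex g vs)) = Ls_class g L (map (point_of g) vs))"
  show "\<phi> = canonical"
  proof (rule extensionalityI[of _ "carrier (Pt g L)"])
    fix X assume "X \<in> carrier (Pt g L)"
    then obtain c where c: "Poly_Mapping.keys c \<subseteq> vertex_lists" "X = Pt_cl (poly_frag c)"
      unfolding Pt_carrier_poly_frag by blast
    show "\<phi> X = canonical X" unfolding c(2) canonical_poly_frag[OF c(1)] using \<phi> c(1) by (intro canonical_unique) auto
  qed (use \<phi> in \<open>auto simp: canonical_def\<close>)
qed (use canonical_simplex in auto)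

section \<open>Surjectivity and kernel of the canonical map\<close>

lemma canonical_surj: "canonical ` carrier (Pt g L) = carrier (Ls g L)"
  unfolding Pt_carrier_poly_frag Ls_carrier_tuple_frag using canonical_poly_frag by (auto simp: image_iff)

lemma canonical_kernel_join_span:
  assumes "Poly_Mapping.keys c \<subseteq> vertex_lists" "canonical (Pt_cl (poly_frag c)) = \<one>\<^bsub>Ls g L\<^esub>"
  shows "\<exists>j\<in>zmod.span (frag_of ` joins). Pt_cl (poly_frag c) = Pt_cl j"
proof -
  have "Ls_cl (tuple_frag c) = Ls_cl 0" using assms by (simp add: canonical_poly_frag Ls_one)
  then have "tuple_frag c \<in> Ls_null g L" by (simp add: Ls_cl_eq_iff)
  then obtain j where j: "j \<in> zmod.span (frag_of ` joins)" "negligible_frag (poly_frag c - j)"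
    using poly_frag_join_span[OF assms(1)] by (auto simp: join_span_def)
  have "Poly_Mapping.keys j \<subseteq> L_polytopes g L"
    using joins_L_polytopes by (intro keys_in_span[OF j(1)]) (auto simp: keys_frag_of)
  then have "poly_frag c - j \<in> Pt_null g L"
    using Pt_null_iff[OF keys_diff_subset[OF keys_poly_frag[OF assms(1)]]] j(2) by blast
  then show ?thesis using j(1) Pt_cl_eq_iff by blast
qed

lemma canonical_iso:
  assumes "g \<noteq> Spherical"
  shows "canonical \<in> iso (Pt g L) (Ls g L)"
proof -
  have "inj_on canonical (carrier (Pt g L))"
  proof (rule inj_onI)
    fix X Y assume "X \<in> carrier (Pt g L)" "Y \<in> carrier (Pt g L)" and eq: "canonical X = canonical Y"
    then obtain c d where c: "Poly_Mapping.keys c \<subseteq> vertex_lists" "X = Pt_cl (poly_frag c)"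
      and d: "Poly_Mapping.keys d \<subseteq> vertex_lists" "Y = Pt_cl (poly_frag d)"
      unfolding Pt_carrier_poly_frag by blast
    have "Ls_cl (tuple_frag (c - d)) = Ls_cl 0"
      using eq c d by (simp add: canonical_poly_frag Ls_cl_eq_iff tuple_frag_diff)
    then have "canonical (Pt_cl (poly_frag (c - d))) = \<one>\<^bsub>Ls g L\<^esub>"
      using canonical_poly_frag[OF keys_diff_subset[OF c(1) d(1)]] by (simp add: Ls_one)
    then obtain j where j: "j \<in> zmod.span (frag_of ` joins)" "Pt_cl (poly_frag (c - d)) = Pt_cl j"
      using canonical_kernel_join_span[OF keys_diff_subset[OF c(1) d(1)]] by blast
    \<comment> \<open>Off the sphere there are no joins, so their span is trivial.\<close>
    have "j = 0" using j(1) assms by (simp add: joins_def)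
    then have "poly_frag c - poly_frag d \<in> Pt_null g L" using j(2) by (simp add: Pt_cl_eq_iff poly_frag_diff)
    then show "X = Y" unfolding c(2) d(2) Pt_cl_eq_iff .
  qed
  then show ?thesis using canonical_hom canonical_surj by (simp add: iso_def bij_betw_def)
qed

lemma canonical_kernel:
  "kernel (Pt g L) (Ls g L) canonical = generate (Pt g L) (Pt_class g L ` joins)"
proof
  interpret G: group "Pt g L" by (rule group_Pt)
  interpret H: group "Ls g L" by (rule group_Ls)
  interpret canonical: group_hom "Pt g L" "Ls g L" canonical by unfold_locales (rule canonical_hom)
  let ?K = "generate (Pt g L) (Pt_class g L ` joins)"
  have carr: "Pt_class g L ` joins \<subseteq> carrier (Pt g L)"
    unfolding Pt_carrier Pt_class_eq using joins_L_polytopes by (force simp: keys_frag_of)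
  show "?K \<subseteq> kernel (Pt g L) (Ls g L) canonical"
  proof (rule G.generate_subgroup_incl[OF _ canonical.subgroup_kernel], rule subsetI)
    fix X assume "X \<in> Pt_class g L ` joins"
    then obtain J where J: "J \<in> joins" "X = Pt_cl (frag_of J)" by (auto simp: Pt_class_eq)
    obtain c where c: "Poly_Mapping.keys c \<subseteq> vertex_lists" "tuple_frag c = 0" "negligible_frag (frag_of J - poly_frag c)"
      using join_is_poly_frag[OF J(1)] by blast
    have "Poly_Mapping.keys (frag_of J - poly_frag c) \<subseteq> L_polytopes g L"
      using J(1) joins_L_polytopes keys_poly_frag[OF c(1)] by (intro keys_diff_subset) (auto simp: keys_frag_of)
    then have "X = Pt_cl (poly_frag c)" unfolding J(2) Pt_cl_eq_iff using Pt_null_iff c(3) by blast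
    then have "canonical X = \<one>\<^bsub>Ls g L\<^esub>" using canonical_poly_frag[OF c(1)] c(2) by (simp add: Ls_one)
    moreover have "X \<in> carrier (Pt g L)"
      unfolding \<open>X = Pt_cl (poly_frag c)\<close> Pt_carrier_poly_frag using c(1) by blast
    ultimately show "X \<in> kernel (Pt g L) (Ls g L) canonical" by (simp add: kernel_def)
  qed
  have K: "subgroup ?K (Pt g L)" by (rule G.generate_is_subgroup[OF carr])
  have sub: "frag_of ` joins \<subseteq> carrier (free_Abelian_group (L_polytopes g L))"
    using joins_L_polytopes by (auto simp: keys_frag_of)
  have span_K: "Poly_Mapping.keys j \<subseteq> L_polytopes g L \<and> Pt_cl j \<in> ?K" if "j \<in> zmod.span (frag_of ` joins)" for j
    using that unfolding generate_free_Abelian_group[OF sub, symmetric]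
  proof (induction rule: generate.induct)
    case one
    then show ?case using subgroup.one_closed[OF K] by (simp add: Pt_one)
  next
    case (incl h)
    then show ?case using joins_L_polytopes by (auto simp: keys_frag_of Pt_class_eq intro!: generate.incl)
  next
    case (inv h)
    then obtain J where J: "J \<in> joins" "h = frag_of J" by auto
    have keys: "Poly_Mapping.keys h \<subseteq> L_polytopes g L" using J joins_L_polytopes by (auto simp: keys_frag_of)
    have hK: "Pt_cl h \<in> ?K" using J by (auto simp: Pt_class_eq intro!: generate.incl)
    have "Pt_cl (- h) \<otimes>\<^bsub>Pt g L\<^esub> Pt_cl h = \<one>\<^bsub>Pt g L\<^esub>"
      using Pt_mult[of "- h" h] keys by (simp add: Pt_one keys_minus)
    moreover have "Pt_cl h \<in> carrier (Pt g L)" "Pt_cl (- h) \<in> carrier (Pt g L)"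
      unfolding Pt_carrier using keys keys_minus[of h] by blast+
    ultimately have "Pt_cl (- h) = inv\<^bsub>Pt g L\<^esub> Pt_cl h" by (metis G.inv_equality)
    then show ?case using subgroup.m_inv_closed[OF K hK] keys by (simp add: keys_minus)
  next
    case (eng h1 h2)
    then have "Pt_cl h1 \<otimes>\<^bsub>Pt g L\<^esub> Pt_cl h2 \<in> ?K" by (intro subgroup.m_closed[OF K]) auto
    then show ?case using eng Pt_mult[of h1 h2] keys_add_subset[of h1 _ h2] by simp
  qed
  show "kernel (Pt g L) (Ls g L) canonical \<subseteq> ?K"
  proof
    fix X assume X: "X \<in> kernel (Pt g L) (Ls g L) canonical"
    then obtain c where c: "Poly_Mapping.keys c \<subseteq> vertex_lists" "X = Pt_cl (poly_frag c)"
      unfolding kernel_def Pt_carrier_poly_frag by blast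
    then have "canonical (Pt_cl (poly_frag c)) = \<one>\<^bsub>Ls g L\<^esub>" using X by (simp add: kernel_def)
    then obtain j where "j \<in> zmod.span (frag_of ` joins)" "X = Pt_cl j"
      using canonical_kernel_join_span[OF c(1)] c(2) by blast
    then show "X \<in> ?K" using span_K by blast
  qed
qed

end

theorem theorem6p4:
  fixes g :: geometry
    and L :: "(real ^ 'n::finite option) set set"
    and b :: "(real ^ 'n option) list"
  assumes "\<forall>A\<in>L. geometric_subspace g A \<and> A \<noteq> {}"
    and "model_space g \<in> L"
    and "generated_by_points g L"
    and "generated_by_hyperplanes g L"
    and "ordered_basis b"
  shows "(g = Euclidean \<longrightarrow> canonical_map g L b \<in> iso (Pt g L) (Ls g L)) \<and>
         (g = Hyperbolic \<longrightarrow> canonical_map g L b \<in> iso (Pt g L) (Ls g L)) \<and>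
         (g = Spherical \<longrightarrow>
            canonical_map g L b \<in> epi (Pt g L) (Ls g L) \<and>
            kernel (Pt g L) (Ls g L) (canonical_map g L b) =
              generate (Pt g L) (Pt_class g L ` join_polytopes L))"
proof -
  interpret oriented_collection g L b
    by unfold_locales (fact assms)+
  have "canonical_map g L b \<in> iso (Pt g L) (Ls g L)" if "g \<noteq> Spherical"
    unfolding canonical_map_eq by (rule canonical_iso[OF that])
  moreover have "canonical_map g L b \<in> epi (Pt g L) (Ls g L)"
    unfolding canonical_map_eq epi_def using canonical_hom canonical_surj by blast
  moreover have "kernel (Pt g L) (Ls g L) (canonical_map g L b) =
      generate (Pt g L) (Pt_class g L ` join_polytopes L)" if "g = Spherical"
    using canonical_kernel unfolding canonical_map_eq joins_def if_P[OF that] .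
  ultimately show ?thesis by blast
qed

end
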